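(* Let $(\mathcal{H},\langle\cdot,\cdot\rangle)$ be a separable complex Hilbert space, let $E$ be $\mathcal{H}$ regarded as a real space with symplectic form $\sigma=\operatorname{Im}\langle\cdot,\cdot\rangle$, let $\beta>0$, and let $H>0$ be a self-adjoint operator on $\mathcal{H}$ with compact resolvent such that $\operatorname{Tr}H^{-s}<+\infty$ for some $s>0$. Let $\delta_0$ be the pointwise closed, linear, continuous weak derivation defined by $\delta_0(W^0(f))=i\Phi_0(iHf)W^0(f)$ for $f\in D(H)$, and let $X(u)=iHu$. If $\omega_0$ is a state on $\mathcal{W}(E,0)$ which is a $(\delta_0,\beta)$-weak KMS state, then there exists a Borel probability measure $\mu_0$ on $\mathcal{H}^{-s}$ which is a $(\beta,X)$-KMS state and whose Fourier transform is given by $$\hat\mu_0(f)=\omega_0(W^0(f)),\qquad f\in\mathcal{H}^s .$$ Conversely, if a Borel probability measure $\mu_0$ on $\mathcal{H}^{-s}$ is a $(\beta,X)$-KMS state, then the algebraic state on $\mathcal{W}(E,0)$ obtained by extending $$\omega_0(W^0(f)):=\hat\mu_0(f),\qquad f\in\mathcal{H}^s,$$ (by norm-continuity in $f$ to all $f\in E$, then by linearity and continuity to $\mathcal{W}(E,0)$) is a $(\delta_0,\beta)$-weak KMS state.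
   Context: Inner products are linear in the second argument. $\mathcal{W}(E,0)$ is the commutative $C^*$-algebra obtained as the sup-norm closure of $\Delta(E,0)=\operatorname{span}\{W^0(f):f\in E\}$, where $W^0(f)$ is the function $W^0(f)[g]=e^{i\operatorname{Re}\langle f,g\rangle}$ on $E$. Poisson bracket on $\Delta(E,0)$: bilinear with $\{W^0(f),W^0(g)\}=\sigma(g,f)W^0(f+g)$. Field functions: $\Phi_0(f)[g]=\operatorname{Re}\langle f,g\rangle$. A weak derivation is a linear map $\delta_0$ from a $*$-subalgebra $D(\delta_0)\subset\Delta(E,0)$ to the weakly continuous complex functions on $E$ (identified with its norm dual), with $\delta_0(A)^*=\delta_0(A^* )$ and $\delta_0(AB)=\delta_0(A)B+A\delta_0(B)$, such that $E(\delta_0)=\{f\in E:W^0(f)\in D(\delta_0)\}$ is a dense subspace of $E$. It is continuous if $\lambda\mapsto\delta_0(W^0(\lambda f))$ is pointwise continuous for $f\in E(\delta_0)$; linear if $W^0(-f)\delta_0(W^0(f))$ is $\mathbb{R}$-linear for $f\in E(\delta_0)$; pointwise closed if $f_n\in E(\delta_0)$, $f_n\to f$ weakly and $\delta_0(W^0(f_n))\to\Psi$ pointwise with $\Psi$ weakly continuous imply $f\in E(\delta_0)$ and $\Psi=\delta_0(W^0(f))$. For the $\delta_0$ of the claim, $E(\delta_0)=D(H)$ and $D(\delta_0)=\operatorname{span}\{W^0(f):f\in D(H)\}$. A state $\omega$ on $\mathcal{W}(E,0)$ with GNS triple $(\mathcal{H}_\omega,\pi_\omega,\Omega_\omega)$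 is of class $C^2$ if $t\mapsto\pi_\omega(W^0(tf))$ is strongly continuous for every $f\in E$ and $\Omega_\omega$ lies in the domain of its self-adjoint generator $\Phi_\omega(f)$ for every $f\in E$; then $\omega(\Phi_0(f)W^0(g)):=\langle\Omega_\omega,\Phi_\omega(f)\pi_\omega(W^0(g))\Omega_\omega\rangle=-i\frac{d}{dt}\omega(W^0(g+tf))|_{t=0}$. A state $\omega$ is a $(\delta_0,\beta)$-weak KMS state if it is of class $C^2$ and $\omega(\{a,b\})=\beta\,\omega(b\,\delta_0(a))$ for all $a,b\in D(\delta_0)$. Sobolev spaces: $\mathcal{H}^s=D(H^{s/2})$ with inner product $\operatorname{Re}\langle H^{s/2}f,H^{s/2}g\rangle$; $\mathcal{H}^{-s}$ is the completion of $E$ for the inner product $\operatorname{Re}\langle H^{-s/2}f,H^{-s/2}g\rangle$; the real duality pairing $\langle f,u\rangle$, $f\in\mathcal{H}^s$, $u\in\mathcal{H}^{-s}$, extends $\operatorname{Re}\langle f,u\rangle$. The Fourier transform of $\mu$ is $\hat\mu(f)=\int_{\mathcal{H}^{-s}}e^{i\langle f,u\rangle}d\mu(u)$. Let $(e_k)$ be an orthonormal basis of $\mathcal{H}$ of eigenvectors of $H$, $f_k=ie_k$, $\pi_n(u)=(\langle e_1,u\rangle,\dots,\langle e_n,u\rangle,\langle f_1,u\rangle,\dots,\langle f_n,u\rangle)$. $C^\infty_{c,cyl}(\mathcal{H}^{-s})$ is the set of $F=\varphi\circ\pi_n$ with $n\in\mathbb{N}$, $\varphi\in C_c^\infty(\mathbb{R}^{2n})$;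 $\nabla F(u)=\sum_{j=1}^n(\partial_j\varphi)(\pi_n(u))e_j+(\partial_{n+j}\varphi)(\pi_n(u))f_j$ and $\{F,G\}(u)=\sigma(\nabla F(u),\nabla G(u))$. The Borel vector field $X(u)=iHu$ on $\mathcal{H}^{-s}$ is understood distributionally: $\langle\varphi,X(u)\rangle=\langle -iH\varphi,u\rangle$. A Borel probability measure $\mu$ on $\mathcal{H}^{-s}$ is a $(\beta,X)$-KMS state if $\langle\varphi,X(\cdot)\rangle$ is $\mu$-integrable for all $\varphi\in\mathcal{H}^s$ and $\int\{F,G\}\,d\mu=\beta\int\langle\nabla F(u),X(u)\rangle G(u)\,d\mu(u)$ for all $F,G\in C^\infty_{c,cyl}(\mathcal{H}^{-s})$.
   Formalization: ⟨φ,X(u)⟩ is taken as ⟨iHφ,u⟩ (with −iH no KMS measure exists on a nonzero space), tested only for φ∈H^s∩D(H) with Hφ∈H^s, where it is defined; in the first half μ̂0(f)=ω0(W0(f)) is for f∈H^s in D(H) or where f↦ω0(W0(f)) is norm-continuous (automatic if s≥2). *)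

theory Defs
  imports "HOL-Probability.Probability"
begin

section \<open>Complex Hilbert spaces and self-adjoint operators\<close>

text \<open>
  A complex Hilbert space, with inner product \<open>cinner\<close> linear in the second argument. The
  superclass \<^class>\<open>real_inner\<close> makes the same type the real Hilbert space \<open>E\<close>, with inner product
  \<open>Re (cinner f g)\<close>.
\<close>

class complex_hilbert = real_inner + complete_space +
  fixes scaleC :: "complex \<Rightarrow> 'a \<Rightarrow> 'a" (infixr "*\<^sub>C" 75)
    and cinner :: "'a \<Rightarrow> 'a \<Rightarrow> complex"
  assumes scaleC_add_right: "c *\<^sub>C (x + y) = c *\<^sub>C x + c *\<^sub>C y"
    and scaleC_add_left: "(c + d) *\<^sub>C x = c *\<^sub>C x + d *\<^sub>C x"
    and scaleC_scaleC: "c *\<^sub>C (d *\<^sub>C x) = (c * d) *\<^sub>C x"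
    and scaleR_scaleC: "r *\<^sub>R x = complex_of_real r *\<^sub>C x"
    and cinner_commute: "cinner x y = cnj (cinner y x)"
    and cinner_add_right: "cinner x (y + z) = cinner x y + cinner x z"
    and cinner_scaleC_right: "cinner x (c *\<^sub>C y) = c * cinner x y"
    and inner_eq_Re_cinner: "inner x y = Re (cinner x y)"

definition sigma :: "'a::complex_hilbert \<Rightarrow> 'a \<Rightarrow> real" where
  "sigma f g = Im (cinner f g)"

text \<open>Unbounded operators are given by a domain \<open>D\<close> and a map \<open>H\<close> that is relevant only on \<open>D\<close>.\<close>

definition clinear_operator :: "'a::complex_hilbert set \<Rightarrow> ('a \<Rightarrow> 'a) \<Rightarrow> bool" where
  "clinear_operator D H \<longleftrightarrow>
     0 \<in> D \<and>
     (\<forall>f\<in>D. \<forall>g\<in>D. \<forall>c d. c *\<^sub>C f + d *\<^sub>C g \<in> D \<and> H (c *\<^sub>C f + d *\<^sub>C g) = c *\<^sub>C H f + d *\<^sub>C H g)"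

definition adjoint_graph :: "'a::complex_hilbert set \<Rightarrow> ('a \<Rightarrow> 'a) \<Rightarrow> ('a \<times> 'a) set" where
  "adjoint_graph D H = {(g, h). \<forall>f\<in>D. cinner (H f) g = cinner f h}"

definition selfadjoint_operator :: "'a::complex_hilbert set \<Rightarrow> ('a \<Rightarrow> 'a) \<Rightarrow> bool" where
  "selfadjoint_operator D H \<longleftrightarrow>
     clinear_operator D H \<and> closure D = UNIV \<and> adjoint_graph D H = {(g, H g) | g. g \<in> D}"

definition positive_operator :: "'a::complex_hilbert set \<Rightarrow> ('a \<Rightarrow> 'a) \<Rightarrow> bool" where
  "positive_operator D H \<longleftrightarrow> (\<forall>f\<in>D. f \<noteq> 0 \<longrightarrow> 0 < Re (cinner f (H f)))"

definition resolvent :: "'a::complex_hilbert set \<Rightarrow> ('a \<Rightarrow> 'a) \<Rightarrow> complex \<Rightarrow> 'a \<Rightarrow> 'a" where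
  "resolvent D H z = inv_into D (\<lambda>f. H f - z *\<^sub>C f)"

definition resolvent_set :: "'a::complex_hilbert set \<Rightarrow> ('a \<Rightarrow> 'a) \<Rightarrow> complex set" where
  "resolvent_set D H =
     {z. bij_betw (\<lambda>f. H f - z *\<^sub>C f) D UNIV \<and> (\<exists>C. \<forall>g. norm (resolvent D H z g) \<le> C * norm g)}"

definition compact_operator :: "('a::real_normed_vector \<Rightarrow> 'b::real_normed_vector) \<Rightarrow> bool" where
  "compact_operator T \<longleftrightarrow> (\<forall>S. bounded S \<longrightarrow> compact (closure (T ` S)))"

definition compact_resolvent :: "'a::complex_hilbert set \<Rightarrow> ('a \<Rightarrow> 'a) \<Rightarrow> bool" where
  "compact_resolvent D H \<longleftrightarrow> (\<exists>z\<in>resolvent_set D H. compact_operator (resolvent D H z))"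

text \<open>
  An orthonormal basis \<open>e\<close> of eigenvectors, indexed from 0 by \<open>I\<close>: all of \<^typ>\<open>nat\<close>, or an initial
  segment if the space has finite dimension.
\<close>

definition eigenvalue :: "('a::complex_hilbert \<Rightarrow> 'a) \<Rightarrow> (nat \<Rightarrow> 'a) \<Rightarrow> nat \<Rightarrow> real" where
  "eigenvalue H e k = Re (cinner (e k) (H (e k)))"

definition eigenbasis ::
  "'a::complex_hilbert set \<Rightarrow> ('a \<Rightarrow> 'a) \<Rightarrow> nat set \<Rightarrow> (nat \<Rightarrow> 'a) \<Rightarrow> bool" where
  "eigenbasis D H I e \<longleftrightarrow>
     (I = UNIV \<or> (\<exists>N. I = {..<N})) \<and>
     (\<forall>j\<in>I. \<forall>k\<in>I. cinner (e j) (e k) = (if j = k then 1 else 0)) \<and>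
     closure {(\<Sum>k\<in>F. c k *\<^sub>C e k) | F c. finite F \<and> F \<subseteq> I} = UNIV \<and>
     (\<forall>k\<in>I. e k \<in> D \<and> H (e k) = complex_of_real (eigenvalue H e k) *\<^sub>C e k)"

text \<open>
  The real powers \<open>H\<^sup>r\<close> given by the functional calculus of the positive operator \<open>H\<close>, and their
  domains. Neither depends on the choice of the eigenbasis.
\<close>

definition Hpow_dom ::
  "('a::complex_hilbert \<Rightarrow> 'a) \<Rightarrow> nat set \<Rightarrow> (nat \<Rightarrow> 'a) \<Rightarrow> real \<Rightarrow> 'a set" where
  "Hpow_dom H I e r =
     {f. (\<lambda>k. (eigenvalue H e k powr r * cmod (cinner (e k) f))\<^sup>2) summable_on I}"

definition Hpow ::
  "('a::complex_hilbert \<Rightarrow> 'a) \<Rightarrow> nat set \<Rightarrow> (nat \<Rightarrow> 'a) \<Rightarrow> real \<Rightarrow> 'a \<Rightarrow> 'a" where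
  "Hpow H I e r f =
     (\<Sum>\<^sub>\<infinity>k\<in>I. (complex_of_real (eigenvalue H e k powr r) * cinner (e k) f) *\<^sub>C e k)"

definition trace_finite ::
  "('a::complex_hilbert \<Rightarrow> 'a) \<Rightarrow> nat set \<Rightarrow> (nat \<Rightarrow> 'a) \<Rightarrow> real \<Rightarrow> bool" where
  "trace_finite H I e r \<longleftrightarrow> (\<lambda>k. Re (cinner (e k) (Hpow H I e r (e k)))) summable_on I"


section \<open>The commutative Weyl algebra\<close>

definition fun_span :: "('x \<Rightarrow> complex) set \<Rightarrow> ('x \<Rightarrow> complex) set" where
  "fun_span S = {(\<lambda>u. \<Sum>g\<in>T. c g * g u) | T c. finite T \<and> T \<subseteq> S}"

definition clinear_functional_on :: "('x \<Rightarrow> complex) set \<Rightarrow> (('x \<Rightarrow> complex) \<Rightarrow> complex) \<Rightarrow> bool" where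
  "clinear_functional_on S L \<longleftrightarrow>
     (\<forall>A\<in>S. \<forall>B\<in>S. \<forall>c d. L (\<lambda>u. c * A u + d * B u) = c * L A + d * L B)"

definition W0 :: "'a::complex_hilbert \<Rightarrow> 'a \<Rightarrow> complex" where
  "W0 f = (\<lambda>g. exp (\<i> * complex_of_real (inner f g)))"

definition Phi0 :: "'a::complex_hilbert \<Rightarrow> 'a \<Rightarrow> complex" where
  "Phi0 f = (\<lambda>g. complex_of_real (inner f g))"

definition Weyl_span :: "('a::complex_hilbert \<Rightarrow> complex) set" where
  "Weyl_span = fun_span (range W0)"

definition Weyl_algebra :: "('a::complex_hilbert \<Rightarrow> complex) set" where
  "Weyl_algebra = {A. \<forall>\<epsilon>>0. \<exists>B\<in>Weyl_span. \<forall>u. cmod (A u - B u) \<le> \<epsilon>}"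

definition poisson_bracket ::
  "(('a::complex_hilbert \<Rightarrow> complex) \<Rightarrow> ('a \<Rightarrow> complex) \<Rightarrow> ('a \<Rightarrow> complex)) \<Rightarrow> bool" where
  "poisson_bracket PB \<longleftrightarrow>
     (\<forall>B\<in>Weyl_span. \<forall>u. clinear_functional_on Weyl_span (\<lambda>A. PB A B u)) \<and>
     (\<forall>A\<in>Weyl_span. \<forall>u. clinear_functional_on Weyl_span (\<lambda>B. PB A B u)) \<and>
     (\<forall>f g. PB (W0 f) (W0 g) = (\<lambda>u. complex_of_real (sigma g f) * W0 (f + g) u))"


section \<open>Weak derivations\<close>

definition weak_topology :: "'a::complex_hilbert topology" where
  "weak_topology = topology_generated_by {(\<lambda>g. inner f g) -` U | f U. open U}"

definition weakly_continuous :: "('a::complex_hilbert \<Rightarrow> complex) \<Rightarrow> bool" where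
  "weakly_continuous F \<longleftrightarrow> continuous_map weak_topology euclidean F"

text \<open>The subspace \<open>E(\<delta>)\<close> of a derivation \<open>\<delta>\<close> with domain \<open>A0\<close>.\<close>

definition Weyl_dom :: "('a::complex_hilbert \<Rightarrow> complex) set \<Rightarrow> 'a set" where
  "Weyl_dom A0 = {f. W0 f \<in> A0}"

definition star_subalgebra :: "('a::complex_hilbert \<Rightarrow> complex) set \<Rightarrow> bool" where
  "star_subalgebra A0 \<longleftrightarrow>
     A0 \<noteq> {} \<and> A0 \<subseteq> Weyl_span \<and>
     (\<forall>A\<in>A0. \<forall>B\<in>A0. \<forall>c d. (\<lambda>u. c * A u + d * B u) \<in> A0) \<and>
     (\<forall>A\<in>A0. \<forall>B\<in>A0. (\<lambda>u. A u * B u) \<in> A0) \<and>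
     (\<forall>A\<in>A0. (\<lambda>u. cnj (A u)) \<in> A0)"

definition weak_derivation ::
  "('a::complex_hilbert \<Rightarrow> complex) set \<Rightarrow> (('a \<Rightarrow> complex) \<Rightarrow> ('a \<Rightarrow> complex)) \<Rightarrow> bool" where
  "weak_derivation A0 \<delta> \<longleftrightarrow>
     star_subalgebra A0 \<and>
     (\<forall>A\<in>A0. weakly_continuous (\<delta> A)) \<and>
     (\<forall>u. clinear_functional_on A0 (\<lambda>A. \<delta> A u)) \<and>
     (\<forall>A\<in>A0. \<delta> (\<lambda>u. cnj (A u)) = (\<lambda>u. cnj (\<delta> A u))) \<and>
     (\<forall>A\<in>A0. \<forall>B\<in>A0. \<delta> (\<lambda>u. A u * B u) = (\<lambda>u. \<delta> A u * B u + A u * \<delta> B u)) \<and>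
     subspace (Weyl_dom A0) \<and> closure (Weyl_dom A0) = UNIV"

definition continuous_derivation ::
  "('a::complex_hilbert \<Rightarrow> complex) set \<Rightarrow> (('a \<Rightarrow> complex) \<Rightarrow> ('a \<Rightarrow> complex)) \<Rightarrow> bool" where
  "continuous_derivation A0 \<delta> \<longleftrightarrow>
     (\<forall>f\<in>Weyl_dom A0. \<forall>u. continuous_on UNIV (\<lambda>t::real. \<delta> (W0 (t *\<^sub>R f)) u))"

definition linear_derivation ::
  "('a::complex_hilbert \<Rightarrow> complex) set \<Rightarrow> (('a \<Rightarrow> complex) \<Rightarrow> ('a \<Rightarrow> complex)) \<Rightarrow> bool" where
  "linear_derivation A0 \<delta> \<longleftrightarrow>
     (\<forall>f\<in>Weyl_dom A0. \<forall>g\<in>Weyl_dom A0. \<forall>(a::real) (b::real). \<forall>u.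
        W0 (- (a *\<^sub>R f + b *\<^sub>R g)) u * \<delta> (W0 (a *\<^sub>R f + b *\<^sub>R g)) u =
        of_real a * (W0 (- f) u * \<delta> (W0 f) u) + of_real b * (W0 (- g) u * \<delta> (W0 g) u))"

definition pointwise_closed_derivation ::
  "('a::complex_hilbert \<Rightarrow> complex) set \<Rightarrow> (('a \<Rightarrow> complex) \<Rightarrow> ('a \<Rightarrow> complex)) \<Rightarrow> bool" where
  "pointwise_closed_derivation A0 \<delta> \<longleftrightarrow>
     (\<forall>fs f \<Psi>. (\<forall>n. fs n \<in> Weyl_dom A0) \<longrightarrow> limitin weak_topology fs f sequentially \<longrightarrow>
        (\<forall>u. (\<lambda>n. \<delta> (W0 (fs n)) u) \<longlonglongrightarrow> \<Psi> u) \<longrightarrow> weakly_continuous \<Psi> \<longrightarrow>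
        f \<in> Weyl_dom A0 \<and> \<Psi> = \<delta> (W0 f))"


section \<open>States, GNS representation, weak KMS states\<close>

definition state :: "(('a::complex_hilbert \<Rightarrow> complex) \<Rightarrow> complex) \<Rightarrow> bool" where
  "state \<omega> \<longleftrightarrow>
     clinear_functional_on Weyl_algebra \<omega> \<and>
     (\<forall>A\<in>Weyl_algebra. \<omega> (\<lambda>u. cnj (A u) * A u) \<in> \<real> \<and> 0 \<le> Re (\<omega> (\<lambda>u. cnj (A u) * A u))) \<and>
     \<omega> (\<lambda>u. 1) = 1"

text \<open>
  The GNS space of \<open>\<omega>\<close> is the completion of the Weyl algebra for the semi-inner product
  \<open>\<omega>(A\<^sup>* B)\<close>. Its vectors are represented by Cauchy sequences, two of them being the same vector iff
  their difference has \<open>gns_norm\<close> zero.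
\<close>

definition gns_space ::
  "(('a::complex_hilbert \<Rightarrow> complex) \<Rightarrow> complex) \<Rightarrow> (nat \<Rightarrow> 'a \<Rightarrow> complex) set" where
  "gns_space \<omega> =
     {A. (\<forall>n. A n \<in> Weyl_algebra) \<and>
         (\<forall>\<epsilon>>0. \<exists>N. \<forall>m\<ge>N. \<forall>n\<ge>N.
            sqrt (Re (\<omega> (\<lambda>u. cnj (A m u - A n u) * (A m u - A n u)))) < \<epsilon>)}"

definition gns_inner ::
  "(('a::complex_hilbert \<Rightarrow> complex) \<Rightarrow> complex) \<Rightarrow> (nat \<Rightarrow> 'a \<Rightarrow> complex) \<Rightarrow> (nat \<Rightarrow> 'a \<Rightarrow> complex)
     \<Rightarrow> complex" where
  "gns_inner \<omega> A B = lim (\<lambda>n. \<omega> (\<lambda>u. cnj (A n u) * B n u))"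

definition gns_norm ::
  "(('a::complex_hilbert \<Rightarrow> complex) \<Rightarrow> complex) \<Rightarrow> (nat \<Rightarrow> 'a \<Rightarrow> complex) \<Rightarrow> real" where
  "gns_norm \<omega> A = sqrt (Re (gns_inner \<omega> A A))"

definition gns_rep :: "('a::complex_hilbert \<Rightarrow> complex) \<Rightarrow> (nat \<Rightarrow> 'a \<Rightarrow> complex) \<Rightarrow> (nat \<Rightarrow> 'a \<Rightarrow> complex)"
  where "gns_rep B A = (\<lambda>n u. B u * A n u)"

definition gns_vac :: "nat \<Rightarrow> 'a::complex_hilbert \<Rightarrow> complex" where
  "gns_vac = (\<lambda>n u. 1)"

text \<open>
  \<open>has_field_value \<omega> f \<xi> \<eta>\<close>: the vector \<open>\<xi>\<close> is in the domain of the generator \<open>\<Phi>\<^sub>\<omega>(f)\<close> of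
  \<open>t \<mapsto> \<pi>\<^sub>\<omega>(W0 (t f)) = exp (i t \<Phi>\<^sub>\<omega>(f))\<close>, and \<open>\<Phi>\<^sub>\<omega>(f) \<xi> = \<eta>\<close>.
\<close>

definition has_field_value ::
  "(('a::complex_hilbert \<Rightarrow> complex) \<Rightarrow> complex) \<Rightarrow> 'a \<Rightarrow> (nat \<Rightarrow> 'a \<Rightarrow> complex)
     \<Rightarrow> (nat \<Rightarrow> 'a \<Rightarrow> complex) \<Rightarrow> bool" where
  "has_field_value \<omega> f \<xi> \<eta> \<longleftrightarrow>
     \<xi> \<in> gns_space \<omega> \<and> \<eta> \<in> gns_space \<omega> \<and>
     ((\<lambda>t::real. gns_norm \<omega>
         (\<lambda>n u. (gns_rep (W0 (t *\<^sub>R f)) \<xi> n u - \<xi> n u) / (\<i> * of_real t) - \<eta> n u)) \<longlongrightarrow> 0) (at 0)"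

definition class_C2 :: "(('a::complex_hilbert \<Rightarrow> complex) \<Rightarrow> complex) \<Rightarrow> bool" where
  "class_C2 \<omega> \<longleftrightarrow>
     (\<forall>f. \<forall>\<xi>\<in>gns_space \<omega>. \<forall>t0::real.
        ((\<lambda>t::real. gns_norm \<omega>
            (\<lambda>n u. gns_rep (W0 (t *\<^sub>R f)) \<xi> n u - gns_rep (W0 (t0 *\<^sub>R f)) \<xi> n u)) \<longlongrightarrow> 0) (at t0)) \<and>
     (\<forall>f. \<exists>\<eta>. has_field_value \<omega> f gns_vac \<eta>)"

text \<open>\<open>\<omega>(\<Phi>\<^sub>0(f) W\<^sup>0(g)) = \<langle>\<Omega>\<^sub>\<omega>, \<Phi>\<^sub>\<omega>(f) \<pi>\<^sub>\<omega>(W\<^sup>0(g)) \<Omega>\<^sub>\<omega>\<rangle>\<close>\<close>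

definition field_expectation :: "(('a::complex_hilbert \<Rightarrow> complex) \<Rightarrow> complex) \<Rightarrow> 'a \<Rightarrow> 'a \<Rightarrow> complex"
  where "field_expectation \<omega> f g =
     gns_inner \<omega> gns_vac (SOME \<eta>. has_field_value \<omega> f (gns_rep (W0 g) gns_vac) \<eta>)"

definition field_span :: "('a::complex_hilbert \<Rightarrow> complex) set" where
  "field_span = fun_span {(\<lambda>u. Phi0 f u * W0 g u) | f g. True}"

text \<open>
  In the KMS condition, \<open>b \<delta>(a)\<close> is unbounded in general; \<open>\<omega>\<close> is evaluated on it through the
  linear extension \<open>\<omega>'\<close> of \<open>\<omega>(\<Phi>\<^sub>0(f) W\<^sup>0(g))\<close>, which is unique on \<^const>\<open>field_span\<close>.
\<close>

definition weak_kms_state ::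
  "(('a::complex_hilbert \<Rightarrow> complex) \<Rightarrow> ('a \<Rightarrow> complex) \<Rightarrow> ('a \<Rightarrow> complex)) \<Rightarrow>
   ('a \<Rightarrow> complex) set \<Rightarrow> (('a \<Rightarrow> complex) \<Rightarrow> ('a \<Rightarrow> complex)) \<Rightarrow> real \<Rightarrow>
   (('a \<Rightarrow> complex) \<Rightarrow> complex) \<Rightarrow> bool" where
  "weak_kms_state PB A0 \<delta> \<beta> \<omega> \<longleftrightarrow>
     state \<omega> \<and> class_C2 \<omega> \<and>
     (\<exists>\<omega>'. clinear_functional_on field_span \<omega>' \<and>
        (\<forall>f g. \<omega>' (\<lambda>u. Phi0 f u * W0 g u) = field_expectation \<omega> f g) \<and>
        (\<forall>a\<in>A0. \<forall>b\<in>A0. \<omega> (PB a b) = of_real \<beta> * \<omega>' (\<lambda>u. b u * \<delta> a u)))"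


section \<open>Negative Sobolev spaces and KMS measures\<close>

text \<open>The Sobolev space \<open>\<H>\<^sup>s\<close> as a set.\<close>

definition sobolev ::
  "('a::complex_hilbert \<Rightarrow> 'a) \<Rightarrow> nat set \<Rightarrow> (nat \<Rightarrow> 'a) \<Rightarrow> real \<Rightarrow> 'a set" where
  "sobolev H I e s = Hpow_dom H I e (s / 2)"

text \<open>
  The type \<open>'b\<close> with the embedding \<open>\<iota>\<close> is a realisation of \<open>\<H>\<^sup>-\<^sup>s\<close>, the completion of \<open>E\<close>;
  completeness is part of the sort of \<open>'b\<close>.
\<close>

definition neg_sobolev_completion ::
  "('a::complex_hilbert \<Rightarrow> 'a) \<Rightarrow> nat set \<Rightarrow> (nat \<Rightarrow> 'a) \<Rightarrow> real \<Rightarrow>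
   ('a \<Rightarrow> 'b::{real_inner,complete_space}) \<Rightarrow> bool" where
  "neg_sobolev_completion H I e s \<iota> \<longleftrightarrow>
     linear \<iota> \<and> closure (range \<iota>) = UNIV \<and>
     (\<forall>f g. inner (\<iota> f) (\<iota> g) = Re (cinner (Hpow H I e (- s / 2) f) (Hpow H I e (- s / 2) g)))"

text \<open>
  The real duality pairing \<open>\<langle>f, u\<rangle>\<close> of \<open>f \<in> \<H>\<^sup>s\<close> and \<open>u \<in> \<H>\<^sup>-\<^sup>s\<close>: the continuous extension of
  \<open>Re \<langle>f, \<cdot>\<rangle>\<close> from \<open>E\<close>. Meaningful only for \<open>f \<in> \<H>\<^sup>s\<close>.
\<close>

definition dual_pairing ::
  "('a::complex_hilbert \<Rightarrow> 'b::{real_inner,complete_space}) \<Rightarrow> 'a \<Rightarrow> 'b \<Rightarrow> real" where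
  "dual_pairing \<iota> f = (THE p. continuous_on UNIV p \<and> (\<forall>g. p (\<iota> g) = inner f g))"

definition fourier ::
  "('a::complex_hilbert \<Rightarrow> 'b::{real_inner,complete_space}) \<Rightarrow> 'b measure \<Rightarrow> 'a \<Rightarrow> complex" where
  "fourier \<iota> \<mu> f = (LINT u|\<mu>. exp (\<i> * complex_of_real (dual_pairing \<iota> f u)))"

text \<open>
  Test functions on \<open>\<real>\<^sup>m\<close>, with variable \<open>m\<close>: functions on \<^typ>\<open>nat \<Rightarrow> real\<close> that depend only on the
  coordinates below \<open>m\<close>, where \<open>\<real>\<^sup>m\<close> is identified with the set of sequences vanishing from \<open>m\<close> on.
\<close>

definition partial_deriv :: "nat \<Rightarrow> ((nat \<Rightarrow> real) \<Rightarrow> real) \<Rightarrow> (nat \<Rightarrow> real) \<Rightarrow> real" where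
  "partial_deriv j \<phi> x = deriv (\<lambda>t. \<phi> (x(j := t))) (x j)"

definition test_function :: "nat \<Rightarrow> ((nat \<Rightarrow> real) \<Rightarrow> real) \<Rightarrow> bool" where
  "test_function m \<phi> \<longleftrightarrow>
     (\<forall>x y. (\<forall>i<m. x i = y i) \<longrightarrow> \<phi> x = \<phi> y) \<and>
     (\<forall>js. set js \<subseteq> {..<m} \<longrightarrow>
        continuous_on UNIV (foldr partial_deriv js \<phi>) \<and>
        (\<forall>j<m. \<forall>x. (\<lambda>t. foldr partial_deriv js \<phi> (x(j := t))) field_differentiable at (x j))) \<and>
     compact (closure {x. (\<forall>i\<ge>m. x i = 0) \<and> \<phi> x \<noteq> 0})"

definition cyl_proj ::
  "(nat \<Rightarrow> 'a::complex_hilbert) \<Rightarrow> ('a \<Rightarrow> 'b::{real_inner,complete_space}) \<Rightarrow> nat \<Rightarrow> 'b \<Rightarrow> nat \<Rightarrow> real"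
  where
  "cyl_proj e \<iota> n u =
     (\<lambda>i. if i < n then dual_pairing \<iota> (e i) u
          else if i < 2 * n then dual_pairing \<iota> (\<i> *\<^sub>C e (i - n)) u
          else 0)"

text \<open>The gradient of the cylindrical function \<open>\<phi> \<circ> \<pi>\<^sub>n\<close>.\<close>

definition cyl_gradient ::
  "(nat \<Rightarrow> 'a::complex_hilbert) \<Rightarrow> ('a \<Rightarrow> 'b::{real_inner,complete_space}) \<Rightarrow> nat \<Rightarrow>
   ((nat \<Rightarrow> real) \<Rightarrow> real) \<Rightarrow> 'b \<Rightarrow> 'a" where
  "cyl_gradient e \<iota> n \<phi> u =
     (\<Sum>j<n. partial_deriv j \<phi> (cyl_proj e \<iota> n u) *\<^sub>R e j
           + partial_deriv (n + j) \<phi> (cyl_proj e \<iota> n u) *\<^sub>R (\<i> *\<^sub>C e j))"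

text \<open>
  A vector field \<open>X\<close> enters only through the functions \<open>X \<phi> u = \<langle>\<phi>, X(u)\<rangle>\<close> with \<open>\<phi>\<close> in the set \<open>T\<close>
  of vectors for which this pairing makes sense.
\<close>

definition kms_measure ::
  "nat set \<Rightarrow> (nat \<Rightarrow> 'a::complex_hilbert) \<Rightarrow> ('a \<Rightarrow> 'b::{real_inner,complete_space}) \<Rightarrow>
   'a set \<Rightarrow> ('a \<Rightarrow> 'b \<Rightarrow> real) \<Rightarrow> real \<Rightarrow> 'b measure \<Rightarrow> bool" where
  "kms_measure I e \<iota> T X \<beta> \<mu> \<longleftrightarrow>
     prob_space \<mu> \<and> sets \<mu> = sets borel \<and>
     (\<forall>\<phi>\<in>T. integrable \<mu> (X \<phi>)) \<and>
     (\<forall>n m \<phi> \<psi>. 0 < n \<longrightarrow> 0 < m \<longrightarrow> {..<n} \<subseteq> I \<longrightarrow> {..<m} \<subseteq> I \<longrightarrow>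
        test_function (2 * n) \<phi> \<longrightarrow> test_function (2 * m) \<psi> \<longrightarrow>
        (LINT u|\<mu>. sigma (cyl_gradient e \<iota> n \<phi> u) (cyl_gradient e \<iota> m \<psi> u)) =
        \<beta> * (LINT u|\<mu>. X (cyl_gradient e \<iota> n \<phi> u) u * \<psi> (cyl_proj e \<iota> m u)))"

text \<open>
  The distributional vector field \<open>X(u) = iHu\<close>, which maps \<open>\<H>\<^sup>-\<^sup>s\<close> to \<open>\<H>\<^sup>-\<^sup>s\<^sup>-\<^sup>2\<close>. It is paired with
  those \<open>\<phi> \<in> \<H>\<^sup>s\<close> for which \<open>H \<phi> \<in> \<H>\<^sup>s\<close>. Sign convention: \<open>iH\<close> is transposed without conjugation,
  \<open>\<langle>\<phi>, X(u)\<rangle> = \<langle>iH\<phi>, u\<rangle>\<close>, so that \<open>X\<close> generates the derivation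
  \<open>\<delta>\<^sub>0(W\<^sup>0(\<phi>)) = i \<Phi>\<^sub>0(iH\<phi>) W\<^sup>0(\<phi>) = i \<langle>\<phi>, X(\<cdot>)\<rangle> W\<^sup>0(\<phi>)\<close>. With \<open>\<langle>-iH\<phi>, u\<rangle>\<close> instead, no
  probability measure satisfies the KMS condition for \<open>\<beta> > 0\<close> on a nonzero space.
\<close>

definition field_iH ::
  "('a::complex_hilbert \<Rightarrow> 'a) \<Rightarrow> ('a \<Rightarrow> 'b::{real_inner,complete_space}) \<Rightarrow> 'a \<Rightarrow> 'b \<Rightarrow> real" where
  "field_iH H \<iota> \<phi> u = dual_pairing \<iota> (\<i> *\<^sub>C H \<phi>) u"

definition field_iH_tests ::
  "'a::complex_hilbert set \<Rightarrow> ('a \<Rightarrow> 'a) \<Rightarrow> nat set \<Rightarrow> (nat \<Rightarrow> 'a) \<Rightarrow> real \<Rightarrow> 'a set" where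
  "field_iH_tests D H I e s = {\<phi> \<in> sobolev H I e s. \<phi> \<in> D \<and> H \<phi> \<in> sobolev H I e s}"

text \<open>
  \<open>\<omega>\<close> is the extension of \<open>f \<mapsto> fourier \<iota> \<mu> f\<close> on \<open>\<H>\<^sup>s\<close> to the Weyl algebra: norm-continuously
  to \<open>f \<in> E\<close>, and then linearly and continuously in the supremum norm.
\<close>

definition extends_fourier ::
  "('a::complex_hilbert \<Rightarrow> 'a) \<Rightarrow> nat set \<Rightarrow> (nat \<Rightarrow> 'a) \<Rightarrow> real \<Rightarrow>
   ('a \<Rightarrow> 'b::{real_inner,complete_space}) \<Rightarrow> 'b measure \<Rightarrow> (('a \<Rightarrow> complex) \<Rightarrow> complex) \<Rightarrow> bool" where
  "extends_fourier H I e s \<iota> \<mu> \<omega> \<longleftrightarrow>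
     (\<forall>f\<in>sobolev H I e s. \<omega> (W0 f) = fourier \<iota> \<mu> f) \<and>
     continuous_on UNIV (\<lambda>f. \<omega> (W0 f)) \<and>
     clinear_functional_on Weyl_algebra \<omega> \<and>
     (\<exists>C. \<forall>A\<in>Weyl_algebra. \<forall>K. (\<forall>u. cmod (A u) \<le> K) \<longrightarrow> cmod (\<omega> A) \<le> C * K)"

end

theory Submission
  imports Defs
begin

text \<open>
  Both conditions determine the Fourier transform, which has to be the Gaussian
  \<open>exp (- \<langle>f, H\<^sup>-\<^sup>1 f\<rangle> / (2\<beta>))\<close>. For a weak KMS state \<open>\<omega>\<close> and \<open>h \<in> D(H)\<close>, choose \<open>f\<close> with \<open>iHf = h\<close>: the
  KMS condition for \<open>W\<^sup>0(f)\<close> and \<open>W\<^sup>0(th - f)\<close> is the differential equation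
  \<open>S' = - (t / \<beta>) \<langle>h, H\<^sup>-\<^sup>1 h\<rangle> S\<close> for \<open>S(t) = \<omega>(W\<^sup>0(th))\<close>. For a KMS measure, the same equation
  follows for cylindrical \<open>h\<close> by testing with cut-off linear functions against cut-off exponentials.

  Since \<open>\<Sum> \<lambda>\<^sub>j\<^bsup>-s-1\<^esup> < \<infinity>\<close>, the Gaussian measure lives on \<open>\<H>\<^sup>-\<^sup>s\<close>, as the law of the almost surely
  convergent series of the eigenvectors with independent normal coefficients of variance
  \<open>1 / (\<beta> \<lambda>\<^sub>j)\<close>. It satisfies the KMS condition by Gaussian integration by parts, where the mixed
  second derivatives cancel. The Gaussian state is the limit of the expectations over
  finite-dimensional sections of this series; it is of class \<open>C\<^sup>2\<close> because the fourth moments are bounded.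
\<close>

section \<open>Standard Gaussian product measure\<close>

text \<open>The choice \<open>W0 (t h - f)\<close> closes the equation because its product with
  \<open>W0 f\<close> is \<open>W0 (t h)\<close>, so both sides of the KMS condition involve S
  alone. The condition speaks only of Weyl functions of vectors in \<open>D\<close>, and class C^2
  gives regularity along lines only; outside \<open>D\<close> the state is tied to the Gaussian by
  continuity at the vector, whence the alternative in the Fourier formula.

  Weyl elements are functions on E, but the random series need not converge in E. Its finite
  sections do lie in E, so the state is a limit of expectations along sections, whereas the measure
  needs the larger completion and an almost sure limit.

  For a KMS measure only first moments of the coordinates are available, and test functions have
  compact support. The cutoffs therefore need gradients bounded uniformly in the cutoff scale. Both
  are products of functions of one variable, for which smoothness and all partial derivatives are
  explicit.

  All expansions use a real orthonormal basis, since the duality pairing, the field functions and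
  the Gaussian coefficients are real.\<close>

definition gaussian_product :: "(nat \<Rightarrow> real) measure" where
  "gaussian_product = PiM UNIV (\<lambda>_. std_normal_distribution)"

interpretation std_normal: real_distribution std_normal_distribution
  by (rule real_dist_normal_dist)

interpretation gaussian_PiM: product_prob_space "\<lambda>_::nat. std_normal_distribution" UNIV
  by unfold_locales

interpretation gaussian_product: prob_space gaussian_product
  unfolding gaussian_product_def by unfold_locales

lemma sets_gaussian_product [measurable_cong]: "sets gaussian_product = sets borel"
proof -
  have "sets gaussian_product = sets (PiM UNIV (\<lambda>_::nat. borel :: real measure))"
    unfolding gaussian_product_def by (intro sets_PiM_cong) auto
  then show ?thesis
    using sets_PiM_equal_borel by simp
qed

lemma space_gaussian_product [simp]: "space gaussian_product = UNIV"
  using sets_eq_imp_space_eq[OF sets_gaussian_product] by simp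

lemma borel_measurable_component: "(\<lambda>z::nat \<Rightarrow> real. z j) \<in> borel_measurable borel"
  by (intro borel_measurable_continuous_onI continuous_on_product_coordinates)

lemma measurable_fun_upd_pair [measurable]:
  "(\<lambda>(t, z). z(j := t)) \<in> std_normal_distribution \<Otimes>\<^sub>M gaussian_product \<rightarrow>\<^sub>M gaussian_product"
proof -
  have "(\<lambda>(t, z). z(j := t)) \<in> borel_measurable (std_normal_distribution \<Otimes>\<^sub>M gaussian_product)"
  proof (rule measurable_coordinatewise_then_product)
    fix i
    have "(\<lambda>p. snd p i) \<in> borel_measurable (std_normal_distribution \<Otimes>\<^sub>M gaussian_product)"
      by (rule measurable_compose[OF measurable_snd])
         (use borel_measurable_component in \<open>simp cong: measurable_cong_sets\<close>)
    then show "(\<lambda>x. (case x of (t, z) \<Rightarrow> z(j := t)) i) \<in> borel_measurable (std_normal_distribution \<Otimes>\<^sub>M gaussian_product)"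
      by (cases "i = j") (simp_all add: case_prod_unfold)
  qed
  then show ?thesis
    by (simp cong: measurable_cong_sets)
qed

text \<open>Replacing one coordinate by an independent copy preserves the law of an i.i.d. sequence.
  It suffices to compare cylinder sets, where the factor of \<open>j\<close> merely passes to the
  fresh variable. This plays the role of Fubini for a single coordinate without splitting the index
  set.\<close>

lemma distr_resample:
  "distr (std_normal_distribution \<Otimes>\<^sub>M gaussian_product) gaussian_product (\<lambda>(t, z). z(j := t)) = gaussian_product"
proof -
  let ?P = "std_normal_distribution \<Otimes>\<^sub>M gaussian_product"
  let ?M = "distr ?P gaussian_product (\<lambda>(t, z). z(j := t))"
  interpret pair_prob_space std_normal_distribution gaussian_product ..
  have "?M = PiM UNIV (\<lambda>_. std_normal_distribution)"
  proof (rule gaussian_PiM.PiM_eq)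
    show "sets ?M = sets (PiM UNIV (\<lambda>_. std_normal_distribution))"
      by (simp add: gaussian_product_def)
  next
    fix J :: "nat set" and F :: "nat \<Rightarrow> real set"
    assume J: "finite J" and F: "\<And>j. j \<in> J \<Longrightarrow> F j \<in> sets std_normal_distribution"
    define E where "E K = (prod_emb UNIV (\<lambda>_. std_normal_distribution) K (Pi\<^sub>E K F) :: (nat \<Rightarrow> real) set)" for K
    have E_eq: "E K = {z. \<forall>i\<in>K. z i \<in> F i}" for K
      by (auto simp: E_def prod_emb_def PiE_iff space_PiM)
    have E_meas: "emeasure gaussian_product (E K) = (\<Prod>j\<in>K. emeasure std_normal_distribution (F j))"
      if "K \<subseteq> J" for K
      unfolding E_def gaussian_product_def using that J F
      by (intro gaussian_PiM.emeasure_PiM_emb) (auto intro: finite_subset)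
    have E_sets: "E K \<in> sets gaussian_product" if "K \<subseteq> J" for K
      unfolding E_def gaussian_product_def using that J F
      by (intro sets_PiM_I) (auto intro: finite_subset)
    \<comment> \<open>If \<open>j\<close> is not constrained, the fresh variable contributes a
      factor 1, hence the default \<open>UNIV\<close>.\<close>
    define A where "A = (if j \<in> J then F j else UNIV)"
    have A: "A \<in> sets std_normal_distribution"
      using F by (auto simp: A_def)
    have "emeasure ?M (E J) = emeasure ?P ((\<lambda>(t, z). z(j := t)) -` E J \<inter> space ?P)"
      by (intro emeasure_distr measurable_fun_upd_pair E_sets) simp
    also have "(\<lambda>(t, z). z(j := t)) -` E J \<inter> space ?P = A \<times> E (J - {j})"
      by (auto simp: E_eq A_def space_pair_measure split: if_splits)
    also have "emeasure ?P \<dots> = emeasure std_normal_distribution A * emeasure gaussian_product (E (J - {j}))"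
      by (intro gaussian_product.emeasure_pair_measure_Times A E_sets) auto
    also have "\<dots> = (\<Prod>j\<in>J. emeasure std_normal_distribution (F j))"
    proof (cases "j \<in> J")
      case True
      then show ?thesis
        using J by (simp add: A_def E_meas prod.remove[of J j])
    next
      case False
      then show ?thesis
        using std_normal.emeasure_space_1 by (simp add: A_def E_meas)
    qed
    finally show "emeasure ?M (prod_emb UNIV (\<lambda>_. std_normal_distribution) J (Pi\<^sub>E J F)) =
        (\<Prod>j\<in>J. emeasure std_normal_distribution (F j))"
      unfolding E_def .
  qed
  then show ?thesis
    by (simp add: gaussian_product_def)
qed

lemma integral_resample:
  fixes h :: "(nat \<Rightarrow> real) \<Rightarrow> 'c::{banach, second_countable_topology}"
  assumes "integrable gaussian_product h"
  shows "(LINT z|gaussian_product. LINT t|std_normal_distribution. h (z(j := t))) = (LINT z|gaussian_product. h z)"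
proof -
  interpret pair_prob_space std_normal_distribution gaussian_product ..
  have int: "integrable (std_normal_distribution \<Otimes>\<^sub>M gaussian_product) (\<lambda>(t, z). h (z(j := t)))"
    using assms integrable_distr_eq[OF measurable_fun_upd_pair, of h j] borel_measurable_integrable[OF assms]
    by (simp add: distr_resample) (simp add: case_prod_unfold)
  have "(LINT z|gaussian_product. h z) = (LINT p|(std_normal_distribution \<Otimes>\<^sub>M gaussian_product). (case p of (t, z) \<Rightarrow> h (z(j := t))))"
    using integral_distr[OF measurable_fun_upd_pair, of h j] borel_measurable_integrable[OF assms]
    by (simp add: distr_resample) (simp add: case_prod_unfold)
  then show ?thesis
    using integral_snd[OF int] by simp
qed

section \<open>Laws and moments of linear forms in independent normal variables\<close>

lemma borel_measurable_linear_form [measurable]: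
  "(\<lambda>z::nat \<Rightarrow> real. \<Sum>j<n. c j * z j) \<in> borel_measurable gaussian_product"
  by (intro borel_measurable_sum borel_measurable_times borel_measurable_const)
     (use borel_measurable_component in \<open>simp cong: measurable_cong_sets\<close>)

text \<open>Resampling coordinate \<open>n\<close> splits off the characteristic function of one
  normal variable, since the terms below \<open>n\<close> do not see that coordinate.\<close>

lemma iexp_linear_form_integral:
  "(LINT z|gaussian_product. iexp (\<Sum>j<n. c j * z j)) = exp (- (\<Sum>j<n. (c j)\<^sup>2) / 2)"
proof (induction n)
  case 0
  then show ?case
    using gaussian_product.prob_space by simp
next
  case (Suc n)
  have int: "integrable gaussian_product (\<lambda>z. iexp (\<Sum>j<m. c j * z j))" for m
    by (intro gaussian_product.integrable_const_bound[where B=1]) auto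
  have "(LINT z|gaussian_product. iexp (\<Sum>j<Suc n. c j * z j)) =
      (LINT z|gaussian_product. LINT t|std_normal_distribution. iexp (\<Sum>j<Suc n. c j * (z(n := t)) j))"
    by (rule integral_resample[OF int, symmetric])
  also have "\<dots> = (LINT z|gaussian_product. iexp (\<Sum>j<n. c j * z j) * char std_normal_distribution (c n))"
    unfolding char_def by (simp add: distrib_left exp_add)
  also have "\<dots> = exp (- (\<Sum>j<n. (c j)\<^sup>2) / 2) * complex_of_real (exp (- (c n)\<^sup>2 / 2))"
    unfolding Suc.IH[symmetric] char_std_normal_distribution by (rule integral_mult_left_zero)
  also have "\<dots> = exp (- (\<Sum>j<Suc n. (c j)\<^sup>2) / 2)"
    by (simp only: of_real_mult[symmetric] mult_exp_exp) (simp add: diff_divide_distrib)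
  finally show ?case .
qed

text \<open>Laws with equal characteristic functions agree by Levy's theorem. This reduces every
  moment of a linear form to a moment of one normal variable.\<close>

lemma distr_linear_form:
  "distr gaussian_product borel (\<lambda>z. \<Sum>j<n. c j * z j) =
   distr std_normal_distribution borel (\<lambda>t. sqrt (\<Sum>j<n. (c j)\<^sup>2) * t)"
proof (rule Levy_uniqueness)
  show "real_distribution (distr gaussian_product borel (\<lambda>z. \<Sum>j<n. c j * z j))"
    by (intro gaussian_product.real_distribution_distr borel_measurable_linear_form)
  show "real_distribution (distr std_normal_distribution borel (\<lambda>t. sqrt (\<Sum>j<n. (c j)\<^sup>2) * t))"
    by (intro std_normal.real_distribution_distr) measurable
  show "char (distr gaussian_product borel (\<lambda>z. \<Sum>j<n. c j * z j)) =
    char (distr std_normal_distribution borel (\<lambda>t. sqrt (\<Sum>j<n. (c j)\<^sup>2) * t))"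
  proof
    fix u
    have "char (distr gaussian_product borel (\<lambda>z. \<Sum>j<n. c j * z j)) u =
        (LINT z|gaussian_product. iexp (\<Sum>j<n. (u * c j) * z j))"
      unfolding char_def by (subst integral_distr) (simp_all add: sum_distrib_left mult.assoc)
    also have "\<dots> = char std_normal_distribution (u * sqrt (\<Sum>j<n. (c j)\<^sup>2))"
      unfolding iexp_linear_form_integral char_std_normal_distribution
      by (simp add: power_mult_distrib sum_distrib_left sum_nonneg)
    also have "\<dots> = char (distr std_normal_distribution borel (\<lambda>t. sqrt (\<Sum>j<n. (c j)\<^sup>2) * t)) u"
      unfolding char_def by (subst integral_distr) (simp_all add: mult.assoc)
    finally show "char (distr gaussian_product borel (\<lambda>z. \<Sum>j<n. c j * z j)) u =
      char (distr std_normal_distribution borel (\<lambda>t. sqrt (\<Sum>j<n. (c j)\<^sup>2) * t)) u" .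
  qed
qed

lemma integrable_linear_form_power:
  "integrable gaussian_product (\<lambda>z. (\<Sum>j<n. c j * z j) ^ k)"
proof -
  have "integrable (distr std_normal_distribution borel (\<lambda>t. sqrt (\<Sum>j<n. (c j)\<^sup>2) * t)) (\<lambda>x. x ^ k)"
    by (subst integrable_distr_eq) (auto simp: power_mult_distrib integrable_std_normal_distribution_moment)
  then show ?thesis
    unfolding distr_linear_form[symmetric] by (subst (asm) integrable_distr_eq) auto
qed

text \<open>The last factor is the even moment of the standard normal law: 1 for
  \<open>k = 1\<close> and 3 for \<open>k = 2\<close>, the two cases used below.\<close>

lemma linear_form_moment_even:
  "(LINT z|gaussian_product. (\<Sum>j<n. c j * z j) ^ (2 * k)) =
   (\<Sum>j<n. (c j)\<^sup>2) ^ k * (fact (2 * k) / (2 ^ k * fact k))"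
proof -
  have "(LINT z|gaussian_product. (\<Sum>j<n. c j * z j) ^ (2 * k)) =
      (LINT x|distr gaussian_product borel (\<lambda>z. \<Sum>j<n. c j * z j). x ^ (2 * k))"
    by (subst integral_distr) auto
  also have "\<dots> = (LINT t|std_normal_distribution. (sqrt (\<Sum>j<n. (c j)\<^sup>2) * t) ^ (2 * k))"
    unfolding distr_linear_form by (subst integral_distr) auto
  also have "\<dots> = (LINT t|std_normal_distribution. (\<Sum>j<n. (c j)\<^sup>2) ^ k * t ^ (2 * k))"
    by (simp add: power_mult_distrib power_mult sum_nonneg)
  also have "\<dots> = (\<Sum>j<n. (c j)\<^sup>2) ^ k * (fact (2 * k) / (2 ^ k * fact k))"
    by (simp only: integral_mult_right_zero std_normal_distribution_even_moments)
  finally show ?thesis .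
qed

lemma component_eq_linear_form: "z j = (\<Sum>i<Suc j. of_bool (i = j) * z i :: real)"
  by (simp add: sum.delta of_bool_def if_distrib[of "\<lambda>x. x * _"] cong: if_cong)

lemma integrable_component_power: "integrable gaussian_product (\<lambda>z. z j ^ k)"
  using integrable_linear_form_power[of "\<lambda>i. of_bool (i = j)" "Suc j" k]
  unfolding component_eq_linear_form[symmetric] .

lemma component_moment_2: "(LINT z|gaussian_product. (z j)\<^sup>2) = 1"
  using linear_form_moment_even[of "\<lambda>i. of_bool (i = j)" "Suc j" 1]
  unfolding component_eq_linear_form[symmetric]
  by (simp add: of_bool_def if_distrib[of "\<lambda>x. x ^ 2"] cong: if_cong)

section \<open>Gaussian integration by parts\<close>

lemma has_real_derivative_std_normal_density:
  "(std_normal_density has_real_derivative - t * std_normal_density t) (at t)"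
  unfolding std_normal_density_def by (auto intro!: derivative_eq_intros simp: field_simps)

lemma std_normal_density_at_infinity:
  "(std_normal_density \<longlongrightarrow> 0) at_top" "(std_normal_density \<longlongrightarrow> 0) at_bot"
  unfolding std_normal_density_def by real_asymp+

text \<open>The density \<open>p\<close> satisfies \<open>p' = - t p\<close>, so
  \<open>p g' - t p g\<close> is the derivative of \<open>p g\<close>; its integral over the line
  vanishes because \<open>g\<close> is bounded and \<open>p\<close> decays.\<close>

lemma std_normal_integration_by_parts:
  fixes g g' :: "real \<Rightarrow> real"
  assumes g: "\<And>t. (g has_real_derivative g' t) (at t)" and cont: "continuous_on UNIV g'"
    and bd: "\<And>t. \<bar>g t\<bar> \<le> B" "\<And>t. \<bar>g' t\<bar> \<le> B"
  shows "(LINT t|std_normal_distribution. t * g t) = (LINT t|std_normal_distribution. g' t)"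
proof -
  have gc: "continuous_on UNIV g"
    using g by (meson DERIV_continuous_on has_field_derivative_at_within)
  have [measurable]: "g \<in> borel_measurable borel" "g' \<in> borel_measurable borel"
    using gc cont by (auto intro: borel_measurable_continuous_onI)
  have i1: "integrable std_normal_distribution (\<lambda>t. t * g t)"
  proof (rule Bochner_Integration.integrable_bound)
    show "integrable std_normal_distribution (\<lambda>t. B * t)"
      using integrable_std_normal_distribution_moment[of 1] by simp
    show "AE t in std_normal_distribution. norm (t * g t) \<le> norm (B * t)"
      using bd(1) by (auto simp: abs_mult mult.commute[of B] intro!: mult_left_mono order_trans[OF bd(1)])
  qed simp
  have i2: "integrable std_normal_distribution g'"
    using bd(2) by (intro std_normal.integrable_const_bound[where B=B]) auto
  have d1: "integrable lborel (\<lambda>t. std_normal_density t * (t * g t))"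
    using i1 by (subst (asm) integrable_density) auto
  have d2: "integrable lborel (\<lambda>t. std_normal_density t * g' t)"
    using i2 by (subst (asm) integrable_density) auto
  let ?F' = "\<lambda>t. std_normal_density t * g' t - std_normal_density t * (t * g t)"
  have lim: "((\<lambda>t. std_normal_density t * g t) \<longlongrightarrow> 0) F" if "(std_normal_density \<longlongrightarrow> 0) F" for F
  proof (rule Lim_null_comparison)
    show "\<forall>\<^sub>F t in F. norm (std_normal_density t * g t) \<le> B * std_normal_density t"
      using bd(1) by (intro always_eventually) (auto simp: abs_mult mult.commute[of B] intro!: mult_left_mono)
    show "((\<lambda>t. B * std_normal_density t) \<longlongrightarrow> 0) F"
      using tendsto_mult_right_zero[OF that] .
  qed
  have "interval_lebesgue_integral lborel (- \<infinity>) \<infinity> ?F' = 0 - 0"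
  proof (rule interval_integral_FTC_integrable[where F = "\<lambda>t. std_normal_density t * g t"])
    show "((\<lambda>t. std_normal_density t * g t) has_vector_derivative ?F' t) (at t)" for t
      unfolding has_real_derivative_iff_has_vector_derivative[symmetric]
      by (auto intro!: derivative_eq_intros g has_real_derivative_std_normal_density)
    show "isCont ?F' t" for t
      using gc cont unfolding std_normal_density_def
      by (intro continuous_intros) (auto simp: continuous_on_eq_continuous_at)
    show "set_integrable lborel (einterval (- \<infinity>) \<infinity>) ?F'"
      unfolding set_integrable_def using d1 d2 by simp
    show "(((\<lambda>t. std_normal_density t * g t) \<circ> real_of_ereal) \<longlongrightarrow> 0) (at_right (- (\<infinity>::ereal)))"
      "(((\<lambda>t. std_normal_density t * g t) \<circ> real_of_ereal) \<longlongrightarrow> 0) (at_left (\<infinity>::ereal))"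
      unfolding ereal_tendsto_simps using lim std_normal_density_at_infinity by auto
  qed simp
  then have "(LBINT t. ?F' t) = 0"
    by (simp add: interval_lebesgue_integral_def set_lebesgue_integral_def)
  then show ?thesis
    using d1 d2 by (simp add: integral_density)
qed

lemma continuous_on_fun_upd: "continuous_on UNIV (\<lambda>t. (x :: nat \<Rightarrow> real)(j := t))"
proof (intro continuous_on_coordinatewise_then_product)
  show "continuous_on UNIV (\<lambda>t. (x(j := t)) i)" for i
    by (cases "i = j") auto
qed

text \<open>Resampling coordinate \<open>j\<close> on both sides reduces the claim to one variable
  with the others frozen. Continuity and the bounds supply integrability.\<close>

lemma gaussian_integration_by_parts:
  fixes h h' :: "(nat \<Rightarrow> real) \<Rightarrow> real"
  assumes h: "\<And>z t. ((\<lambda>t. h (z(j := t))) has_real_derivative h' (z(j := t))) (at t)"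
    and cont: "continuous_on UNIV h" "continuous_on UNIV h'"
    and bd: "\<And>z. \<bar>h z\<bar> \<le> B" "\<And>z. \<bar>h' z\<bar> \<le> B"
  shows "(LINT z|gaussian_product. z j * h z) = (LINT z|gaussian_product. h' z)"
proof -
  have [measurable]: "h \<in> borel_measurable borel" "h' \<in> borel_measurable borel"
    using cont by (auto intro: borel_measurable_continuous_onI)
  note borel_measurable_component [measurable]
  have i1: "integrable gaussian_product (\<lambda>z. z j * h z)"
  proof (rule Bochner_Integration.integrable_bound)
    show "integrable gaussian_product (\<lambda>z. B * z j)"
      using integrable_component_power[of j 1] by simp
    show "AE z in gaussian_product. norm (z j * h z) \<le> norm (B * z j)"
      using bd(1) by (auto simp: abs_mult mult.commute[of B] intro!: mult_left_mono order_trans[OF bd(1)])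
  qed simp
  have i2: "integrable gaussian_product h'"
    using bd(2) by (intro gaussian_product.integrable_const_bound[where B=B]) auto
  have "(LINT z|gaussian_product. z j * h z) =
      (LINT z|gaussian_product. LINT t|std_normal_distribution. t * h (z(j := t)))"
    using integral_resample[OF i1, of j] by simp
  also have "\<dots> = (LINT z|gaussian_product. LINT t|std_normal_distribution. h' (z(j := t)))"
    using h bd cont
    by (intro Bochner_Integration.integral_cong refl std_normal_integration_by_parts[where B=B]
        continuous_on_compose2[OF cont(2) continuous_on_fun_upd]) auto
  also have "\<dots> = (LINT z|gaussian_product. h' z)"
    by (rule integral_resample[OF i2])
  finally show ?thesis .
qed

section \<open>Derivatives of characteristic functions\<close>

lemma has_vector_derivative_at_0_iff:
  fixes S :: "real \<Rightarrow> complex"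
  shows "(S has_vector_derivative D) (at 0) \<longleftrightarrow> ((\<lambda>t. (S t - S 0) / complex_of_real t) \<longlongrightarrow> D) (at 0)"
proof -
  have "norm (S t - S 0 - t *\<^sub>R D) / norm t = norm ((S t - S 0) / complex_of_real t - D)" if "t \<noteq> 0" for t
  proof -
    have "(S t - S 0) / complex_of_real t - D = (S t - S 0 - t *\<^sub>R D) / complex_of_real t"
      using that by (simp add: scaleR_conv_of_real field_simps)
    then show ?thesis
      by (simp add: norm_divide)
  qed
  then have "((\<lambda>t. norm (S t - S 0 - t *\<^sub>R D) / norm t) \<longlongrightarrow> 0) (at 0) \<longleftrightarrow>
      ((\<lambda>t. norm ((S t - S 0) / complex_of_real t - D)) \<longlongrightarrow> 0) (at 0)"
    by (intro tendsto_cong) (auto simp: eventually_at_filter)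
  moreover have "(S has_vector_derivative D) (at 0) \<longleftrightarrow> ((\<lambda>t. norm (S t - S 0 - t *\<^sub>R D) / norm t) \<longlongrightarrow> 0) (at 0)"
    unfolding has_vector_derivative_def has_derivative_at by (simp add: bounded_linear_scaleR_left)
  ultimately show ?thesis
    by (simp add: tendsto_norm_zero_iff LIM_zero_iff)
qed

lemma norm_iexp_minus_1_le: "cmod (iexp x - 1) \<le> \<bar>x\<bar>"
  using iexp_approx1[of x 0] by simp

lemma norm_iexp_minus_linear_le: "cmod (iexp x - 1 - \<i> * x) \<le> x\<^sup>2 / 2"
  using iexp_approx1[of x 1] by (simp add: field_simps power2_eq_square)

text \<open>Differentiation under the integral: since \<open>|exp(ix) - 1| \<le> |x|\<close>, the
  difference quotients are dominated by \<open>|X|\<close>, so one finite first moment suffices. It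
  serves the Gaussian expectations and arbitrary KMS measures alike.\<close>

lemma (in prob_space) iexp_integral_has_vector_derivative:
  assumes X: "integrable M X" and [measurable]: "Y \<in> borel_measurable M"
  shows "((\<lambda>t. LINT u|M. iexp (Y u + t * X u)) has_vector_derivative
    (LINT u|M. \<i> * X u * iexp (Y u))) (at 0)"
proof -
  have [measurable]: "X \<in> borel_measurable M"
    using X by auto
  have int: "integrable M (\<lambda>u. iexp (Z u))" if [measurable]: "Z \<in> borel_measurable M" for Z :: "'a \<Rightarrow> real"
    by (intro integrable_const_bound[where B=1]) auto
  let ?q = "\<lambda>t u. (iexp (Y u + t * X u) - iexp (Y u)) / complex_of_real t"
  have "((\<lambda>t. LINT u|M. ?q t u) \<longlongrightarrow> (LINT u|M. \<i> * X u * iexp (Y u))) (at 0)"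
    unfolding tendsto_at_iff_sequentially comp_def
  proof safe
    fix T :: "nat \<Rightarrow> real" assume T: "\<forall>i. T i \<in> UNIV - {0}" "T \<longlonglongrightarrow> 0"
    show "(\<lambda>i. LINT u|M. ?q (T i) u) \<longlonglongrightarrow> (LINT u|M. \<i> * X u * iexp (Y u))"
    proof (rule integral_dominated_convergence[where w="\<lambda>u. \<bar>X u\<bar>"])
      show "AE u in M. (\<lambda>i. ?q (T i) u) \<longlonglongrightarrow> \<i> * X u * iexp (Y u)"
      proof (intro AE_I2)
        fix u
        have "((\<lambda>t. iexp (Y u + t * X u)) has_vector_derivative (X u *\<^sub>R (\<i> * iexp (Y u)))) (at 0)"
          by (rule vector_diff_chain_at[where f="\<lambda>t. Y u + t * X u" and g=iexp, unfolded o_def])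
             (auto intro!: derivative_eq_intros)
        then have "((\<lambda>t. ?q t u) \<longlongrightarrow> \<i> * X u * iexp (Y u)) (at 0)"
          unfolding has_vector_derivative_at_0_iff by (simp add: scaleR_conv_of_real mult_ac)
        then show "(\<lambda>i. ?q (T i) u) \<longlonglongrightarrow> \<i> * X u * iexp (Y u)"
          using T unfolding tendsto_at_iff_sequentially comp_def by blast
      qed
      show "AE u in M. norm (?q (T i) u) \<le> \<bar>X u\<bar>" for i
      proof (intro AE_I2)
        fix u
        have "iexp (Y u + T i * X u) - iexp (Y u) = iexp (Y u) * (iexp (T i * X u) - 1)"
          by (simp add: distrib_left exp_add algebra_simps)
        then have "norm (?q (T i) u) = cmod (iexp (T i * X u) - 1) / \<bar>T i\<bar>"
          by (simp add: norm_divide norm_mult)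
        then show "norm (?q (T i) u) \<le> \<bar>X u\<bar>"
          using norm_iexp_minus_1_le[of "T i * X u"] T(1) by (simp add: abs_mult divide_le_eq mult.commute)
      qed
    qed (use X in auto)
  qed
  moreover have "(LINT u|M. ?q t u) =
      ((LINT u|M. iexp (Y u + t * X u)) - (LINT u|M. iexp (Y u + 0 * X u))) / complex_of_real t" for t
    using int[of "\<lambda>u. Y u + t * X u"] int[of Y]
    by (simp add: Bochner_Integration.integral_diff)
  ultimately show ?thesis
    by (simp only: has_vector_derivative_at_0_iff)
qed

text \<open>The integrating factor \<open>exp (c t^2 / 2)\<close> turns a solution into a constant,
  whose value is read off at 0.\<close>

lemma gaussian_ode:
  fixes S :: "real \<Rightarrow> complex" and c :: real
  assumes S: "\<And>t. (S has_vector_derivative - (t * c) *\<^sub>R S t) (at t)" and "S 0 = 1"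
  shows "S t = exp (- c * t\<^sup>2 / 2)"
proof -
  define R where "R t = exp (c * t\<^sup>2 / 2) *\<^sub>R S t" for t
  have "(R has_vector_derivative 0) (at t)" for t
    unfolding R_def
    by (auto intro!: derivative_eq_intros S simp: scaleR_right_diff_distrib algebra_simps)
  then have "R t = R 0"
    using has_vector_derivative_zero_constant[of UNIV R] by (metis UNIV_I convex_UNIV)
  then have "complex_of_real (exp (c * t\<^sup>2 / 2)) * S t = 1"
    using assms(2) by (simp add: R_def scaleR_conv_of_real)
  then have "inverse (complex_of_real (exp (c * t\<^sup>2 / 2))) = S t"
    by (rule inverse_unique)
  then show ?thesis
    by (simp add: exp_minus)
qed

section \<open>States on the commutative Weyl algebra\<close>

lemma fun_span_base: "g \<in> S \<Longrightarrow> g \<in> fun_span S"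
  unfolding fun_span_def by (rule CollectI, rule exI[of _ "{g}"], rule exI[of _ "\<lambda>_. 1"]) auto

lemma fun_span_zero: "(\<lambda>u. 0) \<in> fun_span S"
  unfolding fun_span_def by (rule CollectI, rule exI[of _ "{}"]) auto

lemma fun_span_add_base:
  assumes "g \<in> S" "A \<in> fun_span S"
  shows "(\<lambda>u. c * g u + A u) \<in> fun_span S"
proof -
  obtain T d where T: "finite T" "T \<subseteq> S" and A: "A = (\<lambda>u. \<Sum>h\<in>T. d h * h u)"
    using assms(2) by (auto simp: fun_span_def)
  \<comment> \<open>Coefficients are added up if \<open>g\<close> already belongs to
    \<open>T\<close>.\<close>
  define d' where "d' h = (if h \<in> T then d h else 0) + (if h = g then c else 0)" for h
  have "c * g u + A u = (\<Sum>h\<in>insert g T. d' h * h u)" for u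
  proof -
    have "(\<Sum>h\<in>insert g T. d' h * h u) =
        (\<Sum>h\<in>insert g T. if h \<in> T then d h * h u else 0) + (\<Sum>h\<in>insert g T. if h = g then c * h u else 0)"
      by (simp add: d'_def sum.distrib[symmetric] distrib_right if_distrib[of "\<lambda>x. x * _"] cong: if_cong)
    also have "(\<Sum>h\<in>insert g T. if h = g then c * h u else 0) = c * g u"
      using T by (subst sum.delta) auto
    also have "(\<Sum>h\<in>insert g T. if h \<in> T then d h * h u else 0) = A u"
      unfolding A using T by (intro sum.mono_neutral_cong_right) auto
    finally show ?thesis
      by simp
  qed
  moreover have "finite (insert g T)" "insert g T \<subseteq> S"
    using T assms(1) by auto
  ultimately show ?thesis
    unfolding fun_span_def by blast
qed

text \<open>The step has no freshness condition on \<open>g\<close>, so identities between linear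
  functionals can be checked on generators that are possibly linearly dependent.\<close>

lemma fun_span_induct [consumes 1, case_names zero add]:
  assumes A: "A \<in> fun_span S" and zero: "P (\<lambda>u. 0)"
    and step: "\<And>g c B. g \<in> S \<Longrightarrow> B \<in> fun_span S \<Longrightarrow> P B \<Longrightarrow> P (\<lambda>u. c * g u + B u)"
  shows "P A"
proof -
  obtain T d where T: "finite T" "T \<subseteq> S" and A: "A = (\<lambda>u. \<Sum>h\<in>T. d h * h u)"
    using A by (auto simp: fun_span_def)
  have "(\<lambda>u. \<Sum>h\<in>T. d h * h u) \<in> fun_span S \<and> P (\<lambda>u. \<Sum>h\<in>T. d h * h u)"
    using T
  proof (induction T)
    case empty
    then show ?case
      using zero fun_span_zero by simp
  next
    case (insert g T)
    then show ?case
      using step[of g "\<lambda>u. \<Sum>h\<in>T. d h * h u" "d g"] fun_span_add_base[of g S "\<lambda>u. \<Sum>h\<in>T. d h * h u" "d g"] by simp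
  qed
  then show ?thesis
    using A by simp
qed

lemma fun_span_lincomb:
  assumes "A \<in> fun_span S" "B \<in> fun_span S"
  shows "(\<lambda>u. c * A u + d * B u) \<in> fun_span S"
proof -
  have scale: "(\<lambda>u. d * B u) \<in> fun_span S" if "B \<in> fun_span S" for B
    using that
  proof (induction rule: fun_span_induct)
    case zero
    then show ?case
      using fun_span_zero by simp
  next
    case (add g c' B)
    then show ?case
      using fun_span_add_base[of g S "\<lambda>u. d * B u" "d * c'"] by (simp add: algebra_simps)
  qed
  show ?thesis
    using assms(1)
  proof (induction rule: fun_span_induct)
    case zero
    then show ?case
      using scale[OF assms(2)] by simp
  next
    case (add g c' A)
    then show ?case
      using fun_span_add_base[of g S "\<lambda>u. c * A u + d * B u" "c * c'"] by (simp add: algebra_simps)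
  qed
qed

lemma fun_span_clinear_eq:
  assumes A: "A \<in> fun_span S"
    and L: "clinear_functional_on (fun_span S) L" and L': "clinear_functional_on (fun_span S) L'"
    and eq: "\<And>g. g \<in> S \<Longrightarrow> L g = L' g"
  shows "L A = L' A"
  using A
proof (induction rule: fun_span_induct)
  case zero
  have "M (\<lambda>u. 0) = 0" if "clinear_functional_on (fun_span S) M" for M
    using that[unfolded clinear_functional_on_def, rule_format, OF fun_span_zero fun_span_zero, of 0 0] by simp
  from this[OF L] this[OF L'] show ?case
    by simp
next
  case (add g c B)
  have "M (\<lambda>u. c * g u + B u) = c * M g + M B" if "clinear_functional_on (fun_span S) M" for M
    using that[unfolded clinear_functional_on_def, rule_format, OF fun_span_base[OF add(1)] add(2), of c 1]
    by simp
  from this[OF L] this[OF L'] show ?case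
    using eq add by simp
qed

section \<open>The Weyl span and its uniform closure\<close>

lemma W0_add: "W0 (f + g) u = W0 f u * W0 g u"
  by (simp add: W0_def inner_add_left distrib_left exp_add)

lemma W0_0 [simp]: "W0 0 = (\<lambda>u. 1)"
  by (simp add: W0_def fun_eq_iff)

lemma cnj_W0: "cnj (W0 f u) = W0 (- f) u"
  by (simp add: W0_def exp_cnj)

lemma norm_W0 [simp]: "cmod (W0 f u) = 1"
  by (simp add: W0_def)

lemma cnj_W0_mult_W0 [simp]: "cnj (W0 f u) * W0 f u = 1"
  by (simp add: cnj_W0 W0_add[symmetric])

lemma W0_in_Weyl_span: "W0 f \<in> Weyl_span"
  unfolding Weyl_span_def by (intro fun_span_base) auto

lemmas Weyl_span_lincomb = fun_span_lincomb[of _ "range W0", folded Weyl_span_def]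

lemma Weyl_span_mult:
  assumes "A \<in> Weyl_span" "B \<in> Weyl_span"
  shows "(\<lambda>u. A u * B u) \<in> Weyl_span"
proof -
  have base: "(\<lambda>u. W0 f u * B u) \<in> Weyl_span" for f
    using assms(2) unfolding Weyl_span_def
  proof (induction rule: fun_span_induct)
    case zero
    then show ?case
      using fun_span_zero by simp
  next
    case (add g c B)
    then obtain h where "g = W0 h"
      by auto
    then show ?case
      using fun_span_add_base[of "W0 (f + h)", OF _ add(3), of c] by (simp add: W0_add algebra_simps)
  qed
  show ?thesis
    using assms(1)[unfolded Weyl_span_def]
  proof (induction rule: fun_span_induct)
    case zero
    then show ?case
      unfolding Weyl_span_def using fun_span_zero by simp
  next
    case (add g c A)
    obtain f where "g = W0 f"
      using add(1) by auto
    moreover have "(\<lambda>u. c * (W0 f u * B u) + 1 * (A u * B u)) \<in> Weyl_span"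
      by (intro Weyl_span_lincomb base add)
    ultimately show ?case
      by (simp add: algebra_simps)
  qed
qed

lemma Weyl_span_cnj:
  assumes "A \<in> Weyl_span"
  shows "(\<lambda>u. cnj (A u)) \<in> Weyl_span"
  using assms unfolding Weyl_span_def
proof (induction rule: fun_span_induct)
  case zero
  then show ?case
    using fun_span_zero by simp
next
  case (add g c A)
  then obtain h where "g = W0 h"
    by auto
  then show ?case
    using fun_span_add_base[of "W0 (- h)", OF _ add(3), of "cnj c"] by (simp add: cnj_W0)
qed

lemma Weyl_span_bounded:
  assumes "A \<in> Weyl_span"
  shows "\<exists>K. \<forall>u. cmod (A u) \<le> K"
  using assms unfolding Weyl_span_def
proof (induction rule: fun_span_induct)
  case zero
  then show ?case
    by auto
next
  case (add g c A)
  then obtain K where K: "\<And>u. cmod (A u) \<le> K"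
    by auto
  have "cmod (c * g u + A u) \<le> cmod c + K" for u
  proof -
    have "cmod (c * g u + A u) \<le> cmod (c * g u) + cmod (A u)"
      by (rule norm_triangle_ineq)
    also have "\<dots> \<le> cmod c + K"
      using add(1) K by (auto simp: norm_mult)
    finally show ?thesis .
  qed
  then show ?case
    by blast
qed

lemma Weyl_span_continuous:
  assumes "A \<in> Weyl_span"
  shows "continuous_on UNIV A"
  using assms unfolding Weyl_span_def
proof (induction rule: fun_span_induct)
  case zero
  then show ?case
    by simp
next
  case (add g c A)
  then show ?case
    by (auto simp: W0_def intro!: continuous_intros)
qed

lemma Weyl_algebraD:
  "A \<in> Weyl_algebra \<Longrightarrow> \<epsilon> > 0 \<Longrightarrow> \<exists>B. B \<in> Weyl_span \<and> (\<forall>u. cmod (A u - B u) \<le> \<epsilon>)"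
  unfolding Weyl_algebra_def by blast

lemma Weyl_span_subset: "A \<in> Weyl_span \<Longrightarrow> A \<in> Weyl_algebra"
  unfolding Weyl_algebra_def by (auto intro!: bexI[of _ A])

lemma W0_in_Weyl_algebra: "W0 f \<in> Weyl_algebra"
  by (intro Weyl_span_subset W0_in_Weyl_span)

lemma Weyl_algebra_const: "(\<lambda>u. c) \<in> Weyl_algebra"
  using Weyl_span_lincomb[OF W0_in_Weyl_span[of 0] W0_in_Weyl_span[of 0], of c 0]
  by (intro Weyl_span_subset) simp

lemma Weyl_algebra_bounded:
  assumes "A \<in> Weyl_algebra"
  shows "\<exists>K>0. \<forall>u. cmod (A u) \<le> K"
proof -
  obtain B where B: "B \<in> Weyl_span" "\<And>u. cmod (A u - B u) \<le> 1"
    using Weyl_algebraD[OF assms, of 1] by auto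
  obtain K where K: "\<And>u. cmod (B u) \<le> K"
    using Weyl_span_bounded[OF B(1)] by blast
  have "cmod (A u) \<le> 1 + \<bar>K\<bar>" for u
    using B(2)[of u] K[of u] norm_triangle_sub[of "A u" "B u"] by linarith
  then show ?thesis
    by (intro exI[of _ "1 + \<bar>K\<bar>"]) auto
qed

lemma Weyl_algebra_lincomb:
  assumes "A \<in> Weyl_algebra" "B \<in> Weyl_algebra"
  shows "(\<lambda>u. c * A u + d * B u) \<in> Weyl_algebra"
  unfolding Weyl_algebra_def
proof (intro CollectI allI impI)
  fix \<epsilon> :: real assume \<epsilon>: "\<epsilon> > 0"
  define \<delta> where "\<delta> = \<epsilon> / (cmod c + cmod d + 1)"
  have pos: "cmod c + cmod d + 1 > 0"
    by (simp add: add_nonneg_pos)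
  then have "\<delta> > 0"
    using \<epsilon> by (simp add: \<delta>_def)
  then obtain A' B' where A': "A' \<in> Weyl_span" "\<And>u. cmod (A u - A' u) \<le> \<delta>"
    and B': "B' \<in> Weyl_span" "\<And>u. cmod (B u - B' u) \<le> \<delta>"
    using Weyl_algebraD[OF assms(1) \<open>\<delta> > 0\<close>] Weyl_algebraD[OF assms(2) \<open>\<delta> > 0\<close>] by blast
  have "cmod (c * A u + d * B u - (c * A' u + d * B' u)) \<le> \<epsilon>" for u
  proof -
    have "cmod (c * A u + d * B u - (c * A' u + d * B' u)) = cmod (c * (A u - A' u) + d * (B u - B' u))"
      by (simp add: algebra_simps)
    also have "\<dots> \<le> cmod c * \<delta> + cmod d * \<delta>"
      using A'(2)[of u] B'(2)[of u]
      by (intro order_trans[OF norm_triangle_ineq] add_mono) (simp_all add: norm_mult mult_left_mono)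
    also have "\<dots> \<le> (cmod c + cmod d + 1) * \<delta>"
      using \<open>\<delta> > 0\<close> by (simp add: algebra_simps)
    also have "\<dots> = \<epsilon>"
      using pos by (simp add: \<delta>_def)
    finally show ?thesis .
  qed
  then show "\<exists>B''\<in>Weyl_span. \<forall>u. cmod (c * A u + d * B u - B'' u) \<le> \<epsilon>"
    by (intro bexI[OF _ Weyl_span_lincomb[OF A'(1) B'(1), of c d]]) auto
qed

lemma Weyl_algebra_mult:
  assumes "A \<in> Weyl_algebra" "B \<in> Weyl_algebra"
  shows "(\<lambda>u. A u * B u) \<in> Weyl_algebra"
  unfolding Weyl_algebra_def
proof (intro CollectI allI impI)
  fix \<epsilon> :: real assume \<epsilon>: "\<epsilon> > 0"
  obtain K where K: "K > 0" "\<And>u. cmod (B u) \<le> K"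
    using Weyl_algebra_bounded[OF assms(2)] by blast
  obtain A' where A': "A' \<in> Weyl_span" "\<And>u. cmod (A u - A' u) \<le> \<epsilon> / (2 * K)"
    using Weyl_algebraD[OF assms(1), of "\<epsilon> / (2 * K)"] \<epsilon> K(1) by auto
  \<comment> \<open>The approximant \<open>A'\<close> comes first, because its bound
    \<open>L\<close> fixes how closely \<open>B\<close> has to be approximated.\<close>
  obtain L where L: "L > 0" "\<And>u. cmod (A' u) \<le> L"
    using Weyl_algebra_bounded[OF Weyl_span_subset[OF A'(1)]] by blast
  obtain B' where B': "B' \<in> Weyl_span" "\<And>u. cmod (B u - B' u) \<le> \<epsilon> / (2 * L)"
    using Weyl_algebraD[OF assms(2), of "\<epsilon> / (2 * L)"] \<epsilon> L(1) by auto
  have "cmod (A u * B u - A' u * B' u) \<le> \<epsilon>" for u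
  proof -
    have "A u * B u - A' u * B' u = (A u - A' u) * B u + A' u * (B u - B' u)"
      by (simp add: algebra_simps)
    then have "cmod (A u * B u - A' u * B' u) \<le> cmod (A u - A' u) * cmod (B u) + cmod (A' u) * cmod (B u - B' u)"
      by (metis norm_mult norm_triangle_ineq)
    also have "\<dots> \<le> \<epsilon> / (2 * K) * K + L * (\<epsilon> / (2 * L))"
      using A'(2) K L B'(2) by (intro add_mono mult_mono) (auto intro: order_trans[OF norm_ge_zero])
    also have "\<dots> = \<epsilon>"
      using K(1) L(1) by (simp add: field_simps)
    finally show ?thesis .
  qed
  then show "\<exists>B''\<in>Weyl_span. \<forall>u. cmod (A u * B u - B'' u) \<le> \<epsilon>"
    by (intro bexI[OF _ Weyl_span_mult[OF A'(1) B'(1)]]) auto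
qed

lemma Weyl_algebra_cnj:
  assumes "A \<in> Weyl_algebra"
  shows "(\<lambda>u. cnj (A u)) \<in> Weyl_algebra"
  unfolding Weyl_algebra_def
proof (intro CollectI allI impI)
  fix \<epsilon> :: real assume "\<epsilon> > 0"
  then obtain B where B: "B \<in> Weyl_span" "\<And>u. cmod (A u - B u) \<le> \<epsilon>"
    using Weyl_algebraD[OF assms] by blast
  have "cmod (cnj (A u) - cnj (B u)) \<le> \<epsilon>" for u
    using B(2)[of u] complex_mod_cnj[of "A u - B u"] by simp
  then show "\<exists>B\<in>Weyl_span. \<forall>u. cmod (cnj (A u) - B u) \<le> \<epsilon>"
    by (intro bexI[OF _ Weyl_span_cnj[OF B(1)]]) auto
qed

lemma Weyl_algebra_continuous:
  assumes "A \<in> Weyl_algebra"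
  shows "continuous_on UNIV A"
proof -
  have "\<exists>B. \<forall>n. B n \<in> Weyl_span \<and> (\<forall>u. cmod (A u - B n u) \<le> 1 / real (Suc n))"
    by (intro choice allI Weyl_algebraD[OF assms]) simp
  then obtain B where B: "\<And>n. B n \<in> Weyl_span" "\<And>n u. cmod (A u - B n u) \<le> 1 / real (Suc n)"
    by blast
  have "uniform_limit UNIV B A sequentially"
  proof (rule uniform_limitI)
    fix \<epsilon> :: real assume "\<epsilon> > 0"
    then have "\<forall>\<^sub>F n in sequentially. 1 / real (Suc n) < \<epsilon>"
      using LIMSEQ_inverse_real_of_nat by (auto simp: inverse_eq_divide dest: order_tendstoD)
    then show "\<forall>\<^sub>F n in sequentially. \<forall>u\<in>UNIV. dist (B n u) (A u) < \<epsilon>"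
      by eventually_elim (use B(2) in \<open>auto simp: dist_norm norm_minus_commute intro: le_less_trans\<close>)
  qed
  then show ?thesis
    by (rule uniform_limit_theorem[rotated]) (auto intro: always_eventually Weyl_span_continuous B)
qed

lemmas Weyl_algebra_intros = Weyl_algebra_const W0_in_Weyl_algebra Weyl_algebra_lincomb
  Weyl_algebra_mult Weyl_algebra_cnj

lemma Weyl_algebra_add: "A \<in> Weyl_algebra \<Longrightarrow> B \<in> Weyl_algebra \<Longrightarrow> (\<lambda>u. A u + B u) \<in> Weyl_algebra"
  using Weyl_algebra_lincomb[of A B 1 1] by simp

lemma Weyl_algebra_diff: "A \<in> Weyl_algebra \<Longrightarrow> B \<in> Weyl_algebra \<Longrightarrow> (\<lambda>u. A u - B u) \<in> Weyl_algebra"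
  using Weyl_algebra_lincomb[of A B 1 "- 1"] by simp

lemma Weyl_algebra_divide: "A \<in> Weyl_algebra \<Longrightarrow> (\<lambda>u. A u / c) \<in> Weyl_algebra"
  using Weyl_algebra_lincomb[of A A "1 / c" 0] by simp

text \<open>The GNS seminorm of the vector \<open>\<pi>(A) \<Omega>\<close>. GNS vectors are Cauchy
  sequences in this seminorm, so estimates on them are made here and then passed to the
  limit.\<close>

definition state_norm :: "(('a::complex_hilbert \<Rightarrow> complex) \<Rightarrow> complex) \<Rightarrow> ('a \<Rightarrow> complex) \<Rightarrow> real" where
  "state_norm \<omega> A = sqrt (Re (\<omega> (\<lambda>u. cnj (A u) * A u)))"

locale weyl_state =
  fixes \<omega> :: "('a::complex_hilbert \<Rightarrow> complex) \<Rightarrow> complex"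
  assumes state: "state \<omega>"
begin

lemma lincomb: "A \<in> Weyl_algebra \<Longrightarrow> B \<in> Weyl_algebra \<Longrightarrow> \<omega> (\<lambda>u. c * A u + d * B u) = c * \<omega> A + d * \<omega> B"
  using state by (auto simp: state_def clinear_functional_on_def)

lemma one: "\<omega> (\<lambda>u. 1) = 1"
  using state by (simp add: state_def)

lemma pos: "A \<in> Weyl_algebra \<Longrightarrow> Im (\<omega> (\<lambda>u. cnj (A u) * A u)) = 0"
  "A \<in> Weyl_algebra \<Longrightarrow> 0 \<le> Re (\<omega> (\<lambda>u. cnj (A u) * A u))"
  using state by (auto simp: state_def complex_is_Real_iff)

lemma diff: "A \<in> Weyl_algebra \<Longrightarrow> B \<in> Weyl_algebra \<Longrightarrow> \<omega> (\<lambda>u. A u - B u) = \<omega> A - \<omega> B"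
  using lincomb[of A B 1 "- 1"] by simp

lemma scale: "A \<in> Weyl_algebra \<Longrightarrow> \<omega> (\<lambda>u. c * A u) = c * \<omega> A"
  using lincomb[of A A c 0] by simp

lemma state_norm_nonneg: "state_norm \<omega> A \<ge> 0" if "A \<in> Weyl_algebra"
  unfolding state_norm_def using pos(2)[OF that] by simp

lemma state_norm_square: "A \<in> Weyl_algebra \<Longrightarrow> \<omega> (\<lambda>u. cnj (A u) * A u) = (state_norm \<omega> A)\<^sup>2"
  using pos by (simp add: state_norm_def complex_eq_iff)

lemma form_expand:
  assumes [intro]: "A \<in> Weyl_algebra" "B \<in> Weyl_algebra"
  shows "\<omega> (\<lambda>u. cnj (A u + c * B u) * (A u + c * B u)) =
    \<omega> (\<lambda>u. cnj (A u) * A u) + c * \<omega> (\<lambda>u. cnj (A u) * B u) + cnj c * \<omega> (\<lambda>u. cnj (B u) * A u) +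
    cnj c * c * \<omega> (\<lambda>u. cnj (B u) * B u)"
proof -
  have *: "(\<lambda>u. cnj (A u) * A u) \<in> Weyl_algebra" "(\<lambda>u. cnj (A u) * B u) \<in> Weyl_algebra"
     "(\<lambda>u. cnj (B u) * A u) \<in> Weyl_algebra" "(\<lambda>u. cnj (B u) * B u) \<in> Weyl_algebra"
    by (auto intro!: Weyl_algebra_intros)
  define P where "P = (\<lambda>u. 1 * (cnj (A u) * A u) + c * (cnj (A u) * B u))"
  define Q where "Q = (\<lambda>u. cnj c * (cnj (B u) * A u) + (cnj c * c) * (cnj (B u) * B u))"
  have "(\<lambda>u. cnj (A u + c * B u) * (A u + c * B u)) = (\<lambda>u. 1 * P u + 1 * Q u)"
    by (simp add: P_def Q_def algebra_simps)
  moreover have "\<omega> (\<lambda>u. 1 * P u + 1 * Q u) = 1 * \<omega> P + 1 * \<omega> Q"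
    unfolding P_def Q_def by (intro lincomb Weyl_algebra_lincomb *)
  moreover have "\<omega> P = 1 * \<omega> (\<lambda>u. cnj (A u) * A u) + c * \<omega> (\<lambda>u. cnj (A u) * B u)"
    unfolding P_def by (intro lincomb *)
  moreover have "\<omega> Q = cnj c * \<omega> (\<lambda>u. cnj (B u) * A u) + (cnj c * c) * \<omega> (\<lambda>u. cnj (B u) * B u)"
    unfolding Q_def by (intro lincomb *)
  ultimately show ?thesis
    by simp
qed

text \<open>Polarisation: the form is real on \<open>A + c B\<close>; \<open>c = 1\<close> compares
  the imaginary parts and \<open>c = \<i>\<close> the real parts of the two mixed terms.\<close>

lemma form_hermitian:
  assumes "A \<in> Weyl_algebra" "B \<in> Weyl_algebra"
  shows "\<omega> (\<lambda>u. cnj (B u) * A u) = cnj (\<omega> (\<lambda>u. cnj (A u) * B u))"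
proof -
  have *: "(\<lambda>u. A u + c * B u) \<in> Weyl_algebra" for c
    using Weyl_algebra_lincomb[OF assms, of 1 c] by simp
  show ?thesis
    using pos(1)[OF *[of 1]] pos(1)[OF *[of \<i>]] pos(1)[OF assms(1)] pos(1)[OF assms(2)]
    unfolding form_expand[OF assms]
    by (auto simp: complex_eq_iff)
qed

text \<open>The multiplier \<open>- t cnj f\<close> makes both mixed terms real and equal, so
  positivity becomes a quadratic inequality in the real variable \<open>t\<close>.\<close>

lemma Cauchy_Schwarz:
  assumes "A \<in> Weyl_algebra" "B \<in> Weyl_algebra"
  shows "cmod (\<omega> (\<lambda>u. cnj (A u) * B u)) \<le> state_norm \<omega> A * state_norm \<omega> B"
proof -
  define f where "f = \<omega> (\<lambda>u. cnj (A u) * B u)"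
  define a where "a = (state_norm \<omega> A)\<^sup>2"
  define b where "b = (state_norm \<omega> B)\<^sup>2"
  have *: "(\<lambda>u. A u + c * B u) \<in> Weyl_algebra" for c
    using Weyl_algebra_lincomb[OF assms, of 1 c] by simp
  have quad: "0 \<le> a - 2 * t * (cmod f)\<^sup>2 + t\<^sup>2 * (cmod f)\<^sup>2 * b" for t :: real
  proof -
    have e: "\<omega> (\<lambda>u. cnj (A u + c * B u) * (A u + c * B u)) = a + c * f + cnj c * cnj f + cnj c * c * b" for c
      unfolding form_expand[OF assms] form_hermitian[OF assms] f_def a_def b_def
      by (simp only: state_norm_square assms)
    have "0 \<le> Re (complex_of_real a + (- (t * cnj f)) * f + cnj (- (t * cnj f)) * cnj f + cnj (- (t * cnj f)) * (- (t * cnj f)) * b)"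
      using pos(2)[OF *[of "- (t * cnj f)"]] unfolding e .
    then show ?thesis
      unfolding cmod_power2 by (simp add: power2_eq_square algebra_simps)
  qed
  have b: "b \<ge> 0" "a \<ge> 0"
    by (simp_all add: b_def a_def)
  have "(cmod f)\<^sup>2 \<le> a * b"
  proof (cases "b = 0")
    case True
    have "cmod f = 0"
    proof (rule ccontr)
      assume "cmod f \<noteq> 0"
      then have "(cmod f)\<^sup>2 > 0"
        by simp
      then show False
        \<comment> \<open>With \<open>b = 0\<close> the quadratic is affine in \<open>t\<close>, and
          this \<open>t\<close> gives it the value -1.\<close>
        using quad[of "(a + 1) / (2 * (cmod f)\<^sup>2)"] True by (simp add: field_simps)
    qed
    then show ?thesis
      using b by simp
  next
    case False
    then show ?thesis
      \<comment> \<open>The minimum of the quadratic is attained here.\<close>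
      using quad[of "1 / b"] b by (simp add: field_simps power2_eq_square)
  qed
  then have "cmod f \<le> sqrt (a * b)"
    by (rule real_le_rsqrt)
  then show ?thesis
    by (simp add: f_def a_def b_def real_sqrt_mult state_norm_nonneg assms)
qed

lemma norm_le_state_norm:
  assumes "A \<in> Weyl_algebra"
  shows "cmod (\<omega> A) \<le> state_norm \<omega> A"
  using Cauchy_Schwarz[OF Weyl_algebra_const[of 1] assms] by (simp add: state_norm_def one)

lemma state_norm_triangle:
  assumes "A \<in> Weyl_algebra" "B \<in> Weyl_algebra"
  shows "state_norm \<omega> (\<lambda>u. A u + B u) \<le> state_norm \<omega> A + state_norm \<omega> B"
proof -
  have "(\<lambda>u. A u + B u) \<in> Weyl_algebra"
    by (intro Weyl_algebra_add assms)
  from state_norm_square[OF this] have "complex_of_real ((state_norm \<omega> (\<lambda>u. A u + B u))\<^sup>2) =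
      (state_norm \<omega> A)\<^sup>2 + \<omega> (\<lambda>u. cnj (A u) * B u) + cnj (\<omega> (\<lambda>u. cnj (A u) * B u)) + (state_norm \<omega> B)\<^sup>2"
    using form_expand[OF assms, of 1] by (simp add: form_hermitian[OF assms] state_norm_square assms)
  then have "Re (complex_of_real ((state_norm \<omega> (\<lambda>u. A u + B u))\<^sup>2)) =
      Re ((state_norm \<omega> A)\<^sup>2 + \<omega> (\<lambda>u. cnj (A u) * B u) + cnj (\<omega> (\<lambda>u. cnj (A u) * B u)) + (state_norm \<omega> B)\<^sup>2)"
    by (rule arg_cong)
  then have "(state_norm \<omega> (\<lambda>u. A u + B u))\<^sup>2 =
      (state_norm \<omega> A)\<^sup>2 + 2 * Re (\<omega> (\<lambda>u. cnj (A u) * B u)) + (state_norm \<omega> B)\<^sup>2"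
    by simp
  also have "\<dots> \<le> (state_norm \<omega> A + state_norm \<omega> B)\<^sup>2"
    using complex_Re_le_cmod[of "\<omega> (\<lambda>u. cnj (A u) * B u)"] Cauchy_Schwarz[OF assms]
    by (simp add: power2_sum)
  finally show ?thesis
    by (rule power2_le_imp_le) (simp add: state_norm_nonneg assms)
qed

lemma state_norm_minus: "state_norm \<omega> (\<lambda>u. - A u) = state_norm \<omega> A"
  by (simp add: state_norm_def)

lemma state_norm_W0_mult: "state_norm \<omega> (\<lambda>u. W0 g u * A u) = state_norm \<omega> A"
proof -
  have "cnj (W0 g u * A u) * (W0 g u * A u) = (cnj (W0 g u) * W0 g u) * (cnj (A u) * A u)" for u
    by (simp only: complex_cnj_mult mult_ac)
  then show ?thesis
    unfolding state_norm_def by (simp only: cnj_W0_mult_W0 mult_1)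
qed

lemma state_norm_diff_le:
  assumes "A \<in> Weyl_algebra" "B \<in> Weyl_algebra"
  shows "\<bar>state_norm \<omega> A - state_norm \<omega> B\<bar> \<le> state_norm \<omega> (\<lambda>u. A u - B u)"
proof -
  have "state_norm \<omega> A \<le> state_norm \<omega> (\<lambda>u. A u - B u) + state_norm \<omega> B"
    using state_norm_triangle[OF Weyl_algebra_diff[OF assms] assms(2)] by simp
  moreover have "state_norm \<omega> B \<le> state_norm \<omega> (\<lambda>u. A u - B u) + state_norm \<omega> A"
    using state_norm_triangle[OF Weyl_algebra_diff[OF assms(2,1)] assms(1)]
      state_norm_minus[of "\<lambda>u. A u - B u"] by simp
  ultimately show ?thesis
    by linarith
qed

section \<open>Vectors of the GNS space as Cauchy sequences\<close>

lemma gns_space_iff: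
  "\<xi> \<in> gns_space \<omega> \<longleftrightarrow> (\<forall>n. \<xi> n \<in> Weyl_algebra) \<and>
    (\<forall>\<epsilon>>0. \<exists>N. \<forall>m\<ge>N. \<forall>n\<ge>N. state_norm \<omega> (\<lambda>u. \<xi> m u - \<xi> n u) < \<epsilon>)"
  by (simp add: gns_space_def state_norm_def)

lemma gns_spaceD: "\<xi> \<in> gns_space \<omega> \<Longrightarrow> \<xi> n \<in> Weyl_algebra"
  by (simp add: gns_space_iff)

text \<open>\<open>gns_norm\<close> is defined through \<open>lim\<close>, which says nothing unless
  the limit exists. By the reverse triangle inequality the seminorms along a GNS vector form a
  Cauchy sequence.\<close>

lemma gns_norm_LIMSEQ:
  assumes "\<xi> \<in> gns_space \<omega>"
  shows "(\<lambda>n. state_norm \<omega> (\<xi> n)) \<longlonglongrightarrow> gns_norm \<omega> \<xi>"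
proof -
  have W: "\<xi> n \<in> Weyl_algebra" for n
    using assms by (rule gns_spaceD)
  have "Cauchy (\<lambda>n. state_norm \<omega> (\<xi> n))"
  proof (rule metric_CauchyI)
    fix \<epsilon> :: real assume "\<epsilon> > 0"
    then obtain N where "\<forall>m\<ge>N. \<forall>n\<ge>N. state_norm \<omega> (\<lambda>u. \<xi> m u - \<xi> n u) < \<epsilon>"
      using assms by (auto simp: gns_space_iff)
    then show "\<exists>M. \<forall>m\<ge>M. \<forall>n\<ge>M. dist (state_norm \<omega> (\<xi> m)) (state_norm \<omega> (\<xi> n)) < \<epsilon>"
      by (intro exI[of _ N]) (auto simp: dist_real_def intro: le_less_trans[OF state_norm_diff_le[OF W W]])
  qed
  then obtain l where l: "(\<lambda>n. state_norm \<omega> (\<xi> n)) \<longlonglongrightarrow> l"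
    by (auto simp: Cauchy_convergent_iff convergent_def)
  then have "(\<lambda>n. complex_of_real ((state_norm \<omega> (\<xi> n))\<^sup>2)) \<longlonglongrightarrow> complex_of_real (l\<^sup>2)"
    by (intro tendsto_intros)
  then have "gns_inner \<omega> \<xi> \<xi> = complex_of_real (l\<^sup>2)"
    unfolding gns_inner_def by (intro limI) (simp add: state_norm_square W)
  moreover have "l \<ge> 0"
    using LIMSEQ_le_const[OF l] state_norm_nonneg[OF W] by blast
  ultimately show ?thesis
    using l by (simp add: gns_norm_def)
qed

text \<open>The state is bounded by its own seminorm with constant 1, so its values along a GNS
  vector form a Cauchy sequence.\<close>

lemma gns_inner_vac_LIMSEQ:
  assumes "\<eta> \<in> gns_space \<omega>"
  shows "(\<lambda>n. \<omega> (\<eta> n)) \<longlonglongrightarrow> gns_inner \<omega> gns_vac \<eta>"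
proof -
  have W: "\<eta> n \<in> Weyl_algebra" for n
    using assms by (rule gns_spaceD)
  have "Cauchy (\<lambda>n. \<omega> (\<eta> n))"
  proof (rule metric_CauchyI)
    fix \<epsilon> :: real assume "\<epsilon> > 0"
    then obtain N where N: "\<forall>m\<ge>N. \<forall>n\<ge>N. state_norm \<omega> (\<lambda>u. \<eta> m u - \<eta> n u) < \<epsilon>"
      using assms by (auto simp: gns_space_iff)
    have "dist (\<omega> (\<eta> m)) (\<omega> (\<eta> n)) < \<epsilon>" if "m \<ge> N" "n \<ge> N" for m n
      using N that norm_le_state_norm[OF Weyl_algebra_diff[OF W W], of m n]
      by (auto simp: dist_norm diff[OF W W, symmetric] intro: le_less_trans)
    then show "\<exists>M. \<forall>m\<ge>M. \<forall>n\<ge>M. dist (\<omega> (\<eta> m)) (\<omega> (\<eta> n)) < \<epsilon>"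
      by blast
  qed
  then show ?thesis
    by (simp add: gns_inner_def gns_vac_def Cauchy_convergent_iff convergent_LIMSEQ_iff)
qed

lemma gns_space_diff:
  assumes "\<xi> \<in> gns_space \<omega>" "\<eta> \<in> gns_space \<omega>"
  shows "(\<lambda>n u. \<xi> n u - \<eta> n u) \<in> gns_space \<omega>"
  unfolding gns_space_iff
proof safe
  have W: "\<xi> n \<in> Weyl_algebra" "\<eta> n \<in> Weyl_algebra" for n
    using assms by (auto dest: gns_spaceD)
  then show "(\<lambda>u. \<xi> n u - \<eta> n u) \<in> Weyl_algebra" for n
    by (intro Weyl_algebra_diff)
  fix \<epsilon> :: real assume "\<epsilon> > 0"
  then obtain N N' where N: "\<forall>m\<ge>N. \<forall>n\<ge>N. state_norm \<omega> (\<lambda>u. \<xi> m u - \<xi> n u) < \<epsilon> / 2"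
    "\<forall>m\<ge>N'. \<forall>n\<ge>N'. state_norm \<omega> (\<lambda>u. \<eta> m u - \<eta> n u) < \<epsilon> / 2"
    using assms by (metis gns_space_iff half_gt_zero)
  have "state_norm \<omega> (\<lambda>u. \<xi> m u - \<eta> m u - (\<xi> n u - \<eta> n u)) < \<epsilon>" if "m \<ge> max N N'" "n \<ge> max N N'" for m n
  proof -
    have "state_norm \<omega> (\<lambda>u. \<xi> m u - \<eta> m u - (\<xi> n u - \<eta> n u)) =
        state_norm \<omega> (\<lambda>u. (\<xi> m u - \<xi> n u) + (\<eta> n u - \<eta> m u))"
      by (simp add: algebra_simps)
    also have "\<dots> \<le> state_norm \<omega> (\<lambda>u. \<xi> m u - \<xi> n u) + state_norm \<omega> (\<lambda>u. \<eta> n u - \<eta> m u)"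
      by (intro state_norm_triangle Weyl_algebra_diff W)
    also have "\<dots> < \<epsilon> / 2 + \<epsilon> / 2"
      using N that by (intro add_strict_mono) auto
    finally show ?thesis
      by simp
  qed
  then show "\<exists>N. \<forall>m\<ge>N. \<forall>n\<ge>N. state_norm \<omega> (\<lambda>u. \<xi> m u - \<eta> m u - (\<xi> n u - \<eta> n u)) < \<epsilon>"
    by blast
qed

lemma gns_space_const: "A \<in> Weyl_algebra \<Longrightarrow> (\<lambda>n. A) \<in> gns_space \<omega>"
  unfolding gns_space_iff using scale[OF Weyl_algebra_const[of 1], of 0] by (simp add: state_norm_def)

lemma gns_space_rep: "\<xi> \<in> gns_space \<omega> \<Longrightarrow> gns_rep (W0 g) \<xi> \<in> gns_space \<omega>"
  unfolding gns_space_iff gns_rep_def right_diff_distrib[symmetric] state_norm_W0_mult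
  by (auto intro!: Weyl_algebra_intros)

lemma gns_norm_rep: "gns_norm \<omega> (\<lambda>n u. W0 g u * \<xi> n u) = gns_norm \<omega> \<xi>"
proof -
  have "cnj (W0 g u * \<xi> n u) * (W0 g u * \<xi> n u) = (cnj (W0 g u) * W0 g u) * (cnj (\<xi> n u) * \<xi> n u)" for n u
    by (simp only: complex_cnj_mult mult_ac)
  then show ?thesis
    unfolding gns_norm_def gns_inner_def by (simp only: cnj_W0_mult_W0 mult_1)
qed

text \<open>The algebra is commutative, so \<open>W0 g\<close> commutes with
  \<open>W0 (t f)\<close>; being isometric, it carries the difference quotients of the vacuum and
  their limit along.\<close>

lemma has_field_value_rep:
  assumes "has_field_value \<omega> f gns_vac \<eta>"
  shows "has_field_value \<omega> f (gns_rep (W0 g) gns_vac) (gns_rep (W0 g) \<eta>)"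
proof -
  have "(gns_rep (W0 (t *\<^sub>R f)) (gns_rep (W0 g) gns_vac) n u - gns_rep (W0 g) gns_vac n u) / (\<i> * of_real t) - gns_rep (W0 g) \<eta> n u =
    W0 g u * ((gns_rep (W0 (t *\<^sub>R f)) gns_vac n u - gns_vac n u) / (\<i> * of_real t) - \<eta> n u)" for t n u
    by (simp add: gns_rep_def algebra_simps diff_divide_distrib)
  then show ?thesis
    using assms unfolding has_field_value_def by (simp add: gns_space_rep gns_norm_rep)
qed

text \<open>The difference quotients of the vectors converge in GNS norm, and the state, as pairing
  with the vacuum, is bounded by that norm; so the scalar quotients converge too. The factor
  \<open>\<i>\<close> undoes the division by \<open>\<i> t\<close> in the generator.\<close>

lemma has_field_value_derivative:
  assumes "has_field_value \<omega> f (gns_rep (W0 g) gns_vac) \<eta>"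
  shows "((\<lambda>t. \<omega> (W0 (g + t *\<^sub>R f))) has_vector_derivative \<i> * gns_inner \<omega> gns_vac \<eta>) (at 0)"
proof -
  define Q where "Q t = (\<lambda>u. (W0 (g + t *\<^sub>R f) u - W0 g u) / (\<i> * complex_of_real t))" for t
  have Q: "Q t \<in> Weyl_algebra" for t
    unfolding Q_def by (intro Weyl_algebra_divide Weyl_algebra_diff W0_in_Weyl_algebra)
  have \<eta>: "\<eta> \<in> gns_space \<omega>"
    using assms by (simp add: has_field_value_def)
  have W: "\<eta> n \<in> Weyl_algebra" for n
    using \<eta> by (rule gns_spaceD)
  have lim: "((\<lambda>t. gns_norm \<omega> (\<lambda>n u. Q t u - \<eta> n u)) \<longlongrightarrow> 0) (at 0)"
    using assms by (simp add: has_field_value_def Q_def gns_rep_def gns_vac_def W0_add mult.commute)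
  have "((\<lambda>t. \<omega> (Q t) - gns_inner \<omega> gns_vac \<eta>) \<longlongrightarrow> 0) (at 0)"
  proof (rule Lim_null_comparison[OF always_eventually[OF allI] lim])
    fix t
    have "(\<lambda>n u. Q t u - \<eta> n u) \<in> gns_space \<omega>"
      using gns_space_diff[OF gns_space_const[OF Q] \<eta>] .
    then have l1: "(\<lambda>n. state_norm \<omega> (\<lambda>u. Q t u - \<eta> n u)) \<longlonglongrightarrow> gns_norm \<omega> (\<lambda>n u. Q t u - \<eta> n u)"
      by (rule gns_norm_LIMSEQ)
    have l2: "(\<lambda>n. cmod (\<omega> (Q t) - \<omega> (\<eta> n))) \<longlonglongrightarrow> cmod (\<omega> (Q t) - gns_inner \<omega> gns_vac \<eta>)"
      by (intro tendsto_intros gns_inner_vac_LIMSEQ \<eta>)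
    show "cmod (\<omega> (Q t) - gns_inner \<omega> gns_vac \<eta>) \<le> gns_norm \<omega> (\<lambda>n u. Q t u - \<eta> n u)"
      using norm_le_state_norm[OF Weyl_algebra_diff[OF Q W]]
      by (intro LIMSEQ_le[OF l2 l1]) (auto simp: diff[OF Q W, symmetric])
  qed
  then have "((\<lambda>t. \<i> * \<omega> (Q t)) \<longlongrightarrow> \<i> * gns_inner \<omega> gns_vac \<eta>) (at 0)"
    by (intro tendsto_mult_left) (simp add: LIM_zero_iff)
  moreover have "\<i> * \<omega> (Q t) = (\<omega> (W0 (g + t *\<^sub>R f)) - \<omega> (W0 (g + 0 *\<^sub>R f))) / complex_of_real t" for t
    using scale[OF Weyl_algebra_diff[OF W0_in_Weyl_algebra W0_in_Weyl_algebra], of "1 / (\<i> * complex_of_real t)" "g + t *\<^sub>R f" g]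
    by (simp add: Q_def diff W0_in_Weyl_algebra)
  ultimately show ?thesis
    by (simp only: has_vector_derivative_at_0_iff)
qed

text \<open>The choice operator in \<open>field_expectation\<close> is harmless: every admissible
  value yields the same derivative, and class C^2 provides one for the vacuum, transported by
  \<open>W0 g\<close>.\<close>

lemma field_expectation_derivative:
  assumes "class_C2 \<omega>"
  shows "((\<lambda>t. \<omega> (W0 (g + t *\<^sub>R f))) has_vector_derivative \<i> * field_expectation \<omega> f g) (at 0)"
proof -
  obtain \<eta> where "has_field_value \<omega> f gns_vac \<eta>"
    using assms unfolding class_C2_def by blast
  then have "has_field_value \<omega> f (gns_rep (W0 g) gns_vac) (gns_rep (W0 g) \<eta>)"
    by (rule has_field_value_rep)
  then have "has_field_value \<omega> f (gns_rep (W0 g) gns_vac) (SOME \<eta>. has_field_value \<omega> f (gns_rep (W0 g) gns_vac) \<eta>)"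
    by (rule someI[where P="has_field_value \<omega> f (gns_rep (W0 g) gns_vac)"])
  then show ?thesis
    unfolding field_expectation_def by (rule has_field_value_derivative)
qed

end

section \<open>Positive operators with an eigenbasis\<close>

instance complex_hilbert \<subseteq> banach ..

section \<open>Complex scalars in the underlying real Hilbert space\<close>

lemma scaleC_zero_left [simp]: "0 *\<^sub>C (x::'a::complex_hilbert) = 0"
  using scaleR_scaleC[of 0 x] by simp

lemma scaleC_one [simp]: "1 *\<^sub>C (x::'a::complex_hilbert) = x"
  using scaleR_scaleC[of 1 x] by simp

lemma scaleC_zero_right [simp]: "c *\<^sub>C (0::'a::complex_hilbert) = 0"
  using scaleC_scaleC[of c 0 "0::'a"] by simp

lemma scaleC_minus_one: "(- 1) *\<^sub>C (x::'a::complex_hilbert) = - x"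
  using scaleR_scaleC[of "- 1" x] by simp

lemma scaleC_scaleR: "c *\<^sub>C (r *\<^sub>R (x::'a::complex_hilbert)) = r *\<^sub>R (c *\<^sub>C x)"
  by (simp add: scaleR_scaleC scaleC_scaleC mult.commute)

lemma i_scaleC_i_scaleC [simp]: "\<i> *\<^sub>C (\<i> *\<^sub>C (x::'a::complex_hilbert)) = - x"
  by (simp add: scaleC_scaleC scaleC_minus_one)

lemma scaleC_minus_right: "c *\<^sub>C (- x::'a::complex_hilbert) = - (c *\<^sub>C x)"
  using scaleC_scaleR[of c "- 1" x] by simp

lemma scaleC_eq: "c *\<^sub>C (x::'a::complex_hilbert) = Re c *\<^sub>R x + Im c *\<^sub>R (\<i> *\<^sub>C x)"
  by (subst complex_eq[of c]) (simp add: scaleC_add_left scaleR_scaleC scaleC_scaleC mult.commute)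

lemma linear_scaleC: "linear (\<lambda>x::'a::complex_hilbert. c *\<^sub>C x)"
  by (intro linearI) (simp_all add: scaleC_add_right scaleC_scaleR)

lemma cinner_scaleC_left: "cinner (c *\<^sub>C (x::'a::complex_hilbert)) y = cnj c * cinner x y"
  by (metis cinner_commute cinner_scaleC_right complex_cnj_mult)

lemma inner_i_left: "inner (\<i> *\<^sub>C (x::'a::complex_hilbert)) y = Im (cinner x y)"
  by (simp add: inner_eq_Re_cinner cinner_scaleC_left)

lemma cinner_eq: "cinner (x::'a::complex_hilbert) y = Complex (inner x y) (inner (\<i> *\<^sub>C x) y)"
  by (simp add: complex_eq_iff inner_i_left) (simp add: inner_eq_Re_cinner)

lemma sigma_eq: "sigma (f::'a::complex_hilbert) g = inner (\<i> *\<^sub>C f) g"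
  by (simp add: sigma_def inner_i_left)

lemma inner_i_right: "inner (x::'a::complex_hilbert) (\<i> *\<^sub>C y) = - inner (\<i> *\<^sub>C x) y"
  by (simp add: inner_i_left) (simp add: inner_eq_Re_cinner cinner_scaleC_right)

lemma inner_i_self: "inner (\<i> *\<^sub>C (x::'a::complex_hilbert)) x = 0"
  using inner_i_right[of x x] by (simp add: inner_commute)

section \<open>Orthogonal series and sums over pairs of indices\<close>

lemma orthogonal_norm_sum:
  fixes v :: "'i \<Rightarrow> 'b::real_inner"
  assumes "finite A" "\<And>i j. i \<in> A \<Longrightarrow> j \<in> A \<Longrightarrow> i \<noteq> j \<Longrightarrow> inner (v i) (v j) = 0"
  shows "(norm (\<Sum>j\<in>A. v j))\<^sup>2 = (\<Sum>j\<in>A. (norm (v j))\<^sup>2)"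
  by (rule norm_sum_Pythagorean) (use assms in \<open>auto simp: pairwise_def orthogonal_def\<close>)

text \<open>By Pythagoras, blocks of the series are as small as blocks of the summable squares. Used
  for the inverse of \<open>H\<close>, for Riesz representatives and for the random series.\<close>

lemma orthogonal_series_convergent:
  fixes v :: "nat \<Rightarrow> 'b::{real_inner, complete_space}"
  assumes orth: "\<And>i j. i \<noteq> j \<Longrightarrow> inner (v i) (v j) = 0" and sum: "summable (\<lambda>j. (norm (v j))\<^sup>2)"
  shows "convergent (\<lambda>n. \<Sum>j<n. v j)"
proof (rule Cauchy_convergent, rule metric_CauchyI)
  fix \<epsilon> :: real assume "\<epsilon> > 0"
  then obtain N where N: "\<And>m n. m \<ge> N \<Longrightarrow> norm (\<Sum>j=m..<n. (norm (v j))\<^sup>2) < \<epsilon>\<^sup>2"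
    using sum unfolding summable_Cauchy by (meson zero_less_power)
  have *: "dist (\<Sum>j<m. v j) (\<Sum>j<n. v j) < \<epsilon>" if "N \<le> m" "m \<le> n" for m n
  proof -
    have "(\<Sum>j<n. v j) = (\<Sum>j<m. v j) + (\<Sum>j=m..<n. v j)"
      using that by (simp add: sum.atLeastLessThan_concat[of 0 m n, symmetric] lessThan_atLeast0)
    then have "(dist (\<Sum>j<m. v j) (\<Sum>j<n. v j))\<^sup>2 = (norm (\<Sum>j=m..<n. v j))\<^sup>2"
      by (simp add: dist_norm norm_minus_commute)
    also have "\<dots> = (\<Sum>j=m..<n. (norm (v j))\<^sup>2)"
      by (intro orthogonal_norm_sum) (auto intro: orth)
    also have "\<dots> < \<epsilon>\<^sup>2"
      using N[OF that(1), of n] by (simp add: sum_nonneg)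
    finally show ?thesis
      using \<open>\<epsilon> > 0\<close> by (simp add: power_less_imp_less_base)
  qed
  show "\<exists>M. \<forall>m\<ge>M. \<forall>n\<ge>M. dist (\<Sum>j<m. v j) (\<Sum>j<n. v j) < \<epsilon>"
    using * by (intro exI[of _ N] allI impI) (metis dist_commute nle_le)
qed

text \<open>Translates between the complex eigenbasis, indexed by \<open>k\<close>, and the real
  basis, in which mode \<open>k\<close> occupies the indices \<open>2 * k\<close> and
  \<open>2 * k + 1\<close>.\<close>

lemma summable_pairsI:
  fixes f :: "nat \<Rightarrow> real"
  assumes nonneg: "\<And>j. 0 \<le> f j" and sum: "summable (\<lambda>k. f (2 * k) + f (2 * k + 1))"
  shows "summable f"
proof (rule summableI_nonneg_bounded[OF nonneg])
  fix n
  have "(\<Sum>j<n. f j) \<le> (\<Sum>j<2 * n. f j)"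
    by (intro sum_mono2) (auto simp: nonneg)
  also have "(\<Sum>j<2 * n. f j) = (\<Sum>k<n. f (2 * k) + f (2 * k + 1))"
    by (induction n) (simp_all add: algebra_simps)
  also have "\<dots> \<le> suminf (\<lambda>k. f (2 * k) + f (2 * k + 1))"
    by (intro sum_le_suminf sum) (auto simp: nonneg)
  finally show "(\<Sum>j<n. f j) \<le> suminf (\<lambda>k. f (2 * k) + f (2 * k + 1))" .
qed

lemma summable_pairsD:
  fixes f :: "nat \<Rightarrow> real"
  assumes "summable f"
  shows "summable (\<lambda>k. f (2 * k) + f (Suc (2 * k)))"
proof -
  have "summable (\<lambda>n. sum f {n * 2..<n * 2 + 2})"
    using sums_group[OF summable_sums[OF assms], of 2] by (auto simp: sums_iff)
  moreover have "sum f {n * 2..<n * 2 + 2} = f (2 * n) + f (Suc (2 * n))" for n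
    by (simp add: numeral_2_eq_2 mult.commute)
  ultimately show ?thesis
    by simp
qed

lemma suminf_pairs:
  fixes f :: "nat \<Rightarrow> real"
  assumes "summable f"
  shows "suminf f = suminf (\<lambda>k. f (2 * k) + f (2 * k + 1))"
proof -
  have "(\<lambda>n. sum f {n * 2..<n * 2 + 2}) sums suminf f"
    using sums_group[OF summable_sums[OF assms], of 2] by simp
  moreover have "sum f {n * 2..<n * 2 + 2} = f (2 * n) + f (2 * n + 1)" for n
    by (simp add: numeral_2_eq_2 mult.commute)
  ultimately show ?thesis
    by (simp add: sums_iff)
qed

lemma infsum_single_support:
  fixes f :: "'i \<Rightarrow> 'b::{comm_monoid_add, t2_space}"
  assumes "i \<in> A" "\<And>j. j \<in> A \<Longrightarrow> j \<noteq> i \<Longrightarrow> f j = 0"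
  shows "infsum f A = f i"
proof -
  have "infsum f A = infsum f {i}"
    using assms by (intro infsum_cong_neutral) auto
  then show ?thesis
    by simp
qed

lemma summable_on_nat_iff:
  fixes f :: "nat \<Rightarrow> real"
  assumes "\<And>k. k \<in> I \<Longrightarrow> f k \<ge> 0"
  shows "f summable_on I \<longleftrightarrow> summable (\<lambda>k. if k \<in> I then f k else 0)"
proof -
  have "f summable_on I \<longleftrightarrow> (\<lambda>k. if k \<in> I then f k else 0) summable_on UNIV"
    by (intro summable_on_cong_neutral) auto
  also have "\<dots> \<longleftrightarrow> summable (\<lambda>k. if k \<in> I then f k else 0)"
    using assms by (intro summable_on_UNIV_nonneg_real_iff) auto
  finally show ?thesis .
qed

locale positive_discrete_operator =
  fixes D :: "'a::complex_hilbert set" and H :: "'a \<Rightarrow> 'a" and I :: "nat set" and e :: "nat \<Rightarrow> 'a"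
    and s :: real
  assumes selfadjoint: "selfadjoint_operator D H" and positive: "positive_operator D H"
    and eigen: "eigenbasis D H I e" and s_pos: "s > 0" and trace: "trace_finite H I e (- s)"
begin

text \<open>The value 1 outside \<open>I\<close> keeps all weights positive, so that finite
  dimension needs no case distinction in divisions and powers.\<close>

definition lam :: "nat \<Rightarrow> real" where
  "lam k = (if k \<in> I then eigenvalue H e k else 1)"

definition kap :: "nat \<Rightarrow> real" where
  "kap j = lam (j div 2)"

text \<open>The real orthonormal basis \<open>e\<^sub>0, ie\<^sub>0, e\<^sub>1, ie\<^sub>1, \<dots>\<close>, padded by zeros if the dimension is finite.\<close>

definition bas :: "nat \<Rightarrow> 'a" where
  "bas j = (if j div 2 \<in> I then if even j then e (j div 2) else \<i> *\<^sub>C e (j div 2) else 0)"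

definition proj :: "nat \<Rightarrow> 'a \<Rightarrow> 'a" where
  "proj n g = (\<Sum>j<n. inner (bas j) g *\<^sub>R bas j)"

section \<open>The real eigenbasis and its projections\<close>

lemma cinner_e: "j \<in> I \<Longrightarrow> k \<in> I \<Longrightarrow> cinner (e j) (e k) = (if j = k then 1 else 0)"
  using eigen by (simp add: eigenbasis_def)

lemma e_in_D: "k \<in> I \<Longrightarrow> e k \<in> D"
  using eigen by (simp add: eigenbasis_def)

lemma H_e: "k \<in> I \<Longrightarrow> H (e k) = lam k *\<^sub>R e k"
  using eigen by (simp add: eigenbasis_def lam_def scaleR_scaleC)

lemma lam_pos: "lam k > 0"
proof (cases "k \<in> I")
  case True
  then have "e k \<noteq> 0"
    using cinner_e[OF True True] cinner_scaleC_right[of "e k" 0 "e k"] by auto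
  then show ?thesis
    using positive e_in_D[OF True] True by (simp add: positive_operator_def lam_def eigenvalue_def)
qed (simp add: lam_def)

lemma kap_pos: "kap j > 0"
  by (simp add: kap_def lam_pos)

lemma inner_bas: "inner (bas i) (bas j) = (if i = j \<and> i div 2 \<in> I then 1 else 0)"
proof (cases "i div 2 \<in> I \<and> j div 2 \<in> I")
  case True
  have "i = j \<longleftrightarrow> i div 2 = j div 2 \<and> (even i \<longleftrightarrow> even j)"
    by (metis dvd_mult_div_cancel odd_two_times_div_two_succ)
  then show ?thesis
    using True by (auto simp: bas_def inner_eq_Re_cinner cinner_scaleC_left cinner_scaleC_right cinner_e)
qed (auto simp: bas_def)

lemma norm_bas_square: "(norm (bas j))\<^sup>2 = (if j div 2 \<in> I then 1 else 0)"
  by (simp add: power2_norm_eq_inner inner_bas)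

lemma inner_bas_proj: "inner (bas i) (proj n g) = (if i < n then inner (bas i) g else 0)"
proof -
  have "inner (bas i) (proj n g) = (\<Sum>j<n. if j = i then inner (bas i) g else 0)"
    unfolding proj_def inner_sum_right
    by (intro sum.cong) (auto simp: inner_bas, auto simp: bas_def)
  then show ?thesis
    by simp
qed

lemma linear_proj: "linear (proj n)"
  unfolding proj_def
  by (intro linearI) (simp_all add: inner_add_right scaleR_add_left sum.distrib scaleR_right.sum)

lemma proj_bas: "j < n \<Longrightarrow> proj n (bas j) = bas j"
proof -
  assume "j < n"
  have "proj n (bas j) = (\<Sum>i<n. if i = j then bas j else 0)"
    unfolding proj_def by (intro sum.cong) (auto simp: inner_bas, auto simp: bas_def)
  with \<open>j < n\<close> show ?thesis
    by simp
qed

lemma inner_proj_left: "inner (proj n f) g = (\<Sum>j<n. inner (bas j) f * inner (bas j) g)"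
  by (simp add: proj_def inner_sum_left)

text \<open>Pythagoras. The right side shows that the complementary projection does not increase
  norms, which is how it is used.\<close>

lemma norm_diff_proj_square: "(norm (g - proj n g))\<^sup>2 = (norm g)\<^sup>2 - (\<Sum>j<n. (inner (bas j) g)\<^sup>2)"
proof -
  have pp: "inner (proj n g) (proj n g) = inner (proj n g) g"
    unfolding inner_proj_left by (intro sum.cong) (auto simp: inner_bas_proj)
  then have "(norm (g - proj n g))\<^sup>2 = inner g g - inner (proj n g) g"
    by (simp add: power2_norm_eq_inner inner_diff_left inner_diff_right inner_commute)
  then show ?thesis
    by (simp only: inner_proj_left power2_norm_eq_inner[of g]) (simp add: power2_eq_square)
qed

lemma proj_scaleC_e: "k \<in> I \<Longrightarrow> 2 * k + 1 < n \<Longrightarrow> proj n (c *\<^sub>C e k) = c *\<^sub>C e k"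
proof -
  assume k: "k \<in> I" "2 * k + 1 < n"
  have "c *\<^sub>C e k = Re c *\<^sub>R bas (2 * k) + Im c *\<^sub>R bas (2 * k + 1)"
    using k by (subst scaleC_eq) (simp add: bas_def)
  then show ?thesis
    using k by (simp add: linear_add[OF linear_proj] linear_cmul[OF linear_proj] proj_bas)
qed

text \<open>Finite combinations of eigenvectors are dense and are fixed by \<open>proj n\<close> for
  large \<open>n\<close>; on the remaining error the complementary projection is a
  contraction.\<close>

lemma proj_LIMSEQ: "(\<lambda>n. proj n g) \<longlonglongrightarrow> g"
proof (rule metric_LIMSEQ_I)
  fix \<epsilon> :: real assume "\<epsilon> > 0"
  have "g \<in> closure {(\<Sum>k\<in>F. c k *\<^sub>C e k) | F c. finite F \<and> F \<subseteq> I}"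
    using eigen by (simp add: eigenbasis_def)
  then have "\<exists>x\<in>{(\<Sum>k\<in>F. c k *\<^sub>C e k) | F c. finite F \<and> F \<subseteq> I}. dist x g < \<epsilon>"
    using \<open>\<epsilon> > 0\<close> by (simp only: closure_approachable)
  then obtain x F c where F: "finite F" "F \<subseteq> I" and x_def: "x = (\<Sum>k\<in>F. c k *\<^sub>C e k)"
    and d: "dist x g < \<epsilon>"
    by blast
  obtain M where M: "\<And>k. k \<in> F \<Longrightarrow> k \<le> M"
    using F(1) by (meson finite_nat_set_iff_bounded_le)
  \<comment> \<open>The largest real index of a mode \<open>k \<le> M\<close> is
    \<open>2 * M + 1\<close>.\<close>
  have "dist (proj n g) g < \<epsilon>" if n: "n \<ge> 2 * M + 2" for n
  proof -
    have "2 * k + 1 < n" if "k \<in> F" for k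
      using M[OF that] n by linarith
    then have "proj n x = x"
      unfolding x_def using F by (auto simp: linear_sum[OF linear_proj] intro!: sum.cong proj_scaleC_e)
    then have *: "g - proj n g = (g - x) - proj n (g - x)"
      by (simp add: linear_diff[OF linear_proj])
    have "(norm (g - proj n g))\<^sup>2 \<le> (norm (g - x))\<^sup>2"
      unfolding * norm_diff_proj_square by (simp add: sum_nonneg)
    then have "norm (g - proj n g) \<le> norm (g - x)"
      by (rule power2_le_imp_le) simp
    then show ?thesis
      using d by (simp add: dist_norm norm_minus_commute)
  qed
  then show "\<exists>N. \<forall>n\<ge>N. dist (proj n g) g < \<epsilon>"
    by blast
qed

lemma Parseval: "(\<lambda>j. inner (bas j) f * inner (bas j) g) sums inner f g"
  unfolding sums_def inner_proj_left[symmetric] by (intro tendsto_intros proj_LIMSEQ)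

lemma summable_inner_bas: "summable (\<lambda>j. (inner (bas j) f)\<^sup>2)"
  using Parseval[of f f] by (simp add: sums_iff power2_eq_square)

lemma cmod_cinner_e: "k \<in> I \<Longrightarrow> (cmod (cinner (e k) f))\<^sup>2 = (inner (bas (2 * k)) f)\<^sup>2 + (inner (bas (Suc (2 * k))) f)\<^sup>2"
  by (simp add: cinner_eq cmod_def bas_def)

section \<open>Sobolev spaces and powers of H in real coordinates\<close>

lemma summable_weighted_iff:
  "(\<lambda>k. (eigenvalue H e k powr r * cmod (cinner (e k) f))\<^sup>2) summable_on I \<longleftrightarrow>
   summable (\<lambda>k. lam k powr (2 * r) * ((inner (bas (2 * k)) f)\<^sup>2 + (inner (bas (2 * k + 1)) f)\<^sup>2))"
proof -
  have "(if k \<in> I then (eigenvalue H e k powr r * cmod (cinner (e k) f))\<^sup>2 else 0) =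
      lam k powr (2 * r) * ((inner (bas (2 * k)) f)\<^sup>2 + (inner (bas (2 * k + 1)) f)\<^sup>2)" for k
  proof (cases "k \<in> I")
    case True
    then have "eigenvalue H e k = lam k" "(lam k powr r)\<^sup>2 = lam k powr (2 * r)"
      using lam_pos[of k] by (simp_all add: lam_def powr_power mult.commute)
    with True show ?thesis
      by (simp add: cmod_cinner_e[symmetric] power_mult_distrib)
  next
    case False
    then show ?thesis
      by (simp add: bas_def)
  qed
  then show ?thesis
    by (subst summable_on_nat_iff) auto
qed

text \<open>The power \<open>r / 2\<close> in \<open>sobolev\<close> gets squared, so the weight is
  \<open>kap j powr r\<close>; both real vectors of a mode carry the same weight.\<close>

lemma sobolev_iff: "f \<in> sobolev H I e r \<longleftrightarrow> summable (\<lambda>j. kap j powr r * (inner (bas j) f)\<^sup>2)"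
proof -
  let ?f = "\<lambda>j. kap j powr r * (inner (bas j) f)\<^sup>2"
  have "f \<in> sobolev H I e r \<longleftrightarrow> summable (\<lambda>k. ?f (2 * k) + ?f (2 * k + 1))"
    unfolding sobolev_def Hpow_dom_def mem_Collect_eq summable_weighted_iff
    by (simp add: kap_def distrib_left)
  also have "\<dots> \<longleftrightarrow> summable ?f"
  proof
    assume "summable ?f"
    then show "summable (\<lambda>k. ?f (2 * k) + ?f (2 * k + 1))"
      using summable_pairsD[of ?f] by simp
  next
    assume "summable (\<lambda>k. ?f (2 * k) + ?f (2 * k + 1))"
    then show "summable ?f"
      by (rule summable_pairsI[rotated]) simp
  qed
  finally show ?thesis .
qed

lemma sobolev_i: "f \<in> sobolev H I e r \<Longrightarrow> \<i> *\<^sub>C f \<in> sobolev H I e r"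
  by (simp add: sobolev_def Hpow_dom_def cinner_scaleC_right norm_mult)

lemma proj_in_sobolev: "proj n f \<in> sobolev H I e r"
  unfolding sobolev_iff by (rule summable_finite[of "{..<n}"]) (auto simp: inner_bas_proj)

lemma bas_in_sobolev: "bas j \<in> sobolev H I e r"
  using proj_in_sobolev[of "Suc j" "bas j" r] by (simp add: proj_bas)

lemma Hpow_e:
  assumes "k \<in> I"
  shows "Hpow H I e r (e k) = (lam k powr r) *\<^sub>R e k"
  unfolding Hpow_def using assms
  by (subst infsum_single_support[where i=k]) (auto simp: cinner_e lam_def scaleR_scaleC)

lemma Hpow_bas: "Hpow H I e r (bas j) = (kap j powr r) *\<^sub>R bas j"
proof (cases "j div 2 \<in> I")
  case True
  have "Hpow H I e r (\<i> *\<^sub>C e k) = (lam k powr r) *\<^sub>R (\<i> *\<^sub>C e k)" if "k \<in> I" for k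
    unfolding Hpow_def using that
    by (subst infsum_single_support[where i=k])
       (auto simp: cinner_e lam_def scaleR_scaleC cinner_scaleC_right scaleC_scaleC)
  then show ?thesis
    using True Hpow_e[OF True] by (simp add: bas_def kap_def)
next
  case False
  have "cinner x (0::'a) = 0" for x
    using cinner_scaleC_right[of x 0 0] by simp
  with False show ?thesis
    by (simp add: bas_def Hpow_def)
qed

lemma summable_lam: "summable (\<lambda>k. if k \<in> I then lam k powr (- s) else 0)"
proof -
  have "(\<lambda>k. lam k powr (- s)) summable_on I"
    using trace unfolding trace_finite_def
    by (rule summable_on_cong[THEN iffD1, rotated])
       (simp add: Hpow_e scaleR_scaleC cinner_scaleC_right cinner_e)
  then show ?thesis
    by (subst (asm) summable_on_nat_iff) auto
qed

lemma summable_kap: "summable (\<lambda>j. kap j powr (- s) * (norm (bas j))\<^sup>2)"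
proof (rule summable_pairsI)
  have "kap (2 * k) powr (- s) * (norm (bas (2 * k)))\<^sup>2 + kap (2 * k + 1) powr (- s) * (norm (bas (2 * k + 1)))\<^sup>2 =
      2 * (if k \<in> I then lam k powr (- s) else 0)" for k
    by (simp add: norm_bas_square kap_def)
  then show "summable (\<lambda>k. kap (2 * k) powr (- s) * (norm (bas (2 * k)))\<^sup>2 +
      kap (2 * k + 1) powr (- s) * (norm (bas (2 * k + 1)))\<^sup>2)"
    using summable_mult[OF summable_lam, of 2] by simp
qed auto

text \<open>The summable sequence \<open>lam k powr (- s)\<close> is bounded, and the power
  \<open>1 / s\<close> turns this into a bound on \<open>1 / lam k\<close>. So the trace condition
  makes the inverse of \<open>H\<close> bounded.\<close>

lemma inverse_kap_bounded: "\<exists>K>0. \<forall>j. 1 / kap j \<le> K"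
proof -
  have "(\<lambda>k. if k \<in> I then lam k powr (- s) else 0) \<longlonglongrightarrow> 0"
    by (rule summable_LIMSEQ_zero[OF summable_lam])
  then have "Bseq (\<lambda>k. if k \<in> I then lam k powr (- s) else 0)"
    by (intro convergent_imp_Bseq convergentI)
  then obtain M where M: "M > 0" "\<And>k. norm (if k \<in> I then lam k powr (- s) else 0) \<le> M"
    by (auto elim: BseqE)
  \<comment> \<open>The maximum with 1 also covers the padding value of \<open>lam\<close>.\<close>
  define M' where "M' = max M 1"
  have "1 / lam k \<le> M' powr (1 / s)" for k
  proof -
    have "lam k powr (- s) \<le> M'"
      using M(2)[of k] by (cases "k \<in> I") (auto simp: M'_def lam_def)
    then have "(lam k powr (- s)) powr (1 / s) \<le> M' powr (1 / s)"
      using s_pos by (intro powr_mono2) auto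
    moreover have "(lam k powr (- s)) powr (1 / s) = 1 / lam k"
      using s_pos lam_pos[of k] by (simp only: powr_powr) (simp add: powr_minus_divide)
    ultimately show ?thesis
      by simp
  qed
  moreover have "M' powr (1 / s) > 0"
    by (simp add: M'_def)
  ultimately show ?thesis
    unfolding kap_def by blast
qed

lemma summable_inverse_kap: "summable (\<lambda>j. inner (bas j) f * inner (bas j) g / kap j)"
proof -
  obtain K where K: "\<And>j. 1 / kap j \<le> K" "K > 0"
    using inverse_kap_bounded by blast
  have "summable (\<lambda>j. K * ((inner (bas j) f)\<^sup>2 + (inner (bas j) g)\<^sup>2))"
    by (intro summable_mult summable_add summable_inner_bas)
  then show ?thesis
  proof (rule summable_comparison_test')
    fix j
    have "\<bar>inner (bas j) f * inner (bas j) g\<bar> \<le> (inner (bas j) f)\<^sup>2 + (inner (bas j) g)\<^sup>2"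
      using sum_squares_bound[of "\<bar>inner (bas j) f\<bar>" "\<bar>inner (bas j) g\<bar>"]
        mult_nonneg_nonneg[of "\<bar>inner (bas j) f\<bar>" "\<bar>inner (bas j) g\<bar>"]
      unfolding abs_mult power2_abs by linarith
    then have "(1 / kap j) * \<bar>inner (bas j) f * inner (bas j) g\<bar> \<le> K * ((inner (bas j) f)\<^sup>2 + (inner (bas j) g)\<^sup>2)"
      using K kap_pos[of j] by (intro mult_mono) auto
    then show "norm (inner (bas j) f * inner (bas j) g / kap j) \<le> K * ((inner (bas j) f)\<^sup>2 + (inner (bas j) g)\<^sup>2)"
      using kap_pos[of j] by simp
  qed
qed

text \<open>The form \<open>Re \<langle>f, H\<^sup>-\<^sup>1 g\<rangle>\<close>.\<close>

definition Hinv_form :: "'a \<Rightarrow> 'a \<Rightarrow> real" where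
  "Hinv_form f g = (\<Sum>j. inner (bas j) f * inner (bas j) g / kap j)"

lemma Hinv_form_sums: "(\<lambda>j. inner (bas j) f * inner (bas j) g / kap j) sums Hinv_form f g"
  unfolding Hinv_form_def by (intro summable_sums summable_inverse_kap)

text \<open>In the form of a polynomial in \<open>t\<close>, from which the derivatives of the
  Gaussian along lines are computed.\<close>

lemma Hinv_form_add_scale:
  "Hinv_form (g + t *\<^sub>R f) (g + t *\<^sub>R f) = Hinv_form g g + 2 * t * Hinv_form f g + t\<^sup>2 * Hinv_form f f"
proof -
  have "(\<lambda>j. inner (bas j) g * inner (bas j) g / kap j + 2 * t * (inner (bas j) f * inner (bas j) g / kap j)
     + t\<^sup>2 * (inner (bas j) f * inner (bas j) f / kap j)) sums (Hinv_form g g + 2 * t * Hinv_form f g + t\<^sup>2 * Hinv_form f f)"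
    by (intro sums_add sums_mult Hinv_form_sums)
  also have "(\<lambda>j. inner (bas j) g * inner (bas j) g / kap j + 2 * t * (inner (bas j) f * inner (bas j) g / kap j)
     + t\<^sup>2 * (inner (bas j) f * inner (bas j) f / kap j)) =
     (\<lambda>j. inner (bas j) (g + t *\<^sub>R f) * inner (bas j) (g + t *\<^sub>R f) / kap j)"
    using kap_pos by (auto simp: fun_eq_iff inner_add_right field_simps power2_eq_square less_imp_neq[symmetric])
  finally show ?thesis
    using Hinv_form_sums sums_unique2 by blast
qed

lemma Hinv_form_scale: "Hinv_form (t *\<^sub>R f) (t *\<^sub>R f) = t\<^sup>2 * Hinv_form f f"
  using Hinv_form_add_scale[of 0 t f] by (simp add: Hinv_form_def)

lemma Hinv_form_nonneg: "Hinv_form f f \<ge> 0"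
  unfolding Hinv_form_def
  by (intro suminf_nonneg summable_inverse_kap) (auto intro!: divide_nonneg_nonneg less_imp_le[OF kap_pos])

lemma Hinv_form_le: "\<exists>K>0. \<forall>f. Hinv_form f f \<le> K * (norm f)\<^sup>2"
proof -
  obtain K where K: "\<And>j. 1 / kap j \<le> K" "K > 0"
    using inverse_kap_bounded by blast
  have "Hinv_form f f \<le> K * (norm f)\<^sup>2" for f
  proof (rule sums_le[OF _ Hinv_form_sums sums_mult[OF Parseval[of f f, folded power2_norm_eq_inner]]])
    fix j
    show "inner (bas j) f * inner (bas j) f / kap j \<le> K * (inner (bas j) f * inner (bas j) f)"
      using mult_right_mono[OF K(1)[of j], of "inner (bas j) f * inner (bas j) f"] by simp
  qed
  then show ?thesis
    using K(2) by blast
qed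

text \<open>Summed over the two real vectors of a mode, the terms give
  \<open>|\<langle>e k, f\<rangle>|^2 / lam k\<close>, which is invariant under phases.\<close>

lemma Hinv_form_i: "Hinv_form (\<i> *\<^sub>C f) (\<i> *\<^sub>C f) = Hinv_form f f"
proof -
  have *: "Hinv_form f f = (\<Sum>k. if k \<in> I then (cmod (cinner (e k) f))\<^sup>2 / lam k else 0)" for f
    unfolding Hinv_form_def
    by (subst suminf_pairs[OF summable_inverse_kap], intro suminf_cong)
       (auto simp: kap_def cmod_cinner_e power2_eq_square[symmetric] add_divide_distrib, auto simp: bas_def)
  show ?thesis
    unfolding * by (intro suminf_cong) (auto simp: cinner_scaleC_right norm_mult)
qed

section \<open>Domain, closedness and inverse of H\<close>

lemma H_clinear:
  assumes "f \<in> D" "g \<in> D"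
  shows "c *\<^sub>C f + d *\<^sub>C g \<in> D" "H (c *\<^sub>C f + d *\<^sub>C g) = c *\<^sub>C H f + d *\<^sub>C H g"
  using selfadjoint assms by (auto simp: selfadjoint_operator_def clinear_operator_def)

lemma H_symmetric: "f \<in> D \<Longrightarrow> g \<in> D \<Longrightarrow> cinner (H f) g = cinner f (H g)"
  using selfadjoint by (auto simp: selfadjoint_operator_def adjoint_graph_def set_eq_iff)

lemma subspace_D: "subspace D"
proof (rule subspaceI)
  show "0 \<in> D"
    using selfadjoint by (simp add: selfadjoint_operator_def clinear_operator_def)
  show "x + y \<in> D" if "x \<in> D" "y \<in> D" for x y
    using H_clinear(1)[OF that, of 1 1] by simp
  show "c *\<^sub>R x \<in> D" if "x \<in> D" for c x
    using H_clinear(1)[OF that that, of "of_real c" 0] by (simp add: scaleR_scaleC)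
qed

lemma D_scaleC: "f \<in> D \<Longrightarrow> c *\<^sub>C f \<in> D" and H_scaleC: "f \<in> D \<Longrightarrow> H (c *\<^sub>C f) = c *\<^sub>C H f"
  using H_clinear[of f f c 0] by auto

lemma H_add: "f \<in> D \<Longrightarrow> g \<in> D \<Longrightarrow> H (f + g) = H f + H g"
  using H_clinear(2)[of f g 1 1] by simp

lemma H_scaleR: "f \<in> D \<Longrightarrow> H (c *\<^sub>R f) = c *\<^sub>R H f"
  using H_scaleC[of f "of_real c"] by (simp add: scaleR_scaleC)

lemma bas_in_D: "bas j \<in> D"
  using e_in_D D_scaleC subspace_0[OF subspace_D] by (simp add: bas_def)

lemma H_bas: "H (bas j) = kap j *\<^sub>R bas j"
proof -
  have "H 0 = 0"
    using H_scaleR[of 0 0] subspace_0[OF subspace_D] by simp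
  then show ?thesis
    by (simp add: bas_def kap_def H_e H_scaleC e_in_D scaleC_scaleR)
qed

lemma i_bas: "\<i> *\<^sub>C bas (2 * k) = bas (Suc (2 * k))" "\<i> *\<^sub>C bas (Suc (2 * k)) = - bas (2 * k)"
  by (simp_all add: bas_def)

lemma H_sum_bas:
  "(\<Sum>j<n. c j *\<^sub>R bas j) \<in> D" "H (\<Sum>j<n. c j *\<^sub>R bas j) = (\<Sum>j<n. (c j * kap j) *\<^sub>R bas j)"
proof -
  have "(\<Sum>j<n. c j *\<^sub>R bas j) \<in> D \<and> H (\<Sum>j<n. c j *\<^sub>R bas j) = (\<Sum>j<n. (c j * kap j) *\<^sub>R bas j)"
  proof (induction n)
    case 0
    then show ?case
      using H_scaleR[of 0 0] subspace_0[OF subspace_D] by simp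
  next
    case (Suc n)
    then show ?case
      using subspace_scale[OF subspace_D bas_in_D, of "c n" n]
      by (simp add: H_add H_scaleR bas_in_D H_bas subspace_add[OF subspace_D])
  qed
  then show "(\<Sum>j<n. c j *\<^sub>R bas j) \<in> D" "H (\<Sum>j<n. c j *\<^sub>R bas j) = (\<Sum>j<n. (c j * kap j) *\<^sub>R bas j)"
    by auto
qed

lemma inner_H_bas: "f \<in> D \<Longrightarrow> inner (bas j) (H f) = kap j * inner (bas j) f"
  using H_symmetric[OF bas_in_D, of f j]
  by (metis H_bas inner_eq_Re_cinner inner_scaleR_left)

text \<open>The graph of an adjoint is cut out by continuous equations, hence closed, and a
  self-adjoint operator is its own adjoint.\<close>

lemma closed_H:
  assumes f: "\<And>n. f n \<in> D" "f \<longlonglongrightarrow> f'" "(\<lambda>n. H (f n)) \<longlonglongrightarrow> g"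
  shows "f' \<in> D" "H f' = g"
proof -
  have "cinner (H x) f' = cinner x g" if "x \<in> D" for x
  proof (rule LIMSEQ_unique)
    have "(\<lambda>n. cinner y (h n)) \<longlonglongrightarrow> cinner y h'" if "h \<longlonglongrightarrow> h'" for y h h'
      unfolding cinner_eq Complex_eq by (intro tendsto_intros that)
    from this[OF f(2), of "H x"] this[OF f(3), of x]
    show "(\<lambda>n. cinner (H x) (f n)) \<longlonglongrightarrow> cinner (H x) f'" "(\<lambda>n. cinner (H x) (f n)) \<longlonglongrightarrow> cinner x g"
      by (simp_all add: H_symmetric[OF \<open>x \<in> D\<close> f(1)])
  qed
  then have "(f', g) \<in> adjoint_graph D H"
    by (simp add: adjoint_graph_def)
  then show "f' \<in> D" "H f' = g"
    using selfadjoint by (auto simp: selfadjoint_operator_def)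
qed

text \<open>The series with coefficients \<open>inner (bas j) g / kap j\<close> converges since
  \<open>1 / kap j\<close> is bounded, and closedness of \<open>H\<close> puts its sum into
  \<open>D\<close>. The second conjunct identifies \<open>Hinv_form\<close> with the form of the
  inverse.\<close>

lemma H_surjective: "\<exists>f\<in>D. H f = g \<and> (\<forall>x. inner x f = Hinv_form x g)"
proof -
  obtain K where K: "\<And>j. 1 / kap j \<le> K" "K > 0"
    using inverse_kap_bounded by blast
  define v where "v j = (inner (bas j) g / kap j) *\<^sub>R bas j" for j
  have "convergent (\<lambda>n. \<Sum>j<n. v j)"
  proof (rule orthogonal_series_convergent)
    show "inner (v i) (v j) = 0" if "i \<noteq> j" for i j
      using that by (simp add: v_def inner_bas)
    have "summable (\<lambda>j. K\<^sup>2 * (inner (bas j) g)\<^sup>2)"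
      by (intro summable_mult summable_inner_bas)
    then show "summable (\<lambda>j. (norm (v j))\<^sup>2)"
    proof (rule summable_comparison_test')
      fix j
      have "(1 / kap j)\<^sup>2 \<le> K\<^sup>2"
        using K(1)[of j] kap_pos[of j] by (intro power_mono) auto
      then have "(1 / kap j)\<^sup>2 * (inner (bas j) g)\<^sup>2 \<le> K\<^sup>2 * (inner (bas j) g)\<^sup>2"
        by (rule mult_right_mono) simp
      moreover have "(norm (v j))\<^sup>2 \<le> (1 / kap j)\<^sup>2 * (inner (bas j) g)\<^sup>2"
        by (simp add: v_def power_mult_distrib power_divide norm_bas_square)
      ultimately show "norm ((norm (v j))\<^sup>2) \<le> K\<^sup>2 * (inner (bas j) g)\<^sup>2"
        by simp
    qed
  qed
  then obtain f where f: "(\<lambda>n. \<Sum>j<n. v j) \<longlonglongrightarrow> f"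
    by (auto simp: convergent_def)
  have H: "H (\<Sum>j<n. v j) = proj n g" for n
    unfolding v_def H_sum_bas proj_def using kap_pos by (intro sum.cong) (auto simp: less_imp_neq[symmetric])
  have "f \<in> D" "H f = g"
    using closed_H[of "\<lambda>n. \<Sum>j<n. v j" f g] f proj_LIMSEQ[of g] H_sum_bas(1) by (auto simp: H) (auto simp: v_def)
  moreover have "inner x f = Hinv_form x g" for x
  proof (rule LIMSEQ_unique)
    show "(\<lambda>n. inner x (\<Sum>j<n. v j)) \<longlonglongrightarrow> inner x f"
      by (intro tendsto_intros f)
    show "(\<lambda>n. inner x (\<Sum>j<n. v j)) \<longlonglongrightarrow> Hinv_form x g"
      using Hinv_form_sums[of x g] by (simp add: sums_def v_def inner_sum_right inner_commute[of x] mult.commute)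
  qed
  ultimately show ?thesis
    by blast
qed

text \<open>With \<open>w\<close> the preimage of \<open>g\<close> under \<open>H\<close>, the
  increment is \<open>2 \<langle>x - g, w\<rangle>\<close> plus the form of \<open>x - g\<close>,
  which lies between 0 and a multiple of the squared distance.\<close>

lemma continuous_Hinv_form: "continuous_on UNIV (\<lambda>f. Hinv_form f f)"
  unfolding continuous_on_def
proof
  fix g :: 'a
  obtain K where K: "\<And>f. Hinv_form f f \<le> K * (norm f)\<^sup>2"
    using Hinv_form_le by blast
  obtain w where w: "\<And>x. inner x w = Hinv_form x g"
    using H_surjective[of g] by blast
  have "((\<lambda>x. 2 * inner (x - g) w + K * (norm (x - g))\<^sup>2) \<longlongrightarrow> 2 * inner (g - g) w + K * (norm (g - g))\<^sup>2) (at g)"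
    by (intro tendsto_intros)
  then have upper: "((\<lambda>x. 2 * inner (x - g) w + K * (norm (x - g))\<^sup>2) \<longlongrightarrow> 0) (at g)"
    by simp
  have "((\<lambda>x. 2 * inner (x - g) w) \<longlongrightarrow> 2 * inner (g - g) w) (at g)"
    by (intro tendsto_intros)
  then have lower: "((\<lambda>x. 2 * inner (x - g) w) \<longlongrightarrow> 0) (at g)"
    by simp
  have eq: "Hinv_form x x - Hinv_form g g = 2 * inner (x - g) w + Hinv_form (x - g) (x - g)" for x
    using Hinv_form_add_scale[of g 1 "x - g"] by (simp add: w)
  have "((\<lambda>x. Hinv_form x x - Hinv_form g g) \<longlongrightarrow> 0) (at g)"
    unfolding eq
    by (rule tendsto_sandwich[OF always_eventually[OF allI] always_eventually[OF allI] lower upper])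
       (simp_all add: Hinv_form_nonneg K)
  then show "((\<lambda>f. Hinv_form f f) \<longlongrightarrow> Hinv_form g g) (at g within UNIV)"
    by (simp add: LIM_zero_iff)
qed

text \<open>The inverse cancels \<open>H\<close> in each coordinate and leaves the symplectic form.
  This is what makes the Gaussian satisfy the KMS condition on generators.\<close>

lemma Hinv_form_H: "f \<in> D \<Longrightarrow> Hinv_form (\<i> *\<^sub>C H f) g = inner (\<i> *\<^sub>C f) g"
proof -
  assume f: "f \<in> D"
  have "inner (bas j) (\<i> *\<^sub>C H f) / kap j = inner (bas j) (\<i> *\<^sub>C f)" for j
    using inner_H_bas[OF D_scaleC[OF f], of j \<i>] kap_pos[of j] by (simp add: H_scaleC f)
  then have "inner (bas j) (\<i> *\<^sub>C H f) * inner (bas j) g / kap j = inner (bas j) (\<i> *\<^sub>C f) * inner (bas j) g" for j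
    by (metis times_divide_eq_left)
  then show ?thesis
    using Parseval[of "\<i> *\<^sub>C f" g] by (simp add: Hinv_form_def sums_iff)
qed

end

section \<open>The Gaussian state\<close>

locale gaussian_field = positive_discrete_operator D H I e s
  for D :: "'a::complex_hilbert set" and H I e s +
  fixes \<beta> :: real
  assumes \<beta>_pos: "\<beta> > 0"
begin

definition amp :: "nat \<Rightarrow> real" where
  "amp j = 1 / sqrt (\<beta> * kap j)"

lemma amp_pos: "amp j > 0"
  by (simp add: amp_def \<beta>_pos kap_pos)

lemma amp_square: "(amp j)\<^sup>2 = 1 / (\<beta> * kap j)"
  using \<beta>_pos kap_pos[of j] by (simp add: amp_def power_divide)

text \<open>Finite-dimensional approximations of the Gaussian field with covariance \<open>(\<beta>H)\<^sup>-\<^sup>1\<close>.\<close>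

definition field :: "nat \<Rightarrow> (nat \<Rightarrow> real) \<Rightarrow> 'a" where
  "field n z = (\<Sum>j<n. (amp j * z j) *\<^sub>R bas j)"

text \<open>Covariance of the variables \<open>inner f (field n z)\<close> and
  \<open>inner g (field n z)\<close>.\<close>

definition cov :: "nat \<Rightarrow> 'a \<Rightarrow> 'a \<Rightarrow> real" where
  "cov n f g = (\<Sum>j<n. (amp j * inner (bas j) f) * (amp j * inner (bas j) g))"

definition gauss_char :: "'a \<Rightarrow> real" where
  "gauss_char f = exp (- Hinv_form f f / (2 * \<beta>))"

lemma inner_field: "inner f (field n z) = (\<Sum>j<n. (amp j * inner (bas j) f) * z j)"
  by (simp add: field_def inner_sum_right inner_commute mult_ac)

lemma continuous_field: "continuous_on UNIV (field n)"
  unfolding field_def by (intro continuous_intros continuous_on_product_coordinates)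

lemma measurable_inner_field [measurable]: "(\<lambda>z. inner f (field n z)) \<in> borel_measurable gaussian_product"
  unfolding inner_field by (rule borel_measurable_linear_form)

lemma cov_eq: "cov n f g = (\<Sum>j<n. inner (bas j) f * inner (bas j) g / kap j) / \<beta>"
proof -
  have "(amp j * inner (bas j) f) * (amp j * inner (bas j) g) = inner (bas j) f * inner (bas j) g / kap j / \<beta>" for j
    using amp_square[of j] by (simp add: power2_eq_square field_simps)
  then show ?thesis
    by (simp add: cov_def sum_divide_distrib)
qed

lemma cov_LIMSEQ: "(\<lambda>n. cov n f g) \<longlonglongrightarrow> Hinv_form f g / \<beta>"
  unfolding cov_eq using Hinv_form_sums[of f g] \<beta>_pos by (intro tendsto_intros) (auto simp: sums_def)

lemma cov_nonneg: "cov n f f \<ge> 0"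
  unfolding cov_def by (intro sum_nonneg) simp

lemma cov_le: "cov n f f \<le> Hinv_form f f / \<beta>"
  unfolding cov_eq Hinv_form_def using \<beta>_pos
  by (intro divide_right_mono sum_le_suminf summable_inverse_kap)
     (auto intro!: divide_nonneg_nonneg less_imp_le[OF kap_pos])

lemma cov_add_scale: "cov n (g + t *\<^sub>R f) (g + t *\<^sub>R f) = cov n g g + 2 * t * cov n f g + t\<^sup>2 * cov n f f"
  unfolding cov_def sum_distrib_left sum.distrib[symmetric]
  by (intro sum.cong) (simp_all add: inner_add_right algebra_simps power2_eq_square)

lemma W0_field_integral:
  "(LINT z|gaussian_product. W0 f (field n z)) = exp (- cov n f f / 2)"
  unfolding W0_def inner_field iexp_linear_form_integral cov_def by (simp add: power2_eq_square)

lemma W0_field_LIMSEQ: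
  "(\<lambda>n. LINT z|gaussian_product. W0 f (field n z)) \<longlonglongrightarrow> complex_of_real (gauss_char f)"
proof -
  have "(\<lambda>n. exp (- cov n f f / 2)) \<longlonglongrightarrow> exp (- (Hinv_form f f / \<beta>) / 2)"
    by (intro tendsto_intros cov_LIMSEQ) simp
  then show ?thesis
    unfolding W0_field_integral gauss_char_def by (intro tendsto_of_real) (simp add: mult.commute)
qed

lemma integrable_field_moment: "integrable gaussian_product (\<lambda>z. (inner f (field n z)) ^ k)"
  unfolding inner_field by (rule integrable_linear_form_power)

lemma integrable_W0_field: "integrable gaussian_product (\<lambda>z. W0 f (field n z))"
  unfolding W0_def by (intro gaussian_product.integrable_const_bound[where B=1]) auto

lemma integrable_Phi0_W0_field: "integrable gaussian_product (\<lambda>z. Phi0 f (field n z) * W0 g (field n z))"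
proof (rule Bochner_Integration.integrable_bound)
  show "integrable gaussian_product (\<lambda>z. inner f (field n z))"
    using integrable_field_moment[of f n 1] by simp
qed (auto simp: norm_mult Phi0_def W0_def)

text \<open>The characteristic function along \<open>g + t f\<close> is differentiated at 0 in two
  ways: under the integral, and as an explicit Gaussian. Uniqueness of the derivative gives the
  formula.\<close>

lemma Phi0_W0_field_integral:
  "(LINT z|gaussian_product. Phi0 f (field n z) * W0 g (field n z)) = \<i> * cov n f g * exp (- cov n g g / 2)"
proof -
  have "((\<lambda>t. LINT z|gaussian_product. iexp (inner g (field n z) + t * inner f (field n z))) has_vector_derivative
      (LINT z|gaussian_product. \<i> * inner f (field n z) * iexp (inner g (field n z)))) (at 0)"
    using integrable_field_moment[of f n 1] by (intro gaussian_product.iexp_integral_has_vector_derivative) auto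
  also have "(\<lambda>t. LINT z|gaussian_product. iexp (inner g (field n z) + t * inner f (field n z))) =
      (\<lambda>t. complex_of_real (exp (- (cov n g g + 2 * t * cov n f g + t\<^sup>2 * cov n f f) / 2)))"
    using W0_field_integral[of "g + _ *\<^sub>R f" n] unfolding cov_add_scale W0_def by (simp add: inner_add_left)
  finally have d: "((\<lambda>t. complex_of_real (exp (- (cov n g g + 2 * t * cov n f g + t\<^sup>2 * cov n f f) / 2))) has_vector_derivative
      (LINT z|gaussian_product. \<i> * inner f (field n z) * iexp (inner g (field n z)))) (at 0)" .
  have "((\<lambda>t. exp (- (cov n g g + 2 * t * cov n f g + t\<^sup>2 * cov n f f) / 2)) has_real_derivative
      - cov n f g * exp (- cov n g g / 2)) (at 0)"
    by (auto intro!: derivative_eq_intros)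
  then have "((\<lambda>t. complex_of_real (exp (- (cov n g g + 2 * t * cov n f g + t\<^sup>2 * cov n f f) / 2))) has_vector_derivative
      complex_of_real (- cov n f g * exp (- cov n g g / 2))) (at 0)"
    by (rule has_vector_derivative_of_real[OF _, simplified has_real_derivative_iff_has_vector_derivative[symmetric]])
  from vector_derivative_unique_at[OF d this]
  have "(LINT z|gaussian_product. \<i> * (Phi0 f (field n z) * W0 g (field n z))) = - cov n f g * exp (- cov n g g / 2)"
    by (simp add: Phi0_def W0_def mult.assoc)
  then have "\<i> * (LINT z|gaussian_product. Phi0 f (field n z) * W0 g (field n z)) = - cov n f g * exp (- cov n g g / 2)"
    by simp
  then have "- \<i> * (\<i> * (LINT z|gaussian_product. Phi0 f (field n z) * W0 g (field n z))) = - \<i> * (- cov n f g * exp (- cov n g g / 2))"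
    by (rule arg_cong)
  then show ?thesis
    by (simp add: mult.assoc[symmetric])
qed

text \<open>
  As a limit of Gaussian expectations, the state is linear and positive without any appeal to the
  linear independence of the functions \<open>W\<^sup>0(f)\<close>, and the same formula extends it to \<^const>\<open>field_span\<close>.
\<close>

definition gauss_state :: "('a \<Rightarrow> complex) \<Rightarrow> complex" where
  "gauss_state A = lim (\<lambda>n. LINT z|gaussian_product. A (field n z))"

text \<open>Integrals of nonintegrable functions are 0 by convention, which would break additivity;
  so integrability on every section is recorded beside convergence. This matters for the unbounded
  elements of \<open>field_span\<close>.\<close>

definition field_integrable :: "('a \<Rightarrow> complex) \<Rightarrow> bool" where
  "field_integrable A \<longleftrightarrow> (\<forall>n. integrable gaussian_product (\<lambda>z. A (field n z))) \<and>
    convergent (\<lambda>n. LINT z|gaussian_product. A (field n z))"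

lemma gauss_state_LIMSEQ:
  "field_integrable A \<Longrightarrow> (\<lambda>n. LINT z|gaussian_product. A (field n z)) \<longlonglongrightarrow> gauss_state A"
  by (simp add: field_integrable_def gauss_state_def convergent_LIMSEQ_iff)

lemma gauss_state_lincomb_LIMSEQ:
  assumes "field_integrable A" "field_integrable B"
  shows "(\<lambda>n. LINT z|gaussian_product. c * A (field n z) + d * B (field n z)) \<longlonglongrightarrow>
    c * gauss_state A + d * gauss_state B"
proof -
  have "(LINT z|gaussian_product. c * A (field n z) + d * B (field n z)) =
      c * (LINT z|gaussian_product. A (field n z)) + d * (LINT z|gaussian_product. B (field n z))" for n
    using assms by (subst Bochner_Integration.integral_add) (auto simp: field_integrable_def)
  then show ?thesis
    using assms by (auto intro!: tendsto_intros gauss_state_LIMSEQ)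
qed

lemma field_integrable_lincomb:
  assumes "field_integrable A" "field_integrable B"
  shows "field_integrable (\<lambda>u. c * A u + d * B u)"
  using gauss_state_lincomb_LIMSEQ[OF assms, of c d] assms
  by (auto simp: field_integrable_def intro: convergentI)

lemma gauss_state_lincomb:
  assumes "field_integrable A" "field_integrable B"
  shows "gauss_state (\<lambda>u. c * A u + d * B u) = c * gauss_state A + d * gauss_state B"
  using gauss_state_lincomb_LIMSEQ[OF assms, of c d]
    gauss_state_LIMSEQ[OF field_integrable_lincomb[OF assms, of c d]] by (rule LIMSEQ_unique[rotated])

lemma field_integrable_fun_span:
  assumes "A \<in> fun_span S" "\<And>g. g \<in> S \<Longrightarrow> field_integrable g"
  shows "field_integrable A"
  using assms(1)
proof (induction rule: fun_span_induct)
  case zero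
  then show ?case
    by (simp add: field_integrable_def convergent_const)
next
  case (add g c B)
  then show ?case
    using field_integrable_lincomb[of g B c 1] assms(2) by simp
qed

lemma field_integrable_W0: "field_integrable (W0 f)"
  using W0_field_LIMSEQ integrable_W0_field by (auto simp: field_integrable_def intro: convergentI)

lemma gauss_state_W0: "gauss_state (W0 f) = gauss_char f"
  using gauss_state_LIMSEQ[OF field_integrable_W0] W0_field_LIMSEQ by (rule LIMSEQ_unique)

lemma Phi0_W0_field_LIMSEQ:
  "(\<lambda>n. LINT z|gaussian_product. Phi0 f (field n z) * W0 g (field n z)) \<longlonglongrightarrow>
    \<i> * (Hinv_form f g / \<beta>) * gauss_char g"
proof -
  have "(\<lambda>n. \<i> * cov n f g * (exp (- cov n g g / 2))) \<longlonglongrightarrow> \<i> * (Hinv_form f g / \<beta>) * exp (- (Hinv_form g g / \<beta>) / 2)"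
    by (intro tendsto_intros cov_LIMSEQ) simp
  then show ?thesis
    unfolding Phi0_W0_field_integral gauss_char_def by (simp add: mult.commute)
qed

lemma field_integrable_Phi0_W0: "field_integrable (\<lambda>u. Phi0 f u * W0 g u)"
  using Phi0_W0_field_LIMSEQ integrable_Phi0_W0_field by (auto simp: field_integrable_def intro: convergentI)

lemma gauss_state_Phi0_W0: "gauss_state (\<lambda>u. Phi0 f u * W0 g u) = \<i> * (Hinv_form f g / \<beta>) * gauss_char g"
  using gauss_state_LIMSEQ[OF field_integrable_Phi0_W0] Phi0_W0_field_LIMSEQ by (rule LIMSEQ_unique)

lemma integrable_Weyl_algebra_field:
  assumes "A \<in> Weyl_algebra"
  shows "integrable gaussian_product (\<lambda>z. A (field n z))"
proof -
  obtain K where K: "\<And>u. cmod (A u) \<le> K"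
    using Weyl_algebra_bounded[OF assms] by blast
  have "(\<lambda>z. A (field n z)) \<in> borel_measurable borel"
    by (intro borel_measurable_continuous_onI continuous_on_compose2[OF Weyl_algebra_continuous[OF assms] continuous_field]) auto
  then have "(\<lambda>z. A (field n z)) \<in> borel_measurable gaussian_product"
    by (simp cong: measurable_cong_sets)
  then show ?thesis
    by (intro gaussian_product.integrable_const_bound[where B=K]) (auto simp: K)
qed

text \<open>Elements of the span have convergent expectations; an approximation within
  \<open>\<epsilon> / 4\<close>, uniform over all sections, transfers the Cauchy property to the
  closure.\<close>

lemma field_integrable_Weyl_algebra:
  assumes "A \<in> Weyl_algebra"
  shows "field_integrable A"
proof -
  have "Cauchy (\<lambda>n. LINT z|gaussian_product. A (field n z))"
  proof (rule metric_CauchyI)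
    fix \<epsilon> :: real assume "\<epsilon> > 0"
    then have "\<epsilon> / 4 > 0"
      by simp
    then obtain B where B: "B \<in> Weyl_span" "\<And>u. cmod (A u - B u) \<le> \<epsilon> / 4"
      using Weyl_algebraD[OF assms] by blast
    have close: "dist (LINT z|gaussian_product. A (field n z)) (LINT z|gaussian_product. B (field n z)) \<le> \<epsilon> / 4" for n
    proof -
      have int: "integrable gaussian_product (\<lambda>z. A (field n z))" "integrable gaussian_product (\<lambda>z. B (field n z))"
        by (intro integrable_Weyl_algebra_field assms Weyl_span_subset B(1))+
      have "dist (LINT z|gaussian_product. A (field n z)) (LINT z|gaussian_product. B (field n z)) =
          cmod (LINT z|gaussian_product. A (field n z) - B (field n z))"
        using int by (simp add: dist_norm)
      also have "\<dots> \<le> (LINT z|gaussian_product. cmod (A (field n z) - B (field n z)))"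
        by (rule integral_norm_bound)
      also have "\<dots> \<le> (LINT z|gaussian_product. \<epsilon> / 4)"
        using int B(2) by (intro integral_mono integrable_norm Bochner_Integration.integrable_diff) auto
      finally show ?thesis
        using gaussian_product.prob_space by simp
    qed
    have "field_integrable B"
      using B(1) unfolding Weyl_span_def by (rule field_integrable_fun_span) (auto intro: field_integrable_W0)
    then have "Cauchy (\<lambda>n. LINT z|gaussian_product. B (field n z))"
      by (simp add: field_integrable_def Cauchy_convergent_iff)
    then obtain N where N: "\<And>m n. m \<ge> N \<Longrightarrow> n \<ge> N \<Longrightarrow>
        dist (LINT z|gaussian_product. B (field m z)) (LINT z|gaussian_product. B (field n z)) < \<epsilon> / 4"
      using \<open>\<epsilon> / 4 > 0\<close> unfolding Cauchy_def by blast
    have "dist (LINT z|gaussian_product. A (field m z)) (LINT z|gaussian_product. A (field n z)) < \<epsilon>"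
      if "m \<ge> N" "n \<ge> N" for m n
      using close[of m] close[of n] N[OF that] \<open>\<epsilon> > 0\<close>
        dist_triangle[of "LINT z|gaussian_product. A (field m z)" "LINT z|gaussian_product. A (field n z)" "LINT z|gaussian_product. B (field m z)"]
        dist_triangle[of "LINT z|gaussian_product. B (field m z)" "LINT z|gaussian_product. A (field n z)" "LINT z|gaussian_product. B (field n z)"]
      by (simp add: dist_commute)
    then show "\<exists>M. \<forall>m\<ge>M. \<forall>n\<ge>M. dist (LINT z|gaussian_product. A (field m z)) (LINT z|gaussian_product. A (field n z)) < \<epsilon>"
      by blast
  qed
  then show ?thesis
    using integrable_Weyl_algebra_field[OF assms] by (simp add: field_integrable_def Cauchy_convergent_iff)
qed

text \<open>Monotonicity on every section survives the limit. It yields positivity, boundedness and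
  the estimate behind strong continuity.\<close>

lemma gauss_state_norm_le:
  assumes A: "A \<in> Weyl_algebra" and B: "B \<in> Weyl_algebra" and le: "\<And>u. cmod (A u) \<le> Re (B u)"
  shows "cmod (gauss_state A) \<le> Re (gauss_state B)"
proof (rule LIMSEQ_le)
  show "(\<lambda>n. cmod (LINT z|gaussian_product. A (field n z))) \<longlonglongrightarrow> cmod (gauss_state A)"
    "(\<lambda>n. Re (LINT z|gaussian_product. B (field n z))) \<longlonglongrightarrow> Re (gauss_state B)"
    using gauss_state_LIMSEQ field_integrable_Weyl_algebra A B by (auto intro!: tendsto_intros)
  have "cmod (LINT z|gaussian_product. A (field n z)) \<le> Re (LINT z|gaussian_product. B (field n z))" for n
  proof -
    have int: "integrable gaussian_product (\<lambda>z. A (field n z))" "integrable gaussian_product (\<lambda>z. B (field n z))"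
      by (intro integrable_Weyl_algebra_field A B)+
    have "cmod (LINT z|gaussian_product. A (field n z)) \<le> (LINT z|gaussian_product. cmod (A (field n z)))"
      by (rule integral_norm_bound)
    also have "\<dots> \<le> (LINT z|gaussian_product. Re (B (field n z)))"
      using int le by (intro integral_mono integrable_norm integrable_Re) auto
    finally show ?thesis
      using int by simp
  qed
  then show "\<exists>N. \<forall>n\<ge>N. cmod (LINT z|gaussian_product. A (field n z)) \<le> Re (LINT z|gaussian_product. B (field n z))"
    by blast
qed

lemma gauss_state_cnj:
  assumes "A \<in> Weyl_algebra"
  shows "gauss_state (\<lambda>u. cnj (A u)) = cnj (gauss_state A)"
proof (rule LIMSEQ_unique)
  show "(\<lambda>n. LINT z|gaussian_product. cnj (A (field n z))) \<longlonglongrightarrow> gauss_state (\<lambda>u. cnj (A u))"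
    by (intro gauss_state_LIMSEQ field_integrable_Weyl_algebra Weyl_algebra_cnj assms)
  show "(\<lambda>n. LINT z|gaussian_product. cnj (A (field n z))) \<longlonglongrightarrow> cnj (gauss_state A)"
    using tendsto_cnj[OF gauss_state_LIMSEQ[OF field_integrable_Weyl_algebra[OF assms]]] by simp
qed

lemma gauss_char_0: "gauss_char 0 = 1"
  by (simp add: gauss_char_def Hinv_form_def)

lemma state_gauss_state: "state gauss_state"
  unfolding state_def
proof (intro conjI ballI)
  show "clinear_functional_on Weyl_algebra gauss_state"
    unfolding clinear_functional_on_def by (intro ballI allI gauss_state_lincomb field_integrable_Weyl_algebra)
  show "gauss_state (\<lambda>u. 1) = 1"
    using gauss_state_W0[of 0] by (simp add: gauss_char_0)
  fix A :: "'a \<Rightarrow> complex" assume A: "A \<in> Weyl_algebra"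
  then have AA: "(\<lambda>u. cnj (A u) * A u) \<in> Weyl_algebra"
    by (intro Weyl_algebra_intros)
  show "gauss_state (\<lambda>u. cnj (A u) * A u) \<in> \<real>"
    using gauss_state_cnj[OF AA] by (simp add: Reals_cnj_iff mult.commute)
  \<comment> \<open>Comparison with the zero function gives positivity.\<close>
  have "cmod (gauss_state (\<lambda>u. 0)) \<le> Re (gauss_state (\<lambda>u. cnj (A u) * A u))"
    by (intro gauss_state_norm_le Weyl_algebra_const AA) simp
  then show "0 \<le> Re (gauss_state (\<lambda>u. cnj (A u) * A u))"
    by (meson norm_ge_zero order_trans)
qed

sublocale gauss_state: weyl_state gauss_state
  by unfold_locales (rule state_gauss_state)

lemma gauss_state_bounded:
  assumes "A \<in> Weyl_algebra" "\<And>u. cmod (A u) \<le> K"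
  shows "cmod (gauss_state A) \<le> K"
proof -
  have "Re (gauss_state (\<lambda>u. complex_of_real K)) = K"
    using gauss_state.scale[OF Weyl_algebra_const[of 1], of "complex_of_real K"] by (simp add: gauss_state.one)
  then show ?thesis
    using gauss_state_norm_le[OF assms(1) Weyl_algebra_const[of "complex_of_real K"]] assms(2) by simp
qed

lemma continuous_gauss_char: "continuous_on UNIV gauss_char"
  unfolding gauss_char_def using \<beta>_pos by (intro continuous_intros continuous_Hinv_form) simp

text \<open>\<open>|W0 f - W0 g|^2 = 2 - W0 (f - g) - W0 (g - f)\<close> lies in the Weyl span, so
  its expectation is known exactly; the factor \<open>A\<close> is replaced by its bound
  \<open>K\<close>.\<close>

lemma state_norm_W0_diff_le:
  assumes A: "A \<in> Weyl_algebra" and K: "\<And>u. cmod (A u) \<le> K"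
  shows "state_norm gauss_state (\<lambda>u. W0 f u * A u - W0 g u * A u) \<le> K * sqrt (2 - 2 * gauss_char (f - g))"
proof -
  have "K \<ge> 0"
    using K[of 0] norm_ge_zero order_trans by blast
  define B where "B = (\<lambda>u. W0 f u * A u - W0 g u * A u)"
  define C where "C = (\<lambda>u::'a. complex_of_real (2 * K\<^sup>2) * 1 + (- complex_of_real (K\<^sup>2)) * (W0 (f - g) u + W0 (g - f) u))"
  have B: "B \<in> Weyl_algebra"
    unfolding B_def by (intro Weyl_algebra_diff Weyl_algebra_mult W0_in_Weyl_algebra A)
  have W: "(\<lambda>u. W0 (f - g) u + W0 (g - f) u) \<in> Weyl_algebra"
    by (intro Weyl_algebra_add W0_in_Weyl_algebra)
  have C: "C \<in> Weyl_algebra"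
    unfolding C_def by (intro Weyl_algebra_lincomb Weyl_algebra_const W)
  have "Re (gauss_state (\<lambda>u. cnj (B u) * B u)) \<le> cmod (gauss_state (\<lambda>u. cnj (B u) * B u))"
    by (rule complex_Re_le_cmod)
  also have "\<dots> \<le> Re (gauss_state C)"
  proof (rule gauss_state_norm_le[OF _ C])
    show "(\<lambda>u. cnj (B u) * B u) \<in> Weyl_algebra"
      by (intro Weyl_algebra_intros B)
    fix u
    have cosd: "Re (W0 (f - g) u) = cos (inner f u - inner g u)" "Re (W0 (g - f) u) = cos (inner f u - inner g u)"
      using cos_minus[of "inner f u - inner g u"] by (simp_all add: W0_def Re_exp inner_diff_left)
    have "cmod (cnj (B u) * B u) = (cmod (A u))\<^sup>2 * (cmod (W0 f u - W0 g u))\<^sup>2"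
    proof -
      have "B u = A u * (W0 f u - W0 g u)"
        by (simp add: B_def algebra_simps)
      then show ?thesis
        by (simp only: norm_mult complex_mod_cnj power2_eq_square mult_ac)
    qed
    also have "\<dots> \<le> K\<^sup>2 * (cmod (W0 f u - W0 g u))\<^sup>2"
      by (intro mult_right_mono power_mono K) auto
    also have "(cmod (W0 f u - W0 g u))\<^sup>2 = 2 - 2 * cos (inner f u - inner g u)"
    proof -
      have "(cmod (W0 f u - W0 g u))\<^sup>2 = (cos (inner f u) - cos (inner g u))\<^sup>2 + (sin (inner f u) - sin (inner g u))\<^sup>2"
        unfolding cmod_power2 W0_def by (simp add: Re_exp Im_exp)
      then show ?thesis
        unfolding cos_diff power2_diff distrib_left mult.assoc
        using sin_cos_squared_add[of "inner f u"] sin_cos_squared_add[of "inner g u"] by linarith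
    qed
    also have "K\<^sup>2 * \<dots> = Re (C u)"
      by (simp add: C_def cosd algebra_simps)
    finally show "cmod (cnj (B u) * B u) \<le> Re (C u)" .
  qed
  also have "gauss_state C = complex_of_real (2 * K\<^sup>2) * gauss_state (\<lambda>u. 1) +
      (- complex_of_real (K\<^sup>2)) * gauss_state (\<lambda>u. W0 (f - g) u + W0 (g - f) u)"
    unfolding C_def by (rule gauss_state.lincomb[OF Weyl_algebra_const W])
  also have "gauss_state (\<lambda>u. W0 (f - g) u + W0 (g - f) u) = gauss_char (f - g) + gauss_char (g - f)"
    using gauss_state.lincomb[OF W0_in_Weyl_algebra[of "f - g"] W0_in_Weyl_algebra[of "g - f"], of 1 1]
    by (simp add: gauss_state_W0)
  also have "gauss_char (g - f) = gauss_char (f - g)"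
    using Hinv_form_scale[of "- 1" "f - g"] by (simp add: gauss_char_def)
  finally have "Re (gauss_state (\<lambda>u. cnj (B u) * B u)) \<le> K\<^sup>2 * (2 - 2 * gauss_char (f - g))"
    by (simp add: gauss_state.one algebra_simps)
  then have "sqrt (Re (gauss_state (\<lambda>u. cnj (B u) * B u))) \<le> sqrt (K\<^sup>2 * (2 - 2 * gauss_char (f - g)))"
    by (rule real_sqrt_le_mono)
  then show ?thesis
    using \<open>K \<ge> 0\<close> by (simp add: state_norm_def B_def real_sqrt_mult)
qed

text \<open>Three-epsilon argument: \<open>\<xi>\<close> is replaced by the single algebra element
  \<open>\<xi> N\<close>, which is bounded, and the error is not enlarged because Weyl functions act
  isometrically for the seminorm.\<close>

lemma W0_strongly_continuous:
  assumes \<xi>: "\<xi> \<in> gns_space gauss_state"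
  shows "((\<lambda>t. gns_norm gauss_state (\<lambda>n u. gns_rep (W0 (t *\<^sub>R f)) \<xi> n u - gns_rep (W0 (t0 *\<^sub>R f)) \<xi> n u)) \<longlongrightarrow> 0) (at t0)"
proof -
  define G where "G t = gns_norm gauss_state (\<lambda>n u. gns_rep (W0 (t *\<^sub>R f)) \<xi> n u - gns_rep (W0 (t0 *\<^sub>R f)) \<xi> n u)" for t
  have \<xi>W: "\<xi> n \<in> Weyl_algebra" for n
    using \<xi> by (rule gauss_state.gns_spaceD)
  have space: "(\<lambda>n u. gns_rep (W0 (t *\<^sub>R f)) \<xi> n u - gns_rep (W0 (t0 *\<^sub>R f)) \<xi> n u) \<in> gns_space gauss_state" for t
    by (intro gauss_state.gns_space_diff gauss_state.gns_space_rep \<xi>)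
  have lim: "(\<lambda>n. state_norm gauss_state (\<lambda>u. W0 (t *\<^sub>R f) u * \<xi> n u - W0 (t0 *\<^sub>R f) u * \<xi> n u)) \<longlonglongrightarrow> G t" for t
    using gauss_state.gns_norm_LIMSEQ[OF space[of t]] by (simp add: G_def gns_rep_def)
  have G_nonneg: "G t \<ge> 0" for t
    by (rule LIMSEQ_le_const[OF lim])
       (auto intro!: exI[of _ 0] gauss_state.state_norm_nonneg Weyl_algebra_diff Weyl_algebra_mult W0_in_Weyl_algebra \<xi>W)
  have "(G \<longlongrightarrow> 0) (at t0)"
  proof (rule tendstoI)
    fix \<epsilon> :: real assume "\<epsilon> > 0"
    then have "\<epsilon> / 4 > 0"
      by simp
    then obtain N where N: "\<And>n m. m \<ge> N \<Longrightarrow> n \<ge> N \<Longrightarrow> state_norm gauss_state (\<lambda>u. \<xi> m u - \<xi> n u) < \<epsilon> / 4"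
      using \<xi> unfolding gauss_state.gns_space_iff by blast
    obtain K where K: "\<And>u. cmod (\<xi> N u) \<le> K"
      using Weyl_algebra_bounded[OF \<xi>W] by blast
    define R where "R t = K * sqrt (2 - 2 * gauss_char (t *\<^sub>R f - t0 *\<^sub>R f))" for t
    have "((\<lambda>t. gauss_char ((t - t0) *\<^sub>R f)) \<longlongrightarrow> gauss_char ((t0 - t0) *\<^sub>R f)) (at t0)"
      by (intro isCont_tendsto_compose[of _ gauss_char] tendsto_intros)
         (use continuous_gauss_char in \<open>auto simp: continuous_on_eq_continuous_at\<close>)
    then have "(R \<longlongrightarrow> K * sqrt (2 - 2 * gauss_char ((t0 - t0) *\<^sub>R f))) (at t0)"
      unfolding R_def scaleR_left_diff_distrib[symmetric] by (intro tendsto_intros)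
    then have "(R \<longlongrightarrow> 0) (at t0)"
      by (simp add: gauss_char_0)
    then have "\<forall>\<^sub>F t in at t0. R t < \<epsilon> / 4"
      using \<open>\<epsilon> / 4 > 0\<close> by (rule order_tendstoD)
    then show "\<forall>\<^sub>F t in at t0. dist (G t) 0 < \<epsilon>"
    proof eventually_elim
      case (elim t)
      have "state_norm gauss_state (\<lambda>u. W0 (t *\<^sub>R f) u * \<xi> n u - W0 (t0 *\<^sub>R f) u * \<xi> n u) \<le> 3 * (\<epsilon> / 4)" if "n \<ge> N" for n
      proof -
        let ?d = "\<lambda>u. \<xi> n u - \<xi> N u"
        have d: "?d \<in> Weyl_algebra"
          by (intro Weyl_algebra_diff \<xi>W)
        have "state_norm gauss_state (\<lambda>u. W0 (t *\<^sub>R f) u * \<xi> n u - W0 (t0 *\<^sub>R f) u * \<xi> n u) =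
            state_norm gauss_state (\<lambda>u. (W0 (t *\<^sub>R f) u * ?d u + - (W0 (t0 *\<^sub>R f) u * ?d u)) +
               (W0 (t *\<^sub>R f) u * \<xi> N u - W0 (t0 *\<^sub>R f) u * \<xi> N u))"
          by (simp add: algebra_simps)
        also have "\<dots> \<le> state_norm gauss_state (\<lambda>u. W0 (t *\<^sub>R f) u * ?d u + - (W0 (t0 *\<^sub>R f) u * ?d u)) +
            state_norm gauss_state (\<lambda>u. W0 (t *\<^sub>R f) u * \<xi> N u - W0 (t0 *\<^sub>R f) u * \<xi> N u)"
          using Weyl_algebra_diff[OF Weyl_algebra_mult[OF W0_in_Weyl_algebra d] Weyl_algebra_mult[OF W0_in_Weyl_algebra d]]
          by (intro gauss_state.state_norm_triangle Weyl_algebra_diff Weyl_algebra_mult W0_in_Weyl_algebra \<xi>W) simp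
        also have "state_norm gauss_state (\<lambda>u. W0 (t *\<^sub>R f) u * ?d u + - (W0 (t0 *\<^sub>R f) u * ?d u)) \<le>
            state_norm gauss_state (\<lambda>u. W0 (t *\<^sub>R f) u * ?d u) + state_norm gauss_state (\<lambda>u. - (W0 (t0 *\<^sub>R f) u * ?d u))"
          using Weyl_algebra_diff[OF Weyl_algebra_const[of 0] Weyl_algebra_mult[OF W0_in_Weyl_algebra d]]
          by (intro gauss_state.state_norm_triangle Weyl_algebra_mult W0_in_Weyl_algebra d) simp
        also have "\<dots> = 2 * state_norm gauss_state ?d"
          by (simp only: gauss_state.state_norm_minus gauss_state.state_norm_W0_mult)
        also have "state_norm gauss_state (\<lambda>u. W0 (t *\<^sub>R f) u * \<xi> N u - W0 (t0 *\<^sub>R f) u * \<xi> N u) \<le> R t"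
          unfolding R_def by (rule state_norm_W0_diff_le[OF \<xi>W K])
        finally show ?thesis
          using N[OF that order_refl] elim by simp
      qed
      then have "G t \<le> 3 * (\<epsilon> / 4)"
        by (intro LIMSEQ_le_const2[OF lim[of t]]) blast
      then show ?case
        using G_nonneg[of t] \<open>\<epsilon> > 0\<close> by simp
    qed
  qed
  then show ?thesis
    unfolding G_def .
qed

definition W0_quotient :: "'a \<Rightarrow> real \<Rightarrow> 'a \<Rightarrow> complex" where
  "W0_quotient f t u = (W0 (t *\<^sub>R f) u - 1) / (\<i> * complex_of_real t)"

lemma W0_quotient_in_Weyl_algebra: "W0_quotient f t \<in> Weyl_algebra"
  unfolding W0_quotient_def by (intro Weyl_algebra_divide Weyl_algebra_diff W0_in_Weyl_algebra Weyl_algebra_const)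

text \<open>Second-order Taylor expansion of the exponential; the factor 1/2 is dropped.\<close>

lemma W0_quotient_approx:
  assumes "t \<noteq> 0"
  shows "cmod (W0_quotient f t u - inner f u) \<le> \<bar>t\<bar> * (inner f u)\<^sup>2"
proof -
  have "W0_quotient f t u - inner f u = (iexp (t * inner f u) - 1 - \<i> * complex_of_real (t * inner f u)) / (\<i> * complex_of_real t)"
    using assms by (simp add: W0_quotient_def W0_def field_simps)
  then have "cmod (W0_quotient f t u - inner f u) \<le> (t * inner f u)\<^sup>2 / 2 / \<bar>t\<bar>"
    using norm_iexp_minus_linear_le[of "t * inner f u"] assms
    by (simp only: norm_divide norm_mult norm_ii norm_of_real mult_1 real_norm_def) (intro divide_right_mono, auto)
  also have "\<dots> = \<bar>t\<bar> * (inner f u)\<^sup>2 / 2"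
    using assms by (simp add: power2_eq_square abs_if)
  also have "\<dots> \<le> \<bar>t\<bar> * (inner f u)\<^sup>2"
    by simp
  finally show ?thesis .
qed

text \<open>Both quotients approximate the field function up to a multiple of its square, so the
  squared seminorm of their difference is controlled by a Gaussian fourth moment. With variance at
  most \<open>V\<close> this moment is at most \<open>3 V^2\<close>, hence
  \<open>sqrt 3\<close>.\<close>

lemma state_norm_W0_quotient_diff:
  assumes "t \<noteq> 0" "r \<noteq> 0"
  shows "state_norm gauss_state (\<lambda>u. W0_quotient f t u - W0_quotient f r u) \<le>
    (\<bar>t\<bar> + \<bar>r\<bar>) * (sqrt 3 * (Hinv_form f f / \<beta>))"
proof -
  define B where "B u = W0_quotient f t u - W0_quotient f r u" for u
  define V where "V = Hinv_form f f / \<beta>"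
  have B: "B \<in> Weyl_algebra"
    unfolding B_def by (intro Weyl_algebra_diff W0_quotient_in_Weyl_algebra)
  then have BB: "(\<lambda>u. cnj (B u) * B u) \<in> Weyl_algebra"
    by (intro Weyl_algebra_intros)
  have ptw: "Re (cnj (B u) * B u) \<le> (\<bar>t\<bar> + \<bar>r\<bar>)\<^sup>2 * (inner f u) ^ 4" for u
  proof -
    have "B u = (W0_quotient f t u - inner f u) - (W0_quotient f r u - inner f u)"
      by (simp add: B_def)
    then have "cmod (B u) \<le> cmod (W0_quotient f t u - inner f u) + cmod (W0_quotient f r u - inner f u)"
      by (metis norm_triangle_ineq4)
    also have "\<dots> \<le> \<bar>t\<bar> * (inner f u)\<^sup>2 + \<bar>r\<bar> * (inner f u)\<^sup>2"
      by (intro add_mono W0_quotient_approx assms)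
    finally have "(cmod (B u))\<^sup>2 \<le> ((\<bar>t\<bar> + \<bar>r\<bar>) * (inner f u)\<^sup>2)\<^sup>2"
      by (intro power_mono) (simp_all add: distrib_right)
    then show ?thesis
      by (simp add: cmod_power2 power_mult_distrib power2_eq_square[of "Re _"] power2_eq_square[of "Im _"] flip: power_mult)
  qed
  have "Re (LINT z|gaussian_product. cnj (B (field n z)) * B (field n z)) \<le> (\<bar>t\<bar> + \<bar>r\<bar>)\<^sup>2 * (3 * V\<^sup>2)" for n
  proof -
    have "Re (LINT z|gaussian_product. cnj (B (field n z)) * B (field n z)) =
        (LINT z|gaussian_product. Re (cnj (B (field n z)) * B (field n z)))"
      by (intro integral_Re[symmetric] integrable_Weyl_algebra_field BB)
    also have "\<dots> \<le> (LINT z|gaussian_product. (\<bar>t\<bar> + \<bar>r\<bar>)\<^sup>2 * (inner f (field n z)) ^ 4)"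
      by (intro integral_mono ptw integrable_Re integrable_Weyl_algebra_field BB integrable_mult_right integrable_field_moment)
    also have "\<dots> = (\<bar>t\<bar> + \<bar>r\<bar>)\<^sup>2 * (3 * (cov n f f)\<^sup>2)"
      unfolding inner_field using linear_form_moment_even[of "\<lambda>j. amp j * inner (bas j) f" n 2]
      by (simp add: cov_def power2_eq_square[of "_ * _"] fact_numeral)
    also have "\<dots> \<le> (\<bar>t\<bar> + \<bar>r\<bar>)\<^sup>2 * (3 * V\<^sup>2)"
      unfolding V_def by (intro mult_left_mono power_mono cov_le cov_nonneg) auto
    finally show ?thesis .
  qed
  moreover have "(\<lambda>n. Re (LINT z|gaussian_product. cnj (B (field n z)) * B (field n z))) \<longlonglongrightarrow> Re (gauss_state (\<lambda>u. cnj (B u) * B u))"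
    by (intro tendsto_intros gauss_state_LIMSEQ field_integrable_Weyl_algebra BB)
  ultimately have "Re (gauss_state (\<lambda>u. cnj (B u) * B u)) \<le> (\<bar>t\<bar> + \<bar>r\<bar>)\<^sup>2 * (3 * V\<^sup>2)"
    by (intro LIMSEQ_le_const2) blast+
  then have "sqrt (Re (gauss_state (\<lambda>u. cnj (B u) * B u))) \<le> sqrt ((\<bar>t\<bar> + \<bar>r\<bar>)\<^sup>2 * (3 * V\<^sup>2))"
    by (rule real_sqrt_le_mono)
  also have "V \<ge> 0"
    using \<beta>_pos Hinv_form_nonneg by (simp add: V_def)
  then have "sqrt ((\<bar>t\<bar> + \<bar>r\<bar>)\<^sup>2 * (3 * V\<^sup>2)) = (\<bar>t\<bar> + \<bar>r\<bar>) * (sqrt 3 * V)"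
    by (simp add: real_sqrt_mult)
  finally show ?thesis
    by (simp only: state_norm_def B_def V_def)
qed

text \<open>The field function is unbounded in general, so the value of the generator is given as
  the GNS vector formed by the quotients at steps \<open>1 / (n + 1)\<close>. Letting the second
  step tend to 0 in the preceding estimate proves convergence at rate \<open>|t|\<close>.\<close>

lemma has_field_value_gauss_state:
  "has_field_value gauss_state f gns_vac (\<lambda>n. W0_quotient f (inverse (real (Suc n))))"
proof -
  let ?r = "\<lambda>n. inverse (real (Suc n))"
  define C where "C = sqrt 3 * (Hinv_form f f / \<beta>)"
  have "C \<ge> 0"
    using \<beta>_pos Hinv_form_nonneg by (simp add: C_def)
  have space: "(\<lambda>n. W0_quotient f (?r n)) \<in> gns_space gauss_state"
    unfolding gauss_state.gns_space_iff
  proof (intro conjI allI impI W0_quotient_in_Weyl_algebra)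
    fix \<epsilon> :: real assume "\<epsilon> > 0"
    have "(\<lambda>n. ?r n * C) \<longlonglongrightarrow> 0 * C"
      by (intro tendsto_intros LIMSEQ_inverse_real_of_nat)
    then have "\<forall>\<^sub>F n in sequentially. ?r n * C < \<epsilon> / 2"
      using \<open>\<epsilon> > 0\<close> by (intro order_tendstoD) auto
    then obtain N where N: "\<And>n. n \<ge> N \<Longrightarrow> ?r n * C < \<epsilon> / 2"
      by (auto simp: eventually_sequentially)
    have "state_norm gauss_state (\<lambda>u. W0_quotient f (?r m) u - W0_quotient f (?r n) u) < \<epsilon>" if "m \<ge> N" "n \<ge> N" for m n
    proof -
      have "state_norm gauss_state (\<lambda>u. W0_quotient f (?r m) u - W0_quotient f (?r n) u) \<le> (\<bar>?r m\<bar> + \<bar>?r n\<bar>) * C"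
        unfolding C_def by (intro state_norm_W0_quotient_diff) auto
      also have "\<dots> = ?r m * C + ?r n * C"
        by (simp add: distrib_right)
      also have "\<dots> < \<epsilon>"
        using N[OF that(1)] N[OF that(2)] by linarith
      finally show ?thesis .
    qed
    then show "\<exists>N. \<forall>m\<ge>N. \<forall>n\<ge>N. state_norm gauss_state (\<lambda>u. W0_quotient f (?r m) u - W0_quotient f (?r n) u) < \<epsilon>"
      by blast
  qed
  define G where "G t = gns_norm gauss_state (\<lambda>n u. W0_quotient f t u - W0_quotient f (?r n) u)" for t
  have G: "0 \<le> G t \<and> G t \<le> \<bar>t\<bar> * C" if "t \<noteq> 0" for t
  proof -
    have lim: "(\<lambda>n. state_norm gauss_state (\<lambda>u. W0_quotient f t u - W0_quotient f (?r n) u)) \<longlonglongrightarrow> G t"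
      unfolding G_def
      by (intro gauss_state.gns_norm_LIMSEQ gauss_state.gns_space_diff gauss_state.gns_space_const W0_quotient_in_Weyl_algebra space)
    have "(\<lambda>n. (\<bar>t\<bar> + \<bar>?r n\<bar>) * C) \<longlonglongrightarrow> (\<bar>t\<bar> + \<bar>0\<bar>) * C"
      by (intro tendsto_intros LIMSEQ_inverse_real_of_nat)
    then have "G t \<le> (\<bar>t\<bar> + \<bar>0\<bar>) * C"
      using state_norm_W0_quotient_diff[OF that, of "?r _" f] unfolding C_def[symmetric]
      by (intro LIMSEQ_le[OF lim]) (auto intro!: exI[of _ 0])
    moreover have "0 \<le> G t"
      by (rule LIMSEQ_le_const[OF lim])
         (auto intro!: exI[of _ 0] gauss_state.state_norm_nonneg Weyl_algebra_diff W0_quotient_in_Weyl_algebra)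
    ultimately show ?thesis
      by simp
  qed
  have "(G \<longlongrightarrow> 0) (at 0)"
  proof (rule tendsto_sandwich)
    show "\<forall>\<^sub>F t in at 0. 0 \<le> G t" "\<forall>\<^sub>F t in at 0. G t \<le> \<bar>t\<bar> * C"
      using G by (auto simp: eventually_at_filter)
    have "((\<lambda>t. \<bar>t\<bar> * C) \<longlongrightarrow> \<bar>0\<bar> * C) (at 0)"
      by (intro tendsto_intros)
    then show "((\<lambda>t. \<bar>t\<bar> * C) \<longlongrightarrow> 0) (at 0)"
      by simp
  qed simp
  then have "((\<lambda>t. gns_norm gauss_state (\<lambda>n u. (gns_rep (W0 (t *\<^sub>R f)) gns_vac n u - gns_vac n u) / (\<i> * of_real t)
      - W0_quotient f (?r n) u)) \<longlongrightarrow> 0) (at 0)"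
    unfolding G_def[abs_def] by (simp only: W0_quotient_def[of f] gns_rep_def gns_vac_def mult_1_right)
  moreover have "gns_vac \<in> gns_space gauss_state"
    unfolding gns_vac_def by (intro gauss_state.gns_space_const Weyl_algebra_const)
  ultimately show ?thesis
    using space by (simp add: has_field_value_def)
qed

lemma class_C2_gauss_state: "class_C2 gauss_state"
  unfolding class_C2_def using W0_strongly_continuous has_field_value_gauss_state by blast

lemma gauss_char_derivative:
  "((\<lambda>t. complex_of_real (gauss_char (g + t *\<^sub>R f))) has_vector_derivative
    complex_of_real (- (Hinv_form f g / \<beta>) * gauss_char g)) (at 0)"
proof -
  have "((\<lambda>t. gauss_char (g + t *\<^sub>R f)) has_real_derivative - (Hinv_form f g / \<beta>) * gauss_char g) (at 0)"
    unfolding gauss_char_def Hinv_form_add_scale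
    using \<beta>_pos by (auto intro!: derivative_eq_intros)
  then show ?thesis
    by (rule has_vector_derivative_of_real[OF _, simplified has_real_derivative_iff_has_vector_derivative[symmetric]])
qed

lemma field_expectation_gauss_state:
  "field_expectation gauss_state f g = \<i> * (Hinv_form f g / \<beta>) * gauss_char g"
proof -
  have "\<i> * field_expectation gauss_state f g = complex_of_real (- (Hinv_form f g / \<beta>) * gauss_char g)"
    using vector_derivative_unique_at[OF gauss_state.field_expectation_derivative[OF class_C2_gauss_state]]
      gauss_char_derivative unfolding gauss_state_W0 by blast
  then have "- \<i> * (\<i> * field_expectation gauss_state f g) = - \<i> * complex_of_real (- (Hinv_form f g / \<beta>) * gauss_char g)"
    by (rule arg_cong)
  then show ?thesis
    by (simp add: mult.assoc[symmetric])
qed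

end

section \<open>Functionals and maps determined on generators\<close>

lemma fun_span_clinear_map:
  assumes A: "A \<in> fun_span S" and F: "\<And>u. clinear_functional_on (fun_span S) (\<lambda>A. F A u)"
    and base: "\<And>g. g \<in> S \<Longrightarrow> F g \<in> fun_span T"
  shows "F A \<in> fun_span T"
  using A
proof (induction rule: fun_span_induct)
  case zero
  have "F (\<lambda>u. 0) = (\<lambda>u. 0)"
    using F[unfolded clinear_functional_on_def, rule_format, OF fun_span_zero fun_span_zero, of 0 0] by auto
  then show ?case
    using fun_span_zero by simp
next
  case (add g c B)
  have "F (\<lambda>u. c * g u + B u) = (\<lambda>v. c * F g v + 1 * F B v)"
    using F[unfolded clinear_functional_on_def, rule_format, OF fun_span_base[OF add(1)] add(2), of c 1] by auto
  then show ?case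
    using fun_span_lincomb[OF base[OF add(1)] add(3), of c 1] by simp
qed

lemma fun_span_mono: "S \<subseteq> T \<Longrightarrow> fun_span S \<subseteq> fun_span T"
  unfolding fun_span_def by blast

lemma clinear_functional_on_subset:
  "clinear_functional_on T L \<Longrightarrow> S \<subseteq> T \<Longrightarrow> clinear_functional_on S L"
  unfolding clinear_functional_on_def by blast

text \<open>\<open>PB\<close> is given only by bilinearity and its values on Weyl functions; this
  locates all its values on the span.\<close>

lemma poisson_bracket_in_Weyl_span:
  assumes PB: "poisson_bracket PB" and "A \<in> Weyl_span" "B \<in> Weyl_span"
  shows "PB A B \<in> Weyl_span"
proof -
  have base: "PB (W0 f) (W0 g) \<in> Weyl_span" for f g
    using PB Weyl_span_lincomb[OF W0_in_Weyl_span[of "f + g"] W0_in_Weyl_span[of "f + g"], of "sigma g f" 0]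
    by (simp add: poisson_bracket_def)
  have "PB (W0 f) B \<in> Weyl_span" for f
    unfolding Weyl_span_def
  proof (rule fun_span_clinear_map[where F="PB (W0 f)", OF assms(3)[unfolded Weyl_span_def]])
    show "clinear_functional_on (fun_span (range W0)) (\<lambda>A. PB (W0 f) A u)" for u
      using PB W0_in_Weyl_span unfolding poisson_bracket_def Weyl_span_def[symmetric] by blast
  qed (use base in \<open>auto simp: Weyl_span_def\<close>)
  then show ?thesis
    unfolding Weyl_span_def
  proof (intro fun_span_clinear_map[where F="\<lambda>A. PB A B", OF assms(2)[unfolded Weyl_span_def]])
    show "clinear_functional_on (fun_span (range W0)) (\<lambda>A. PB A B u)" for u
      using PB assms(3) unfolding poisson_bracket_def Weyl_span_def[symmetric] by blast
  qed auto
qed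

text \<open>Ensures that \<open>b \<delta>(a)\<close> in the KMS condition stays in the domain of
  the extended functional.\<close>

lemma field_span_W0_mult:
  assumes "A \<in> Weyl_span" "B \<in> field_span"
  shows "(\<lambda>u. A u * B u) \<in> field_span"
proof -
  have base: "(\<lambda>u. W0 f u * B u) \<in> field_span" for f
    unfolding field_span_def
  proof (rule fun_span_clinear_map[where F="\<lambda>B u. W0 f u * B u", OF assms(2)[unfolded field_span_def]])
    fix G :: "'a \<Rightarrow> complex" assume "G \<in> {(\<lambda>u. Phi0 h u * W0 g u) | h g. True}"
    then obtain h g where "G = (\<lambda>u. Phi0 h u * W0 g u)"
      by blast
    then have "(\<lambda>u. W0 f u * G u) = (\<lambda>u. Phi0 h u * W0 (f + g) u)"
      by (simp add: W0_add mult_ac)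
    then show "(\<lambda>u. W0 f u * G u) \<in> fun_span {(\<lambda>u. Phi0 h u * W0 g u) | h g. True}"
      by (intro fun_span_base) blast
  qed (simp add: clinear_functional_on_def algebra_simps)
  show ?thesis
    unfolding field_span_def
    by (rule fun_span_clinear_map[where F="\<lambda>A u. A u * B u", OF assms(1)[unfolded Weyl_span_def]])
       (use base in \<open>auto simp: clinear_functional_on_def algebra_simps field_span_def\<close>)
qed

text \<open>Both functionals agree on the span by linearity; a common approximant and the two bounds
  transfer this to the closure.\<close>

lemma Weyl_algebra_functional_unique:
  assumes L: "clinear_functional_on Weyl_algebra L" "\<And>A K. A \<in> Weyl_algebra \<Longrightarrow> (\<forall>u. cmod (A u) \<le> K) \<Longrightarrow> cmod (L A) \<le> C * K"
    and L': "clinear_functional_on Weyl_algebra L'" "\<And>A K. A \<in> Weyl_algebra \<Longrightarrow> (\<forall>u. cmod (A u) \<le> K) \<Longrightarrow> cmod (L' A) \<le> C' * K"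
    and eq: "\<And>f. L (W0 f) = L' (W0 f)" and A: "A \<in> Weyl_algebra"
  shows "L A = L' A"
proof -
  have diff: "M (\<lambda>u. A u - B u) = M A - M B" if "clinear_functional_on Weyl_algebra M" "B \<in> Weyl_algebra" for M B
    using that(1)[unfolded clinear_functional_on_def, rule_format, OF A that(2), of 1 "- 1"] by simp
  have sub: "Weyl_span \<subseteq> Weyl_algebra"
    using Weyl_span_subset by blast
  have "cmod (L A - L' A) \<le> 0 + \<epsilon>" if "\<epsilon> > 0" for \<epsilon>
  proof -
    define \<delta> where "\<delta> = \<epsilon> / (\<bar>C\<bar> + \<bar>C'\<bar> + 1)"
    have "\<delta> > 0"
      using that by (simp add: \<delta>_def add_nonneg_pos)
    then obtain B where B: "B \<in> Weyl_span" "\<And>u. cmod (A u - B u) \<le> \<delta>"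
      using Weyl_algebraD[OF A] by blast
    have BW: "B \<in> Weyl_algebra"
      by (rule Weyl_span_subset[OF B(1)])
    have "L B = L' B"
      using B(1) unfolding Weyl_span_def
      by (rule fun_span_clinear_eq)
         (use clinear_functional_on_subset[OF L(1) sub] clinear_functional_on_subset[OF L'(1) sub] eq in \<open>auto simp: Weyl_span_def\<close>)
    then have "L A - L' A = L (\<lambda>u. A u - B u) - L' (\<lambda>u. A u - B u)"
      by (simp add: diff L L' BW)
    also have "cmod \<dots> \<le> C * \<delta> + C' * \<delta>"
      using L(2)[OF Weyl_algebra_diff[OF A BW]] L'(2)[OF Weyl_algebra_diff[OF A BW]] B(2)
      by (intro order_trans[OF norm_triangle_ineq4] add_mono) auto
    also have "\<dots> \<le> (\<bar>C\<bar> + \<bar>C'\<bar> + 1) * \<delta>"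
      using \<open>\<delta> > 0\<close> unfolding distrib_right[symmetric] by (intro mult_right_mono) auto
    also have "\<dots> = \<epsilon>"
      by (simp add: \<delta>_def)
    finally show ?thesis
      by simp
  qed
  then have "cmod (L A - L' A) \<le> 0"
    by (rule field_le_epsilon)
  then show ?thesis
    by simp
qed

section \<open>The KMS condition for the Gaussian state\<close>

context gaussian_field
begin

text \<open>The extension to \<open>field_span\<close> is \<open>gauss_state\<close> itself, whose
  defining limit also exists there. Both sides of the KMS condition are bilinear, so linearity in
  \<open>b\<close> and then in \<open>a\<close> reduces it to \<open>W0 f\<close> and
  \<open>W0 g\<close>; there it is \<open>Hinv_form_H\<close> applied to \<open>f\<close> and
  \<open>f + g\<close>.\<close>

lemma weak_kms_gauss_state:
  assumes PB: "poisson_bracket PB" and A0: "A0 = fun_span (W0 ` D)"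
    and \<delta>: "\<And>u. clinear_functional_on A0 (\<lambda>A. \<delta> A u)"
    and \<delta>_W0: "\<And>f. f \<in> D \<Longrightarrow> \<delta> (W0 f) = (\<lambda>u. \<i> * Phi0 (\<i> *\<^sub>C H f) u * W0 f u)"
  shows "weak_kms_state PB A0 \<delta> \<beta> gauss_state"
  unfolding weak_kms_state_def
proof (intro conjI exI[of _ gauss_state] allI ballI state_gauss_state class_C2_gauss_state)
  have field_int: "field_integrable A" if "A \<in> field_span" for A
    using that unfolding field_span_def by (rule field_integrable_fun_span) (auto intro: field_integrable_Phi0_W0)
  then show "clinear_functional_on field_span gauss_state"
    unfolding clinear_functional_on_def by (intro ballI allI gauss_state_lincomb)
  show "gauss_state (\<lambda>u. Phi0 f u * W0 g u) = field_expectation gauss_state f g" for f g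
    by (simp only: gauss_state_Phi0_W0 field_expectation_gauss_state)
  have A0_sub: "A0 \<subseteq> Weyl_span"
    unfolding A0 Weyl_span_def by (intro fun_span_mono) auto
  have \<delta>_field: "\<delta> a \<in> field_span" if "a \<in> A0" for a
    unfolding field_span_def
  proof (rule fun_span_clinear_map[where F=\<delta>, OF that[unfolded A0] \<delta>[unfolded A0]])
    fix G :: "'a \<Rightarrow> complex" assume "G \<in> W0 ` D"
    then obtain f where f: "f \<in> D" "G = W0 f"
      by blast
    have "(\<lambda>u. Phi0 (\<i> *\<^sub>C H f) u * W0 f u) \<in> fun_span {(\<lambda>u. Phi0 h u * W0 g u) | h g. True}"
      by (intro fun_span_base) blast
    from fun_span_lincomb[OF this this, of \<i> 0] show "\<delta> G \<in> fun_span {(\<lambda>u. Phi0 h u * W0 g u) | h g. True}"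
      by (simp add: f \<delta>_W0 mult.assoc)
  qed
  have PB_int: "field_integrable (PB a b)" if "a \<in> A0" "b \<in> A0" for a b
    using that A0_sub by (intro field_integrable_Weyl_algebra Weyl_span_subset poisson_bracket_in_Weyl_span[OF PB]) auto
  have \<delta>_int: "field_integrable (\<lambda>u. b u * \<delta> a u)" if "a \<in> A0" "b \<in> A0" for a b
    using that A0_sub by (intro field_int field_span_W0_mult \<delta>_field) auto
  have base: "gauss_state (PB (W0 f) (W0 g)) = \<beta> * gauss_state (\<lambda>u. W0 g u * \<delta> (W0 f) u)" if f: "f \<in> D" for f g
  proof -
    have "gauss_state (PB (W0 f) (W0 g)) = sigma g f * gauss_char (f + g)"
      using PB gauss_state.scale[OF W0_in_Weyl_algebra] by (simp add: poisson_bracket_def gauss_state_W0)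
    have "(\<lambda>u. W0 g u * \<delta> (W0 f) u) = (\<lambda>u. \<i> * (Phi0 (\<i> *\<^sub>C H f) u * W0 (f + g) u) + 0 * (Phi0 (\<i> *\<^sub>C H f) u * W0 (f + g) u))"
      by (simp add: \<delta>_W0[OF f] W0_add mult_ac)
    then have "gauss_state (\<lambda>u. W0 g u * \<delta> (W0 f) u) = \<i> * (\<i> * (Hinv_form (\<i> *\<^sub>C H f) (f + g) / \<beta>) * gauss_char (f + g))"
      using gauss_state_lincomb[OF field_integrable_Phi0_W0 field_integrable_Phi0_W0, of \<i> "\<i> *\<^sub>C H f" "f + g" 0 "\<i> *\<^sub>C H f" "f + g"]
      by (simp add: gauss_state_Phi0_W0)
    \<comment> \<open>The part with \<open>f\<close> vanishes because \<open>\<i> f\<close> is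
      orthogonal to \<open>f\<close> in the real inner product.\<close>
    also have "Hinv_form (\<i> *\<^sub>C H f) (f + g) = - sigma g f"
      by (simp add: Hinv_form_H[OF f] sigma_eq inner_add_right inner_i_self inner_i_right inner_commute[of _ g])
    finally have "complex_of_real \<beta> * gauss_state (\<lambda>u. W0 g u * \<delta> (W0 f) u) = sigma g f * gauss_char (f + g)"
      using \<beta>_pos by (simp add: mult.assoc[symmetric])
    then show ?thesis
      using \<open>gauss_state (PB (W0 f) (W0 g)) = sigma g f * gauss_char (f + g)\<close> by simp
  qed
  have PB_lin: "(\<lambda>u. PB (\<lambda>u. c * a u + d * a' u) b u) = (\<lambda>u. c * PB a b u + d * PB a' b u)"
     "(\<lambda>u. PB b (\<lambda>u. c * a u + d * a' u) u) = (\<lambda>u. c * PB b a u + d * PB b a' u)"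
    if "a \<in> A0" "a' \<in> A0" "b \<in> A0" for a a' b c d
  proof -
    have W: "a \<in> Weyl_span" "a' \<in> Weyl_span" "b \<in> Weyl_span"
      using that A0_sub by auto
    show "(\<lambda>u. PB (\<lambda>u. c * a u + d * a' u) b u) = (\<lambda>u. c * PB a b u + d * PB a' b u)"
      using PB[unfolded poisson_bracket_def clinear_functional_on_def, THEN conjunct1, rule_format, OF W(3) W(1,2)] by simp
    show "(\<lambda>u. PB b (\<lambda>u. c * a u + d * a' u) u) = (\<lambda>u. c * PB b a u + d * PB b a' u)"
      using PB[unfolded poisson_bracket_def clinear_functional_on_def, THEN conjunct2, THEN conjunct1, rule_format, OF W(3) W(1,2)] by simp
  qed
  have W0_A0: "g \<in> A0" if "g \<in> W0 ` D" for g
    using that unfolding A0 by (rule fun_span_base)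
  have step: "gauss_state (PB (W0 f) b) = \<beta> * gauss_state (\<lambda>u. b u * \<delta> (W0 f) u)" if f: "f \<in> D" and b: "b \<in> A0" for f b
  proof (rule fun_span_clinear_eq[OF b[unfolded A0]])
    have Wf: "W0 f \<in> A0"
      using f by (intro W0_A0) auto
    show "clinear_functional_on (fun_span (W0 ` D)) (\<lambda>b. gauss_state (PB (W0 f) b))"
      unfolding A0[symmetric] clinear_functional_on_def
      by (intro ballI allI) (simp add: PB_lin[OF _ _ Wf] gauss_state_lincomb PB_int Wf)
    have "gauss_state (\<lambda>u. (c * a u + d * a' u) * \<delta> (W0 f) u) =
        c * gauss_state (\<lambda>u. a u * \<delta> (W0 f) u) + d * gauss_state (\<lambda>u. a' u * \<delta> (W0 f) u)" if "a \<in> A0" "a' \<in> A0" for a a' c d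
      using gauss_state_lincomb[OF \<delta>_int[OF Wf that(1)] \<delta>_int[OF Wf that(2)], of c d] by (simp add: algebra_simps)
    then show "clinear_functional_on (fun_span (W0 ` D)) (\<lambda>b. \<beta> * gauss_state (\<lambda>u. b u * \<delta> (W0 f) u))"
      unfolding A0[symmetric] clinear_functional_on_def by (simp add: algebra_simps)
  qed (use base[OF f] in auto)
  fix a b assume ab: "a \<in> A0" "b \<in> A0"
  show "gauss_state (PB a b) = complex_of_real \<beta> * gauss_state (\<lambda>u. b u * \<delta> a u)"
  proof (rule fun_span_clinear_eq[OF ab(1)[unfolded A0]])
    show "clinear_functional_on (fun_span (W0 ` D)) (\<lambda>a. gauss_state (PB a b))"
      unfolding A0[symmetric] clinear_functional_on_def
      by (intro ballI allI) (simp add: PB_lin[OF _ _ ab(2)] gauss_state_lincomb PB_int ab(2))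
    have "gauss_state (\<lambda>u. b u * \<delta> (\<lambda>u. c * a u + d * a' u) u) =
        c * gauss_state (\<lambda>u. b u * \<delta> a u) + d * gauss_state (\<lambda>u. b u * \<delta> a' u)" if "a \<in> A0" "a' \<in> A0" for a a' c d
    proof -
      have "\<delta> (\<lambda>u. c * a u + d * a' u) u = c * \<delta> a u + d * \<delta> a' u" for u
        using \<delta> that unfolding clinear_functional_on_def by blast
      then show ?thesis
        using gauss_state_lincomb[OF \<delta>_int[OF that(1) ab(2)] \<delta>_int[OF that(2) ab(2)], of c d] by (simp add: algebra_simps)
    qed
    then show "clinear_functional_on (fun_span (W0 ` D)) (\<lambda>a. \<beta> * gauss_state (\<lambda>u. b u * \<delta> a u))"
      unfolding A0[symmetric] clinear_functional_on_def by (simp add: algebra_simps)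
  qed (use step ab in auto)
qed

end

section \<open>Negative Sobolev spaces and the Gaussian measure\<close>

text \<open>The norm comes from the real inner product, so complex homogeneity has to be derived; it
  rests on \<open>cinner x x\<close> being real.\<close>

lemma norm_scaleC: "norm (c *\<^sub>C (x::'a::complex_hilbert)) = cmod c * norm x"
proof -
  have "(norm (c *\<^sub>C x))\<^sup>2 = (cmod c * norm x)\<^sup>2"
  proof -
    have "cinner x x = complex_of_real ((norm x)\<^sup>2)"
      using inner_i_self[of x] by (simp add: cinner_eq power2_norm_eq_inner complex_eq_iff)
    moreover have "c * cnj c = complex_of_real ((cmod c)\<^sup>2)"
      by (rule complex_norm_square[symmetric])
    ultimately have "cinner (c *\<^sub>C x) (c *\<^sub>C x) = complex_of_real ((cmod c * norm x)\<^sup>2)"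
      by (simp add: cinner_scaleC_left cinner_scaleC_right power_mult_distrib mult.assoc[symmetric])
    then show ?thesis
      by (simp only: power2_norm_eq_inner inner_eq_Re_cinner[of "c *\<^sub>C x"]) simp
  qed
  then show ?thesis
    by (simp add: power2_eq_iff_nonneg)
qed

section \<open>Coordinates of negative powers of H\<close>

context positive_discrete_operator
begin

lemma inner_bas_scaleC_e:
  assumes "k \<in> I"
  shows "inner (bas j) (c *\<^sub>C e k) = (if j = 2 * k then Re c else if j = Suc (2 * k) then Im c else 0)"
proof -
  have "c *\<^sub>C e k = Re c *\<^sub>R bas (2 * k) + Im c *\<^sub>R bas (Suc (2 * k))"
    using assms by (subst scaleC_eq) (simp add: bas_def)
  then show ?thesis
    using assms by (auto simp: inner_add_right inner_bas)
qed

text \<open>\<open>Hpow\<close> is an unconditional sum, so a coordinate functional may be taken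
  inside only after summability is known. The terms have norm \<open>x * y\<close> with
  \<open>x^2 = lam k powr (- s)\<close> and \<open>y\<close> the modulus of the coordinate of
  \<open>g\<close>, and \<open>x * y \<le> x^2 + y^2\<close> is summable by the trace condition and
  Parseval.\<close>

lemma inner_bas_Hpow:
  "inner (bas j) (Hpow H I e (- s / 2) g) = kap j powr (- s / 2) * inner (bas j) g"
proof -
  let ?f = "\<lambda>k. (complex_of_real (eigenvalue H e k powr (- s / 2)) * cinner (e k) g) *\<^sub>C e k"
  have "(\<lambda>k. norm (?f k)) summable_on I"
  proof (subst summable_on_nat_iff)
    have "summable (\<lambda>k. (inner (bas (2 * k)) g)\<^sup>2 + (inner (bas (Suc (2 * k))) g)\<^sup>2)"
      by (rule summable_pairsD[OF summable_inner_bas])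
    then have "summable (\<lambda>k. (if k \<in> I then lam k powr (- s) else 0) + ((inner (bas (2 * k)) g)\<^sup>2 + (inner (bas (Suc (2 * k))) g)\<^sup>2))"
      by (rule summable_add[OF summable_lam])
    then show "summable (\<lambda>k. if k \<in> I then norm (?f k) else 0)"
    proof (rule summable_comparison_test')
      fix k
      show "norm (if k \<in> I then norm (?f k) else 0) \<le>
        (if k \<in> I then lam k powr (- s) else 0) + ((inner (bas (2 * k)) g)\<^sup>2 + (inner (bas (Suc (2 * k))) g)\<^sup>2)"
      proof (cases "k \<in> I")
        case True
        then have "norm (e k) = 1"
          using norm_bas_square[of "2 * k"] by (simp add: bas_def power2_eq_1_iff) (smt (verit) norm_ge_zero)
        define x where "x = lam k powr (- s / 2)"
        define y where "y = cmod (cinner (e k) g)"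
        have xy: "x \<ge> 0" "y \<ge> 0" "x\<^sup>2 = lam k powr (- s)"
          using lam_pos[of k] by (simp_all add: x_def y_def powr_power)
        have "2 * x * y \<le> x\<^sup>2 + y\<^sup>2"
          by (rule sum_squares_bound)
        moreover have "x * y \<ge> 0"
          using xy by simp
        ultimately have "x * y \<le> lam k powr (- s) + y\<^sup>2"
          unfolding xy(3)[symmetric] by linarith
        with True \<open>norm (e k) = 1\<close> show ?thesis
          by (simp add: norm_scaleC norm_mult cmod_cinner_e[symmetric] x_def y_def lam_def)
      qed simp
    qed
  qed simp
  then have sum: "?f summable_on I"
    by (rule abs_summable_summable)
  have bl: "bounded_linear (inner (bas j))"
    by (rule bounded_linear_inner_right)
  have "inner (bas j) (Hpow H I e (- s / 2) g) = infsum (\<lambda>k. inner (bas j) (?f k)) I"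
    unfolding Hpow_def by (intro infsumI[symmetric] has_sum_bounded_linear[OF bl has_sum_infsum[OF sum], unfolded o_def])
  also have "\<dots> = kap j powr (- s / 2) * inner (bas j) g"
  proof (cases "j div 2 \<in> I")
    case True
    have "infsum (\<lambda>k. inner (bas j) (?f k)) I = inner (bas j) (?f (j div 2))"
      using True by (intro infsum_single_support) (auto simp: inner_bas_scaleC_e)
    also have "\<dots> = kap j powr (- s / 2) * inner (bas j) g"
    proof (cases "even j")
      case True
      then obtain k where "j = 2 * k"
        by (elim evenE)
      then show ?thesis
        unfolding inner_bas_scaleC_e[OF \<open>j div 2 \<in> I\<close>] using \<open>j div 2 \<in> I\<close>
        by (simp add: bas_def kap_def lam_def cinner_eq)
    next
      case False
      then obtain k where "j = Suc (2 * k)"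
        by (metis oddE Suc_eq_plus1)
      then show ?thesis
        unfolding inner_bas_scaleC_e[OF \<open>j div 2 \<in> I\<close>] using \<open>j div 2 \<in> I\<close>
        by (simp add: bas_def kap_def lam_def cinner_eq)
    qed
    finally show ?thesis .
  qed (simp add: bas_def)
  finally show ?thesis .
qed

end

locale negative_sobolev = positive_discrete_operator D H I e s
  for D :: "'a::complex_hilbert set" and H I e s +
  fixes \<iota> :: "'a \<Rightarrow> 'b::{real_inner, complete_space}"
  assumes completion: "neg_sobolev_completion H I e s \<iota>"
begin

lemma linear_iota: "linear \<iota>"
  using completion by (simp add: neg_sobolev_completion_def)

lemma closure_range_iota: "closure (range \<iota>) = UNIV"
  using completion by (simp add: neg_sobolev_completion_def)

lemma inner_iota_bas: "inner (\<iota> (bas j)) (\<iota> g) = kap j powr (- s) * inner (bas j) g"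
proof -
  have "inner (\<iota> (bas j)) (\<iota> g) = inner (Hpow H I e (- s / 2) (bas j)) (Hpow H I e (- s / 2) g)"
    using completion by (simp add: neg_sobolev_completion_def inner_eq_Re_cinner)
  also have "\<dots> = (kap j powr (- s / 2) * kap j powr (- s / 2)) * inner (bas j) g"
    unfolding Hpow_bas using inner_bas_Hpow[of j g] by simp
  also have "kap j powr (- s / 2) * kap j powr (- s / 2) = kap j powr (- s)"
    by (simp add: powr_add[symmetric])
  finally show ?thesis .
qed

text \<open>\<open>v\<close> is the Riesz representative in \<open>\<H>\<^sup>-\<^sup>s\<close> of the functional \<open>\<langle>f, \<cdot>\<rangle>\<close>.\<close>

definition riesz :: "'a \<Rightarrow> 'b \<Rightarrow> bool" where
  "riesz f v \<longleftrightarrow> (\<forall>g. inner v (\<iota> g) = inner f g)"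

text \<open>A continuous extension from a dense range is unique, so pairing with the Riesz vector
  meets the definite description in \<open>dual_pairing\<close>.\<close>

lemma riesz_dual_pairing:
  assumes "riesz f v"
  shows "dual_pairing \<iota> f = inner v"
  unfolding dual_pairing_def
proof (rule the_equality)
  show "continuous_on UNIV (inner v) \<and> (\<forall>g. inner v (\<iota> g) = inner f g)"
    using assms by (auto simp: riesz_def intro: continuous_intros)
  fix p assume p: "continuous_on UNIV p \<and> (\<forall>g. p (\<iota> g) = inner f g)"
  have "closure (range \<iota>) \<subseteq> {u. p u = inner v u}"
  proof (rule closure_minimal)
    show "range \<iota> \<subseteq> {u. p u = inner v u}"
      using assms p by (auto simp: riesz_def)
    show "closed {u. p u = inner v u}"
      using p by (intro closed_Collect_eq continuous_intros) auto
  qed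
  then show "p = inner v"
    unfolding closure_range_iota by auto
qed

lemma riesz_lincomb: "riesz f v \<Longrightarrow> riesz g w \<Longrightarrow> riesz (a *\<^sub>R f + b *\<^sub>R g) (a *\<^sub>R v + b *\<^sub>R w)"
  by (simp add: riesz_def inner_add_left)

lemma riesz_scaleR: "riesz f v \<Longrightarrow> riesz (a *\<^sub>R f) (a *\<^sub>R v)"
  by (simp add: riesz_def)

lemma riesz_sum: "(\<And>j. j \<in> A \<Longrightarrow> riesz (f j) (v j)) \<Longrightarrow> riesz (\<Sum>j\<in>A. f j) (\<Sum>j\<in>A. v j)"
  by (simp add: riesz_def inner_sum_left)

text \<open>The image of \<open>H^s (bas j)\<close>: the inner product of the completion carries the
  weight \<open>kap j powr (- s)\<close>, which the factor cancels.\<close>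

definition riesz_bas :: "nat \<Rightarrow> 'b" where
  "riesz_bas j = kap j powr s *\<^sub>R \<iota> (bas j)"

lemma riesz_bas: "riesz (bas j) (riesz_bas j)"
  using kap_pos[of j] by (simp add: riesz_def riesz_bas_def inner_iota_bas powr_add[symmetric] mult.assoc[symmetric])

lemma dual_pairing_bas: "dual_pairing \<iota> (bas j) = inner (riesz_bas j)"
  by (rule riesz_dual_pairing[OF riesz_bas])

text \<open>The squared norms of the terms are \<open>kap j powr s * (inner (bas j) f)^2\<close>,
  and their summability is exactly membership in the Sobolev space.\<close>

lemma riesz_exists:
  assumes "f \<in> sobolev H I e s"
  obtains v where "riesz f v" "(\<lambda>n. \<Sum>j<n. inner (bas j) f *\<^sub>R riesz_bas j) \<longlonglongrightarrow> v"
proof -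
  have "convergent (\<lambda>n. \<Sum>j<n. inner (bas j) f *\<^sub>R riesz_bas j)"
  proof (rule orthogonal_series_convergent)
    show "inner (inner (bas i) f *\<^sub>R riesz_bas i) (inner (bas j) f *\<^sub>R riesz_bas j) = 0" if "i \<noteq> j" for i j
      using that by (simp add: riesz_bas_def inner_iota_bas inner_bas)
    have "(norm (inner (bas j) f *\<^sub>R riesz_bas j))\<^sup>2 = kap j powr s * (inner (bas j) f)\<^sup>2" for j
    proof -
      have "(norm (inner (bas j) f *\<^sub>R riesz_bas j))\<^sup>2 = (kap j powr s * (inner (bas j) f)\<^sup>2) * (kap j powr s * kap j powr (- s) * inner (bas j) (bas j))"
        unfolding power2_norm_eq_inner by (simp add: riesz_bas_def inner_iota_bas power2_eq_square)
      also have "kap j powr s * kap j powr (- s) = 1"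
        using kap_pos[of j] by (simp add: powr_add[symmetric])
      finally show ?thesis
        by (auto simp: inner_bas) (auto simp: bas_def)
    qed
    then show "summable (\<lambda>j. (norm (inner (bas j) f *\<^sub>R riesz_bas j))\<^sup>2)"
      using assms by (simp add: sobolev_iff)
  qed
  then obtain v where v: "(\<lambda>n. \<Sum>j<n. inner (bas j) f *\<^sub>R riesz_bas j) \<longlonglongrightarrow> v"
    by (auto simp: convergent_def)
  have "inner v (\<iota> g) = inner f g" for g
  proof (rule LIMSEQ_unique)
    show "(\<lambda>n. inner (\<Sum>j<n. inner (bas j) f *\<^sub>R riesz_bas j) (\<iota> g)) \<longlonglongrightarrow> inner v (\<iota> g)"
      by (intro tendsto_intros v)
    show "(\<lambda>n. inner (\<Sum>j<n. inner (bas j) f *\<^sub>R riesz_bas j) (\<iota> g)) \<longlonglongrightarrow> inner f g"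
      using Parseval[of f g] riesz_bas by (simp add: sums_def inner_sum_left riesz_def)
  qed
  then show ?thesis
    using that v by (auto simp: riesz_def)
qed

lemma dual_pairing_sum_bas: "dual_pairing \<iota> (\<Sum>j<n. c j *\<^sub>R bas j) u = (\<Sum>j<n. c j * dual_pairing \<iota> (bas j) u)"
proof -
  have "riesz (\<Sum>j<n. c j *\<^sub>R bas j) (\<Sum>j<n. c j *\<^sub>R riesz_bas j)"
    by (intro riesz_sum riesz_scaleR riesz_bas)
  from riesz_dual_pairing[OF this] show ?thesis
    by (simp add: dual_pairing_bas inner_sum_left)
qed

lemma continuous_dual_pairing:
  assumes "f \<in> sobolev H I e s"
  shows "continuous_on UNIV (dual_pairing \<iota> f)"
proof -
  obtain v where "riesz f v"
    using riesz_exists[OF assms] .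
  then show ?thesis
    by (simp add: riesz_dual_pairing continuous_intros)
qed

lemma dual_pairing_proj_LIMSEQ:
  assumes "f \<in> sobolev H I e s"
  shows "(\<lambda>n. dual_pairing \<iota> (proj n f) u) \<longlonglongrightarrow> dual_pairing \<iota> f u"
proof -
  obtain v where v: "riesz f v" "(\<lambda>n. \<Sum>j<n. inner (bas j) f *\<^sub>R riesz_bas j) \<longlonglongrightarrow> v"
    using riesz_exists[OF assms] .
  have "dual_pairing \<iota> (proj n f) u = inner (\<Sum>j<n. inner (bas j) f *\<^sub>R riesz_bas j) u" for n
    unfolding proj_def dual_pairing_sum_bas by (simp add: dual_pairing_bas inner_sum_left)
  then show ?thesis
    using v by (simp add: riesz_dual_pairing tendsto_intros)
qed

end

locale gaussian_sobolev = gaussian_field D H I e s \<beta> + negative_sobolev D H I e s \<iota>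
  for D :: "'a::complex_hilbert set" and H I e s \<beta> and \<iota> :: "'a \<Rightarrow> 'b::{real_inner, complete_space}"
begin

section \<open>The almost surely convergent random series\<close>

definition sq_term :: "nat \<Rightarrow> (nat \<Rightarrow> real) \<Rightarrow> real" where
  "sq_term j z = kap j powr (- s) * (norm (bas j))\<^sup>2 * (amp j)\<^sup>2 * (z j)\<^sup>2"

lemma sq_term_nonneg: "sq_term j z \<ge> 0"
  by (simp add: sq_term_def)

lemma iota_field: "\<iota> (field n z) = (\<Sum>j<n. (amp j * z j) *\<^sub>R \<iota> (bas j))"
  by (simp add: field_def linear_sum[OF linear_iota] linear_cmul[OF linear_iota])

lemma norm_term_square: "(norm ((amp j * z j) *\<^sub>R \<iota> (bas j)))\<^sup>2 = sq_term j z"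
proof -
  have "(norm (\<iota> (bas j)))\<^sup>2 = kap j powr (- s) * (norm (bas j))\<^sup>2"
    by (simp add: power2_norm_eq_inner inner_iota_bas)
  then show ?thesis
    by (simp add: power_mult_distrib sq_term_def)
qed

lemma term_orthogonal: "i \<noteq> j \<Longrightarrow> inner ((amp i * z i) *\<^sub>R \<iota> (bas i)) ((amp j * z j) *\<^sub>R \<iota> (bas j)) = 0"
  by (simp add: inner_iota_bas inner_bas)

lemma norm_iota_field: "(norm (\<iota> (field n z)))\<^sup>2 = (\<Sum>j<n. sq_term j z)"
  unfolding iota_field norm_term_square[symmetric] by (intro orthogonal_norm_sum term_orthogonal) auto

lemma sq_term_measurable: "(\<lambda>z. ennreal (sq_term j z)) \<in> borel_measurable gaussian_product"
proof -
  have "(\<lambda>z::nat \<Rightarrow> real. z j) \<in> borel_measurable gaussian_product"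
    using borel_measurable_component[of j] by (simp cong: measurable_cong_sets)
  then show ?thesis
    unfolding sq_term_def by measurable
qed

text \<open>This is the expected squared norm of the whole series. The factor
  \<open>1 / kap j\<close> from the variance is merely bounded; the trace condition sums the
  rest.\<close>

lemma nn_integral_sq_terms: "(\<integral>\<^sup>+z. (\<Sum>j. ennreal (sq_term j z)) \<partial>gaussian_product) < \<infinity>"
proof -
  obtain K where K: "\<And>j. 1 / kap j \<le> K" "K > 0"
    using inverse_kap_bounded by blast
  have "(\<integral>\<^sup>+z. ennreal (sq_term j z) \<partial>gaussian_product) = ennreal (kap j powr (- s) * (norm (bas j))\<^sup>2 * (amp j)\<^sup>2)" for j
  proof -
    have "(\<integral>\<^sup>+z. ennreal (sq_term j z) \<partial>gaussian_product) = ennreal (LINT z|gaussian_product. sq_term j z)"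
      unfolding sq_term_def by (intro nn_integral_eq_integral integrable_mult_right integrable_component_power) auto
    then show ?thesis
      by (simp add: sq_term_def component_moment_2)
  qed
  moreover have "summable (\<lambda>j. kap j powr (- s) * (norm (bas j))\<^sup>2 * (amp j)\<^sup>2)"
  proof (rule summable_comparison_test'[OF summable_mult2[OF summable_kap, of "K / \<beta>"]])
    fix j
    have "(amp j)\<^sup>2 \<le> K / \<beta>"
      using K(1)[of j] \<beta>_pos unfolding amp_square by (simp add: field_simps)
    then show "norm (kap j powr (- s) * (norm (bas j))\<^sup>2 * (amp j)\<^sup>2) \<le> kap j powr (- s) * (norm (bas j))\<^sup>2 * (K / \<beta>)"
      using mult_left_mono[of "(amp j)\<^sup>2" "K / \<beta>" "kap j powr (- s) * (norm (bas j))\<^sup>2"] by simp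
  qed
  ultimately show ?thesis
    by (subst nn_integral_suminf[OF sq_term_measurable]) (simp add: suminf_ennreal2 less_top[symmetric])
qed

lemma AE_summable_sq_term: "AE z in gaussian_product. summable (\<lambda>j. sq_term j z)"
proof -
  have "AE z in gaussian_product. (\<Sum>j. ennreal (sq_term j z)) \<noteq> \<infinity>"
    using nn_integral_sq_terms sq_term_measurable by (intro nn_integral_PInf_AE borel_measurable_suminf_order) auto
  then show ?thesis
    by eventually_elim (intro summable_suminf_not_top, auto simp: sq_term_nonneg top_unique)
qed

text \<open>One measurable exceptional set is fixed, so that the limit can be set to 0 on it and
  becomes a measurable map defined everywhere.\<close>

definition null_set :: "(nat \<Rightarrow> real) set" where
  "null_set = (SOME N. N \<in> null_sets gaussian_product \<and> (\<forall>z. z \<notin> N \<longrightarrow> summable (\<lambda>j. sq_term j z)))"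

lemma null_set: "null_set \<in> null_sets gaussian_product" "z \<notin> null_set \<Longrightarrow> summable (\<lambda>j. sq_term j z)"
proof -
  have "\<exists>N. N \<in> null_sets gaussian_product \<and> (\<forall>z. z \<notin> N \<longrightarrow> summable (\<lambda>j. sq_term j z))"
    using AE_summable_sq_term unfolding eventually_ae_filter by auto
  then have "null_set \<in> null_sets gaussian_product \<and> (\<forall>z. z \<notin> null_set \<longrightarrow> summable (\<lambda>j. sq_term j z))"
    unfolding null_set_def by (rule someI_ex)
  then show "null_set \<in> null_sets gaussian_product" "z \<notin> null_set \<Longrightarrow> summable (\<lambda>j. sq_term j z)"
    by auto
qed

definition limit_field :: "(nat \<Rightarrow> real) \<Rightarrow> 'b" where
  "limit_field z = (if z \<in> null_set then 0 else lim (\<lambda>n. \<iota> (field n z)))"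

lemma limit_field_LIMSEQ: "z \<notin> null_set \<Longrightarrow> (\<lambda>n. \<iota> (field n z)) \<longlonglongrightarrow> limit_field z"
proof -
  assume z: "z \<notin> null_set"
  have "convergent (\<lambda>n. \<Sum>j<n. (amp j * z j) *\<^sub>R \<iota> (bas j))"
  proof (rule orthogonal_series_convergent)
    show "summable (\<lambda>j. (norm ((amp j * z j) *\<^sub>R \<iota> (bas j)))\<^sup>2)"
      unfolding norm_term_square by (rule null_set(2)[OF z])
  qed (rule term_orthogonal)
  then show ?thesis
    using z by (simp add: limit_field_def iota_field convergent_LIMSEQ_iff)
qed

lemma AE_not_null_set: "AE z in gaussian_product. z \<notin> null_set"
  using null_set(1) by (rule AE_not_in)

lemma limit_field_measurable [measurable]: "limit_field \<in> gaussian_product \<rightarrow>\<^sub>M borel"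
proof (rule borel_measurable_LIMSEQ_metric)
  have "continuous_on UNIV (\<lambda>z. \<iota> (field n z))" for n
    unfolding iota_field by (intro continuous_intros continuous_on_product_coordinates)
  then have "(\<lambda>z. \<iota> (field n z)) \<in> borel_measurable borel" for n
    by (rule borel_measurable_continuous_onI)
  then have "(\<lambda>z. \<iota> (field n z)) \<in> borel_measurable gaussian_product" for n
    by (simp cong: measurable_cong_sets)
  \<comment> \<open>Sections set to 0 on \<open>null_set\<close> converge at every point, not only
    almost everywhere.\<close>
  then show "(\<lambda>z. if z \<in> null_set then 0 else \<iota> (field n z)) \<in> borel_measurable gaussian_product" for n
    using null_set(1) by (intro measurable_If_set) auto
  show "(\<lambda>n. if z \<in> null_set then 0 else \<iota> (field n z)) \<longlonglongrightarrow> limit_field z" for z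
    using limit_field_LIMSEQ[of z] by (cases "z \<in> null_set") (auto simp: limit_field_def)
qed

definition gauss_measure :: "'b measure" where
  "gauss_measure = distr gaussian_product borel limit_field"

lemma prob_space_gauss_measure: "prob_space gauss_measure"
  unfolding gauss_measure_def by (intro gaussian_product.prob_space_distr limit_field_measurable)

lemma inner_limit_field_LIMSEQ:
  assumes "riesz f v" "z \<notin> null_set"
  shows "(\<lambda>n. inner f (field n z)) \<longlonglongrightarrow> inner v (limit_field z)"
proof -
  have "(\<lambda>n. inner v (\<iota> (field n z))) \<longlonglongrightarrow> inner v (limit_field z)"
    by (intro tendsto_intros limit_field_LIMSEQ assms)
  then show ?thesis
    using assms(1) by (simp add: riesz_def)
qed

text \<open>The coordinates of the sections are eventually constant in \<open>n\<close>. For a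
  padding index the left side is 0, hence the condition on \<open>j\<close>.\<close>

lemma inner_riesz_bas_limit_field:
  assumes "z \<notin> null_set" "j div 2 \<in> I"
  shows "inner (riesz_bas j) (limit_field z) = amp j * z j"
proof (rule LIMSEQ_unique)
  show "(\<lambda>n. inner (bas j) (field n z)) \<longlonglongrightarrow> inner (riesz_bas j) (limit_field z)"
    by (rule inner_limit_field_LIMSEQ[OF riesz_bas assms(1)])
  have "\<forall>\<^sub>F n in sequentially. inner (bas j) (field n z) = amp j * z j"
    using eventually_gt_at_top[of j]
  proof eventually_elim
    case (elim n)
    have "inner (bas j) (field n z) = (\<Sum>i<n. if i = j then amp j * z j else 0)"
      unfolding inner_field using assms(2) by (intro sum.cong) (auto simp: inner_bas)
    then show ?case
      using elim by simp
  qed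
  then show "(\<lambda>n. inner (bas j) (field n z)) \<longlonglongrightarrow> amp j * z j"
    by (rule tendsto_eventually)
qed

text \<open>By \<open>x \<le> 1 + x^2\<close> the norm is dominated by the series of squares, whose
  finite expectation thus gives a first moment.\<close>

lemma integrable_inner_limit_field: "integrable gaussian_product (\<lambda>z. inner v (limit_field z))"
proof (rule integrableI_bounded)
  have "(\<lambda>u. inner v u) \<in> borel_measurable borel"
    by (intro borel_measurable_continuous_onI continuous_intros)
  then show "(\<lambda>z. inner v (limit_field z)) \<in> borel_measurable gaussian_product"
    by (rule measurable_compose[OF limit_field_measurable])
  have bound: "ennreal (norm (inner v (limit_field z))) \<le> ennreal (norm v) * (1 + (\<Sum>j. ennreal (sq_term j z)))"
    if z: "z \<notin> null_set" for z
  proof -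
    let ?S = "\<Sum>j. sq_term j z"
    have "(norm (limit_field z))\<^sup>2 \<le> ?S"
    proof (rule LIMSEQ_le_const2)
      show "(\<lambda>n. (norm (\<iota> (field n z)))\<^sup>2) \<longlonglongrightarrow> (norm (limit_field z))\<^sup>2"
        by (intro tendsto_intros limit_field_LIMSEQ z)
      show "\<exists>N. \<forall>n\<ge>N. (norm (\<iota> (field n z)))\<^sup>2 \<le> ?S"
        unfolding norm_iota_field by (intro exI allI impI sum_le_suminf null_set(2)[OF z]) (auto simp: sq_term_nonneg)
    qed
    moreover have "norm (limit_field z) \<le> 1 + (norm (limit_field z))\<^sup>2"
      using sum_squares_bound[of 1 "norm (limit_field z)"] norm_ge_zero[of "limit_field z"]
      by (simp only: mult_1_right one_power2)
    ultimately have "norm (limit_field z) \<le> 1 + ?S"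
      by linarith
    then have "norm (inner v (limit_field z)) \<le> norm v * (1 + ?S)"
      using order_trans[OF Cauchy_Schwarz_ineq2 mult_left_mono] by simp
    then have "ennreal (norm (inner v (limit_field z))) \<le> ennreal (norm v * (1 + ?S))"
      by (rule ennreal_leI)
    also have "\<dots> = ennreal (norm v) * (1 + ennreal ?S)"
    proof -
      have "?S \<ge> 0"
        by (intro suminf_nonneg null_set(2)[OF z] sq_term_nonneg)
      then show ?thesis
        by (simp add: ennreal_mult ennreal_plus[of 1 ?S])
    qed
    also have "ennreal ?S = (\<Sum>j. ennreal (sq_term j z))"
      by (intro suminf_ennreal2[symmetric] null_set(2) z sq_term_nonneg)
    finally show ?thesis .
  qed
  have "AE z in gaussian_product. ennreal (norm (inner v (limit_field z))) \<le> ennreal (norm v) * (1 + (\<Sum>j. ennreal (sq_term j z)))"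
    using AE_not_null_set by eventually_elim (rule bound)
  then have "(\<integral>\<^sup>+z. ennreal (norm (inner v (limit_field z))) \<partial>gaussian_product) \<le>
      (\<integral>\<^sup>+z. ennreal (norm v) * (1 + (\<Sum>j. ennreal (sq_term j z))) \<partial>gaussian_product)"
    by (rule nn_integral_mono_AE)
  also have "\<dots> = ennreal (norm v) * (1 + (\<integral>\<^sup>+z. (\<Sum>j. ennreal (sq_term j z)) \<partial>gaussian_product))"
  proof -
    have m: "(\<lambda>z. \<Sum>j. ennreal (sq_term j z)) \<in> borel_measurable gaussian_product"
      by (intro borel_measurable_suminf_order sq_term_measurable)
    then have m': "(\<lambda>z. 1 + (\<Sum>j. ennreal (sq_term j z))) \<in> borel_measurable gaussian_product"
      by (intro borel_measurable_add) auto
    show ?thesis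
      unfolding nn_integral_cmult[OF m'] nn_integral_add[OF borel_measurable_const m]
      using gaussian_product.emeasure_space_1 by simp
  qed
  also have "\<dots> < \<infinity>"
    using nn_integral_sq_terms by (simp add: ennreal_mult_less_top)
  finally show "(\<integral>\<^sup>+z. ennreal (norm (inner v (limit_field z))) \<partial>gaussian_product) < \<infinity>" .
qed

text \<open>Dominated convergence compares the measure with the same finite sections that define the
  state.\<close>

lemma fourier_gauss_measure:
  assumes "f \<in> sobolev H I e s"
  shows "fourier \<iota> gauss_measure f = gauss_char f"
proof -
  obtain v where v: "riesz f v"
    using riesz_exists[OF assms] .
  have m: "(\<lambda>u. iexp (inner v u)) \<in> borel_measurable borel"
    by (intro borel_measurable_continuous_onI continuous_intros)
  have "fourier \<iota> gauss_measure f = (LINT z|gaussian_product. iexp (inner v (limit_field z)))"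
    unfolding fourier_def gauss_measure_def riesz_dual_pairing[OF v]
    by (rule integral_distr[OF limit_field_measurable m])
  also have "\<dots> = gauss_char f"
  proof (rule LIMSEQ_unique)
    show "(\<lambda>n. LINT z|gaussian_product. W0 f (field n z)) \<longlonglongrightarrow> complex_of_real (gauss_char f)"
      by (rule W0_field_LIMSEQ)
    show "(\<lambda>n. LINT z|gaussian_product. W0 f (field n z)) \<longlonglongrightarrow> (LINT z|gaussian_product. iexp (inner v (limit_field z)))"
    proof (rule integral_dominated_convergence[where w="\<lambda>z. 1"])
      show "AE z in gaussian_product. (\<lambda>n. W0 f (field n z)) \<longlonglongrightarrow> iexp (inner v (limit_field z))"
        using AE_not_null_set
      proof eventually_elim
        case (elim z)
        from inner_limit_field_LIMSEQ[OF v this] show ?case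
          unfolding W0_def by (intro tendsto_intros)
      qed
      show "(\<lambda>z. iexp (inner v (limit_field z))) \<in> borel_measurable gaussian_product"
        by (rule measurable_compose[OF limit_field_measurable m])
    qed (use integrable_W0_field in auto)
  qed
  finally show ?thesis .
qed

end

section \<open>The KMS condition for the Gaussian measure\<close>

context gaussian_field
begin

lemma Hinv_form_minus_right: "Hinv_form f (- g) = - Hinv_form f g"
  using sums_minus[OF Hinv_form_sums[of f g]] Hinv_form_sums[of f "- g"]
  by (simp add: sums_iff)

lemma weak_kms_state_char:
  assumes PB: "poisson_bracket PB" and A0: "A0 = fun_span (W0 ` D)"
    and \<delta>_W0: "\<And>f. f \<in> D \<Longrightarrow> \<delta> (W0 f) = (\<lambda>u. \<i> * Phi0 (\<i> *\<^sub>C H f) u * W0 f u)"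
    and kms: "weak_kms_state PB A0 \<delta> \<beta> \<omega>" and h: "h \<in> D"
  shows "\<omega> (W0 h) = gauss_char h"
proof -
  interpret weyl_state \<omega>
    using kms by unfold_locales (simp add: weak_kms_state_def)
  have C2: "class_C2 \<omega>"
    using kms by (simp add: weak_kms_state_def)
  obtain \<omega>' where lin: "clinear_functional_on field_span \<omega>'"
    and field: "\<And>f g. \<omega>' (\<lambda>u. Phi0 f u * W0 g u) = field_expectation \<omega> f g"
    and KMS: "\<And>a b. a \<in> A0 \<Longrightarrow> b \<in> A0 \<Longrightarrow> \<omega> (PB a b) = of_real \<beta> * \<omega>' (\<lambda>u. b u * \<delta> a u)"
    using kms unfolding weak_kms_state_def by blast
  \<comment> \<open>Thus \<open>\<i> H f = h\<close>, so the derivation applied to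
    \<open>W0 f\<close> produces the field in direction \<open>h\<close>.\<close>
  obtain f where f: "f \<in> D" "H f = - (\<i> *\<^sub>C h)" and inner_f: "\<And>x. inner x f = Hinv_form x (- (\<i> *\<^sub>C h))"
    using H_surjective[of "- (\<i> *\<^sub>C h)"] by blast
  define S where "S t = \<omega> (W0 (t *\<^sub>R h))" for t :: real
  define c where "c = Hinv_form h h / \<beta>"
  have iHf: "\<i> *\<^sub>C H f = h"
    by (simp add: f(2) scaleC_minus_right)
  have sig: "sigma h f = - Hinv_form h h"
    by (simp add: sigma_eq inner_f Hinv_form_minus_right Hinv_form_i)
  have deriv: "(S has_vector_derivative - (t * c) *\<^sub>R S t) (at t)" for t
  proof -
    \<comment> \<open>\<open>f + g = t h\<close> lies on the line of \<open>h\<close>, and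
      \<open>sigma g f = t * sigma h f\<close> because \<open>sigma f f = 0\<close>.\<close>
    define g where "g = t *\<^sub>R h - f"
    have "g \<in> D"
      unfolding g_def by (intro subspace_diff subspace_scale subspace_D f h)
    then have mem: "W0 f \<in> A0" "W0 g \<in> A0"
      using f(1) unfolding A0 by (auto intro: fun_span_base)
    have "sigma g f = t * sigma h f"
      by (simp add: g_def sigma_eq linear_diff[OF linear_scaleC] linear_cmul[OF linear_scaleC] inner_diff_left inner_i_self)
    then have "\<omega> (PB (W0 f) (W0 g)) = complex_of_real (t * sigma h f) * S t"
      using PB scale[OF W0_in_Weyl_algebra[of "t *\<^sub>R h"]] by (simp add: poisson_bracket_def g_def S_def)
    moreover have "(\<lambda>u. W0 g u * \<delta> (W0 f) u) =
        (\<lambda>u. \<i> * (Phi0 h u * W0 (t *\<^sub>R h) u) + 0 * (Phi0 h u * W0 (t *\<^sub>R h) u))"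
      using W0_add[of f g] by (auto simp: \<delta>_W0[OF f(1)] iHf g_def mult_ac)
    moreover have mem': "(\<lambda>u. Phi0 h u * W0 (t *\<^sub>R h) u) \<in> field_span"
      unfolding field_span_def by (intro fun_span_base) blast
    have "\<omega>' (\<lambda>u. \<i> * (Phi0 h u * W0 (t *\<^sub>R h) u) + 0 * (Phi0 h u * W0 (t *\<^sub>R h) u)) =
        \<i> * field_expectation \<omega> h (t *\<^sub>R h)"
      using lin[unfolded clinear_functional_on_def, rule_format, OF mem' mem', of \<i> 0] by (simp add: field)
    ultimately have "complex_of_real (t * sigma h f) * S t = \<beta> * (\<i> * field_expectation \<omega> h (t *\<^sub>R h))"
      using KMS[OF mem] by simp
    then have fe: "\<i> * field_expectation \<omega> h (t *\<^sub>R h) = - (t * c) *\<^sub>R S t"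
      using \<beta>_pos by (simp add: sig c_def scaleR_conv_of_real field_simps)
    \<comment> \<open>The field expectation is a derivative at 0 of the shifted curve;
      \<open>t - t\<close> has the shape needed for composing with \<open>r - t\<close>.\<close>
    have "((\<lambda>r. S (t + r)) has_vector_derivative - (t * c) *\<^sub>R S t) (at (t - t))"
      using field_expectation_derivative[OF C2, of "t *\<^sub>R h" h] unfolding fe S_def by (simp add: scaleR_add_left)
    from vector_diff_chain_at[where f="\<lambda>r. r - t" and x=t, OF _ this, of 1] show ?thesis
      by (simp add: o_def has_vector_derivative_diff_const)
  qed
  have "S 0 = 1"
    by (simp add: S_def one)
  from gaussian_ode[OF deriv this, of 1] show ?thesis
    by (simp add: S_def c_def gauss_char_def)
qed

end

section \<open>Calculus of test functions\<close>

lemma partial_deriv_upd: "partial_deriv j \<phi> (x(j := t)) = deriv (\<lambda>r. \<phi> (x(j := r))) t"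
  by (simp add: partial_deriv_def)

lemma test_function_cong: "test_function m \<phi> \<Longrightarrow> (\<And>i. i < m \<Longrightarrow> x i = y i) \<Longrightarrow> \<phi> x = \<phi> y"
  unfolding test_function_def by blast

lemma test_function_continuous:
  assumes "test_function m \<phi>"
  shows "continuous_on UNIV \<phi>"
  using assms[unfolded test_function_def, THEN conjunct2, THEN conjunct1, rule_format, of "[]"] by simp

lemma test_function_has_derivative:
  assumes "test_function m \<phi>" "j < m"
  shows "((\<lambda>t. \<phi> (x(j := t))) has_real_derivative partial_deriv j \<phi> (x(j := t))) (at t)"
proof -
  have "\<forall>j<m. \<forall>x. (\<lambda>t. \<phi> (x(j := t))) field_differentiable at (x j)"
    using assms(1)[unfolded test_function_def, THEN conjunct2, THEN conjunct1, rule_format, of "[]", THEN conjunct2] by simp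
  from this[rule_format, OF assms(2), of "x(j := t)"] show ?thesis
    unfolding partial_deriv_upd by (simp add: DERIV_deriv_iff_field_differentiable)
qed

text \<open>Iterated derivatives of a partial derivative are iterated derivatives of
  \<open>\<phi>\<close>. The support does not grow: off the closed support, \<open>\<phi>\<close>
  vanishes on a whole interval in direction \<open>j\<close>.\<close>

lemma test_function_partial_deriv:
  assumes \<phi>: "test_function m \<phi>" and j: "j < m"
  shows "test_function m (partial_deriv j \<phi>)"
  unfolding test_function_def
proof (intro conjI allI impI)
  fix x y :: "nat \<Rightarrow> real" assume eq: "\<forall>i<m. x i = y i"
  then have "\<phi> (x(j := t)) = \<phi> (y(j := t))" for t
    by (intro test_function_cong[OF \<phi>]) auto
  then show "partial_deriv j \<phi> x = partial_deriv j \<phi> y"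
    using eq j by (simp add: partial_deriv_def)
next
  fix js assume "set js \<subseteq> {..<m}"
  \<comment> \<open>\<open>foldr\<close> applies the last entry first, so \<open>j\<close> is
    appended.\<close>
  then have "set (js @ [j]) \<subseteq> {..<m}"
    using j by auto
  from \<phi>[unfolded test_function_def, THEN conjunct2, THEN conjunct1, rule_format, OF this]
  show "continuous_on UNIV (foldr partial_deriv js (partial_deriv j \<phi>))"
    "\<And>i x. i < m \<Longrightarrow> (\<lambda>t. foldr partial_deriv js (partial_deriv j \<phi>) (x(i := t))) field_differentiable at (x i)"
    by auto
next
  let ?S = "{x. (\<forall>i\<ge>m. x i = 0) \<and> \<phi> x \<noteq> 0}"
  have "{x. (\<forall>i\<ge>m. x i = 0) \<and> partial_deriv j \<phi> x \<noteq> 0} \<subseteq> closure ?S"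
  proof (rule subsetI, rule ccontr)
    fix x assume x: "x \<in> {x. (\<forall>i\<ge>m. x i = 0) \<and> partial_deriv j \<phi> x \<noteq> 0}" and "x \<notin> closure ?S"
    have "open ((\<lambda>t. x(j := t)) -` (- closure ?S))"
      by (intro open_vimage continuous_on_fun_upd) auto
    moreover have "x j \<in> (\<lambda>t. x(j := t)) -` (- closure ?S)"
      using \<open>x \<notin> closure ?S\<close> by simp
    ultimately have "\<forall>\<^sub>F t in nhds (x j). t \<in> (\<lambda>t. x(j := t)) -` (- closure ?S)"
      by (rule eventually_nhds_in_open)
    then have "\<forall>\<^sub>F t in nhds (x j). \<phi> (x(j := t)) = 0"
    proof eventually_elim
      case (elim t)
      then have "x(j := t) \<notin> closure ?S"
        by simp
      then have "x(j := t) \<notin> ?S"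
        by (rule contra_subsetD[OF closure_subset])
      then show ?case
        using x j by auto
    qed
    then have "deriv (\<lambda>t. \<phi> (x(j := t))) (x j) = deriv (\<lambda>t. 0) (x j)"
      by (intro deriv_cong_ev) auto
    then show False
      using x by (simp add: partial_deriv_def)
  qed
  then have "closure {x. (\<forall>i\<ge>m. x i = 0) \<and> partial_deriv j \<phi> x \<noteq> 0} \<subseteq> closure ?S"
    by (intro closure_minimal) auto
  moreover have "compact (closure ?S)"
    using \<phi> unfolding test_function_def by blast
  moreover from this have "compact (closure {x. (\<forall>i\<ge>m. x i = 0) \<and> partial_deriv j \<phi> x \<noteq> 0} \<inter> closure ?S)"
    by (rule closed_Int_compact[OF closed_closure])
  ultimately show "compact (closure {x. (\<forall>i\<ge>m. x i = 0) \<and> partial_deriv j \<phi> x \<noteq> 0})"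
    by (simp only: Int_absorb2)
qed

lemma test_function_bounded:
  assumes "test_function m \<phi>"
  obtains B where "\<And>x. \<bar>\<phi> x\<bar> \<le> B"
proof -
  let ?S = "{x. (\<forall>i\<ge>m. x i = 0) \<and> \<phi> x \<noteq> 0}"
  have "compact (\<phi> ` closure ?S)"
    using assms unfolding test_function_def
    by (intro compact_continuous_image continuous_on_subset[OF test_function_continuous[OF assms]]) auto
  then have "bounded (\<phi> ` closure ?S)"
    by (rule compact_imp_bounded)
  then obtain B where B: "\<And>y. y \<in> \<phi> ` closure ?S \<Longrightarrow> norm y \<le> B"
    unfolding bounded_iff by blast
  have "\<bar>\<phi> x\<bar> \<le> \<bar>B\<bar>" for x
  proof (cases "\<phi> x = 0")
    case False
    \<comment> \<open>Compactness concerns only points vanishing from \<open>m\<close> on;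
      \<open>\<phi>\<close> does not see the other coordinates, so the point is truncated.\<close>
    define x' where "x' = (\<lambda>i. if i < m then x i else 0)"
    have "\<phi> x' = \<phi> x"
      by (intro test_function_cong[OF assms]) (simp add: x'_def)
    moreover from this False have "x' \<in> ?S"
      by (auto simp: x'_def)
    then have "\<phi> x' \<in> \<phi> ` closure ?S"
      by (intro imageI subsetD[OF closure_subset])
    ultimately show ?thesis
      using B[of "\<phi> x'"] by simp
  qed simp
  then show ?thesis
    by (rule that)
qed

text \<open>Schwarz's theorem. The mean value theorem, applied twice to the second difference over a
  square of side \<open>h\<close> in either order, gives a point for each mixed derivative at which
  the two values agree; both points tend to \<open>(a, b)\<close> as \<open>h\<close>
  shrinks.\<close>

lemma mixed_partials_eq:
  fixes f A B AB BA :: "real \<Rightarrow> real \<Rightarrow> real"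
  assumes A: "\<And>x y. ((\<lambda>x. f x y) has_real_derivative A x y) (at x)"
    and B: "\<And>x y. ((\<lambda>y. f x y) has_real_derivative B x y) (at y)"
    and AB: "\<And>x y. ((\<lambda>y. A x y) has_real_derivative AB x y) (at y)"
    and BA: "\<And>x y. ((\<lambda>x. B x y) has_real_derivative BA x y) (at x)"
    and cont: "continuous_on UNIV (\<lambda>(x, y). AB x y)" "continuous_on UNIV (\<lambda>(x, y). BA x y)"
  shows "AB a b = BA a b"
proof -
  have ex: "\<exists>p q. dist p (a, b) \<le> 2 * h \<and> dist q (a, b) \<le> 2 * h \<and>
      (\<lambda>(x, y). AB x y) p = (\<lambda>(x, y). BA x y) q" if "h > 0" for h
  proof -
    have near: "dist (x, y) (a, b) \<le> 2 * h" if "a < x" "x < a + h" "b < y" "y < b + h" for x y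
    proof -
      have "dist (x, y) (a, b) \<le> dist x a + dist y b"
        unfolding dist_prod_def by (simp add: sqrt_sum_squares_le_sum)
      then show ?thesis
        using that by (simp add: dist_real_def)
    qed
    let ?\<Delta> = "f (a + h) (b + h) - f (a + h) b - (f a (b + h) - f a b)"
    have "\<exists>x. a < x \<and> x < a + h \<and> (f (a + h) (b + h) - f (a + h) b) - (f a (b + h) - f a b) = (a + h - a) * (A x (b + h) - A x b)"
      by (rule MVT2) (use \<open>h > 0\<close> A in \<open>auto intro!: derivative_intros\<close>)
    then obtain x where x: "a < x" "x < a + h" "?\<Delta> = h * (A x (b + h) - A x b)"
      by auto
    have "\<exists>y. b < y \<and> y < b + h \<and> A x (b + h) - A x b = (b + h - b) * AB x y"
      by (rule MVT2) (use \<open>h > 0\<close> AB in auto)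
    then obtain y where y: "b < y" "y < b + h" "A x (b + h) - A x b = h * AB x y"
      by auto
    have "\<exists>y. b < y \<and> y < b + h \<and> (f (a + h) (b + h) - f a (b + h)) - (f (a + h) b - f a b) = (b + h - b) * (B (a + h) y - B a y)"
      by (rule MVT2) (use \<open>h > 0\<close> B in \<open>auto intro!: derivative_intros\<close>)
    then obtain y' where y': "b < y'" "y' < b + h" "?\<Delta> = h * (B (a + h) y' - B a y')"
      by auto
    have "\<exists>x. a < x \<and> x < a + h \<and> B (a + h) y' - B a y' = (a + h - a) * BA x y'"
      by (rule MVT2) (use \<open>h > 0\<close> BA in auto)
    then obtain x' where x': "a < x'" "x' < a + h" "B (a + h) y' - B a y' = h * BA x' y'"
      by auto
    have "AB x y = BA x' y'"
      using x(3) y(3) y'(3) x'(3) \<open>h > 0\<close> by simp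
    then show ?thesis
      using near[OF x(1,2) y(1,2)] near[OF x'(1,2) y'(1,2)]
      by (intro exI[of _ "(x, y)"] exI[of _ "(x', y')"]) auto
  qed
  have "\<exists>p q. dist p (a, b) \<le> 2 * inverse (real (Suc n)) \<and> dist q (a, b) \<le> 2 * inverse (real (Suc n)) \<and>
      (\<lambda>(x, y). AB x y) p = (\<lambda>(x, y). BA x y) q" for n
    by (rule ex) simp
  then obtain p q where pq: "\<And>n. dist (p n) (a, b) \<le> 2 * inverse (real (Suc n))"
    "\<And>n. dist (q n) (a, b) \<le> 2 * inverse (real (Suc n))"
    "\<And>n. (\<lambda>(x, y). AB x y) (p n) = (\<lambda>(x, y). BA x y) (q n)"
    by metis
  have null: "(\<lambda>n. 2 * inverse (real (Suc n))) \<longlonglongrightarrow> 0"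
    using tendsto_mult_right_zero[OF LIMSEQ_inverse_real_of_nat] .
  have conv: "r \<longlonglongrightarrow> (a, b)" if "\<And>n. dist (r n) (a, b) \<le> 2 * inverse (real (Suc n))" for r
    by (rule metric_tendsto_imp_tendsto[OF null]) (use that in \<open>auto simp: dist_real_def\<close>)
  have "(\<lambda>n. (\<lambda>(x, y). AB x y) (p n)) \<longlonglongrightarrow> (\<lambda>(x, y). AB x y) (a, b)"
    by (rule continuous_on_tendsto_compose[OF cont(1) conv[OF pq(1)]]) auto
  moreover have "(\<lambda>n. (\<lambda>(x, y). AB x y) (p n)) \<longlonglongrightarrow> (\<lambda>(x, y). BA x y) (a, b)"
    unfolding pq(3) by (rule continuous_on_tendsto_compose[OF cont(2) conv[OF pq(2)]]) auto
  ultimately show ?thesis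
    using LIMSEQ_unique by force
qed

lemma test_function_mixed_partials:
  assumes \<phi>: "test_function m \<phi>" and ij: "i < m" "j < m" "i \<noteq> j"
  shows "partial_deriv j (partial_deriv i \<phi>) x = partial_deriv i (partial_deriv j \<phi>) x"
proof -
  define u where "u a b = x(i := a, j := b)" for a b
  have swap: "u a b = x(j := b, i := a)" for a b
    unfolding u_def using ij(3) by (rule fun_upd_twist)
  have cu: "continuous_on UNIV (\<lambda>(a, b). u a b)"
  proof (intro continuous_on_coordinatewise_then_product)
    show "continuous_on UNIV (\<lambda>p. (case p of (a, b) \<Rightarrow> u a b) k)" for k
      by (cases "k = i"; cases "k = j") (auto simp: u_def case_prod_unfold intro!: continuous_intros)
  qed
  have cont: "continuous_on UNIV (\<lambda>(a, b). \<psi> (u a b))" if "test_function m \<psi>" for \<psi>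
    using continuous_on_compose2[OF test_function_continuous[OF that] cu] by (simp add: case_prod_unfold)
  have "partial_deriv j (partial_deriv i \<phi>) (u (x i) (x j)) = partial_deriv i (partial_deriv j \<phi>) (u (x i) (x j))"
  proof (rule mixed_partials_eq[where f="\<lambda>a b. \<phi> (u a b)" and A="\<lambda>a b. partial_deriv i \<phi> (u a b)" and B="\<lambda>a b. partial_deriv j \<phi> (u a b)"
        and AB="\<lambda>a b. partial_deriv j (partial_deriv i \<phi>) (u a b)" and BA="\<lambda>a b. partial_deriv i (partial_deriv j \<phi>) (u a b)"])
    show "((\<lambda>a. \<phi> (u a b)) has_real_derivative partial_deriv i \<phi> (u a b)) (at a)" for a b
      unfolding swap by (rule test_function_has_derivative[OF \<phi> ij(1)])
    show "((\<lambda>a. partial_deriv j \<phi> (u a b)) has_real_derivative partial_deriv i (partial_deriv j \<phi>) (u a b)) (at a)" for a b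
      unfolding swap by (rule test_function_has_derivative[OF test_function_partial_deriv[OF \<phi> ij(2)] ij(1)])
    show "((\<lambda>b. \<phi> (u a b)) has_real_derivative partial_deriv j \<phi> (u a b)) (at b)" for a b
      unfolding u_def by (rule test_function_has_derivative[OF \<phi> ij(2)])
    show "((\<lambda>b. partial_deriv i \<phi> (u a b)) has_real_derivative partial_deriv j (partial_deriv i \<phi>) (u a b)) (at b)" for a b
      unfolding u_def by (rule test_function_has_derivative[OF test_function_partial_deriv[OF \<phi> ij(1)] ij(2)])
  qed (intro cont test_function_partial_deriv \<phi> ij)+
  then show ?thesis
    by (simp add: u_def)
qed

section \<open>Cylindrical functions in real coordinates\<close>

context negative_sobolev
begin

lemma bas_e: "k \<in> I \<Longrightarrow> e k = bas (2 * k)" "k \<in> I \<Longrightarrow> \<i> *\<^sub>C e k = bas (Suc (2 * k))"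
  by (simp_all add: bas_def)

definition coord :: "nat \<Rightarrow> 'b \<Rightarrow> real" where
  "coord j u = inner (riesz_bas j) u"

lemma continuous_coord: "continuous_on UNIV (coord j)"
  unfolding coord_def by (intro continuous_intros)

text \<open>The dictionary between two orders: \<open>cyl_proj\<close> lists all
  \<open>e\<close>-coordinates and then all \<open>\<i> e\<close>-coordinates, whereas
  \<open>bas\<close> interleaves them.\<close>

lemma cyl_proj_eq:
  assumes "{..<n} \<subseteq> I"
  shows "cyl_proj e \<iota> n u = (\<lambda>i. if i < n then coord (2 * i) u else if i < 2 * n then coord (Suc (2 * (i - n))) u else 0)"
proof
  fix i
  have *: "dual_pairing \<iota> (e k) = inner (riesz_bas (2 * k))" "dual_pairing \<iota> (\<i> *\<^sub>C e k) = inner (riesz_bas (Suc (2 * k)))"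
    if "k < n" for k
    using assms that by (auto simp: bas_e i_bas dual_pairing_bas)
  have "i - n < n" if "i < 2 * n" "\<not> i < n"
    using that by linarith
  then show "cyl_proj e \<iota> n u i = (if i < n then coord (2 * i) u else if i < 2 * n then coord (Suc (2 * (i - n))) u else 0)"
    by (auto simp: cyl_proj_def coord_def *)
qed

lemma continuous_cyl_proj:
  assumes "{..<n} \<subseteq> I"
  shows "continuous_on UNIV (cyl_proj e \<iota> n)"
proof (rule continuous_on_coordinatewise_then_product)
  fix i
  have "continuous_on UNIV (\<lambda>u. if i < n then coord (2 * i) u else if i < 2 * n then coord (Suc (2 * (i - n))) u else 0)"
    by (cases "i < n"; cases "i < 2 * n") (simp_all add: continuous_coord)
  then show "continuous_on UNIV (\<lambda>u. cyl_proj e \<iota> n u i)"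
    using assms by (simp add: cyl_proj_eq)
qed

lemma continuous_cylindrical:
  assumes "{..<n} \<subseteq> I" "continuous_on UNIV \<phi>"
  shows "continuous_on UNIV (\<lambda>u. \<phi> (cyl_proj e \<iota> n u))"
  by (rule continuous_on_compose2[OF assms(2) continuous_cyl_proj[OF assms(1)]]) simp

lemma cyl_gradient_eq:
  assumes "{..<n} \<subseteq> I"
  shows "cyl_gradient e \<iota> n \<phi> u =
    (\<Sum>j<n. partial_deriv j \<phi> (cyl_proj e \<iota> n u) *\<^sub>R bas (2 * j)
          + partial_deriv (n + j) \<phi> (cyl_proj e \<iota> n u) *\<^sub>R bas (Suc (2 * j)))"
  unfolding cyl_gradient_def using assms by (intro sum.cong) (auto simp: bas_e i_bas)

lemma inner_bas_e: "k \<in> I \<Longrightarrow> inner (bas i) (bas (2 * k)) = of_bool (i = 2 * k)"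
  "k \<in> I \<Longrightarrow> inner (bas i) (bas (Suc (2 * k))) = of_bool (i = Suc (2 * k))"
  by (auto simp: inner_bas)

text \<open>Multiplication by \<open>\<i>\<close> rotates the two vectors of each mode, so only
  modes common to both gradients survive. The conjugate coordinate is \<open>n + j\<close> on one
  side and \<open>m + j\<close> on the other, as \<open>n\<close> and \<open>m\<close> may
  differ.\<close>

lemma sigma_cyl_gradient:
  assumes "{..<n} \<subseteq> I" "{..<m} \<subseteq> I"
  shows "sigma (cyl_gradient e \<iota> n \<phi> u) (cyl_gradient e \<iota> m \<psi> u) =
    (\<Sum>j<n. if j < m then partial_deriv j \<phi> (cyl_proj e \<iota> n u) * partial_deriv (m + j) \<psi> (cyl_proj e \<iota> m u)
      - partial_deriv (n + j) \<phi> (cyl_proj e \<iota> n u) * partial_deriv j \<psi> (cyl_proj e \<iota> m u) else 0)"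
proof -
  define a where "a j = partial_deriv j \<phi> (cyl_proj e \<iota> n u)" for j
  define c where "c j = partial_deriv j \<psi> (cyl_proj e \<iota> m u)" for j
  have "sigma (cyl_gradient e \<iota> n \<phi> u) (cyl_gradient e \<iota> m \<psi> u) =
      (\<Sum>j<n. \<Sum>k<m. inner (a j *\<^sub>R bas (Suc (2 * j)) - a (n + j) *\<^sub>R bas (2 * j)) (c k *\<^sub>R bas (2 * k) + c (m + k) *\<^sub>R bas (Suc (2 * k))))"
    unfolding cyl_gradient_eq[OF assms(1)] cyl_gradient_eq[OF assms(2)] a_def c_def sigma_eq
      linear_sum[OF linear_scaleC] inner_sum_left inner_sum_right linear_add[OF linear_scaleC] linear_cmul[OF linear_scaleC] i_bas
    by simp (rule sum.swap)
  also have "\<dots> = (\<Sum>j<n. \<Sum>k<m. if k = j then a j * c (m + j) - a (n + j) * c j else 0)"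
  proof (intro sum.cong refl)
    fix j k assume "j \<in> {..<n}" "k \<in> {..<m}"
    then have "k \<in> I" "j \<in> I"
      using assms by auto
    then show "inner (a j *\<^sub>R bas (Suc (2 * j)) - a (n + j) *\<^sub>R bas (2 * j)) (c k *\<^sub>R bas (2 * k) + c (m + k) *\<^sub>R bas (Suc (2 * k))) =
        (if k = j then a j * c (m + j) - a (n + j) * c j else 0)"
      by (auto simp: inner_diff_left inner_add_right inner_bas_e)
  qed
  also have "\<dots> = (\<Sum>j<n. if j < m then a j * c (m + j) - a (n + j) * c j else 0)"
    by (intro sum.cong) auto
  finally show ?thesis
    unfolding a_def c_def .
qed

text \<open>On the finitely many modes of the gradient, \<open>H\<close> scales mode
  \<open>j\<close> by \<open>lam j\<close> and \<open>\<i>\<close> rotates it, which produces the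
  minus sign.\<close>

lemma field_iH_cyl_gradient:
  assumes "{..<n} \<subseteq> I"
  shows "field_iH H \<iota> (cyl_gradient e \<iota> n \<phi> u) w =
    (\<Sum>j<n. lam j * (partial_deriv j \<phi> (cyl_proj e \<iota> n u) * coord (Suc (2 * j)) w
      - partial_deriv (n + j) \<phi> (cyl_proj e \<iota> n u) * coord (2 * j) w))"
proof -
  define a where "a j = partial_deriv j \<phi> (cyl_proj e \<iota> n u)" for j
  define g where "g j = a j *\<^sub>R bas (2 * j) + a (n + j) *\<^sub>R bas (Suc (2 * j))" for j
  have gD: "g j \<in> D" for j
    unfolding g_def by (intro subspace_add subspace_scale subspace_D bas_in_D)
  have Hg: "H (g j) = lam j *\<^sub>R g j" for j
    unfolding g_def
    by (simp add: H_add H_scaleR subspace_scale subspace_D bas_in_D H_bas kap_def scaleR_add_right mult.commute)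
  have HG: "(\<Sum>j<k. g j) \<in> D \<and> H (\<Sum>j<k. g j) = (\<Sum>j<k. lam j *\<^sub>R g j)" for k
  proof (induction k)
    case 0
    show ?case
      using H_scaleR[of 0 0] subspace_0[OF subspace_D] by simp
  next
    case (Suc k)
    then show ?case
      using gD by (simp add: H_add Hg subspace_add[OF subspace_D])
  qed
  have grad: "cyl_gradient e \<iota> n \<phi> u = (\<Sum>j<n. g j)"
    unfolding cyl_gradient_eq[OF assms] g_def a_def by simp
  have ig: "\<i> *\<^sub>C g j = a j *\<^sub>R bas (Suc (2 * j)) + (- a (n + j)) *\<^sub>R bas (2 * j)" for j
    unfolding g_def by (simp add: linear_add[OF linear_scaleC] linear_cmul[OF linear_scaleC] i_bas)
  have iH: "\<i> *\<^sub>C H (cyl_gradient e \<iota> n \<phi> u) =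
      (\<Sum>j<n. lam j *\<^sub>R (a j *\<^sub>R bas (Suc (2 * j)) + (- a (n + j)) *\<^sub>R bas (2 * j)))"
    unfolding grad HG[THEN conjunct2] linear_sum[OF linear_scaleC] linear_cmul[OF linear_scaleC] ig ..
  have "riesz (\<i> *\<^sub>C H (cyl_gradient e \<iota> n \<phi> u))
      (\<Sum>j<n. lam j *\<^sub>R (a j *\<^sub>R riesz_bas (Suc (2 * j)) + (- a (n + j)) *\<^sub>R riesz_bas (2 * j)))"
    unfolding iH by (intro riesz_sum riesz_scaleR riesz_lincomb riesz_bas)
  from riesz_dual_pairing[OF this] show ?thesis
    unfolding field_iH_def by (simp add: inner_sum_left inner_add_left inner_diff_left coord_def a_def)
qed

end

lemma integrable_bounded_continuous:
  fixes g :: "(nat \<Rightarrow> real) \<Rightarrow> real"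
  assumes cont: "continuous_on UNIV g" and B: "\<And>z. \<bar>g z\<bar> \<le> B"
  shows "integrable gaussian_product g" and "integrable gaussian_product (\<lambda>z. z k * g z)"
proof -
  have meas: "g \<in> borel_measurable gaussian_product" if "continuous_on UNIV g" for g :: "(nat \<Rightarrow> real) \<Rightarrow> real"
    using borel_measurable_continuous_onI[OF that] by (simp cong: measurable_cong_sets)
  show "integrable gaussian_product g"
    by (rule gaussian_product.integrable_const_bound[where B=B]) (use B in \<open>auto intro: meas cont\<close>)
  show "integrable gaussian_product (\<lambda>z. z k * g z)"
  proof (rule Bochner_Integration.integrable_bound)
    show "integrable gaussian_product (\<lambda>z. z k * B)"
      using integrable_component_power[of k 1] by simp
    show "(\<lambda>z. z k * g z) \<in> borel_measurable gaussian_product"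
      by (intro meas continuous_intros continuous_on_product_coordinates cont)
    have "norm (z k * g z) \<le> norm (z k * B)" for z
      unfolding norm_mult[of "z k"] using B[of z] by (intro mult_left_mono) auto
    then show "AE z in gaussian_product. norm (z k * g z) \<le> norm (z k * B)"
      by simp
  qed
qed

section \<open>The Gaussian measure tested mode by mode\<close>

context gaussian_sobolev
begin

lemma integral_gauss_measure:
  fixes f :: "'b \<Rightarrow> real"
  assumes "continuous_on UNIV f"
  shows "(LINT u|gauss_measure. f u) = (LINT z|gaussian_product. f (limit_field z))"
  unfolding gauss_measure_def
  by (rule integral_distr[OF limit_field_measurable borel_measurable_continuous_onI[OF assms]])

lemma integral_gauss_measure_eq:
  fixes f :: "'b \<Rightarrow> real"
  assumes f: "continuous_on UNIV f" and g: "integrable gaussian_product g"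
    and eq: "\<And>z. z \<notin> null_set \<Longrightarrow> f (limit_field z) = g z"
  shows "(LINT u|gauss_measure. f u) = (LINT z|gaussian_product. g z)"
proof -
  have "(\<lambda>z. f (limit_field z)) \<in> borel_measurable gaussian_product"
    by (rule measurable_compose[OF limit_field_measurable borel_measurable_continuous_onI[OF f]])
  moreover have "AE z in gaussian_product. f (limit_field z) = g z"
    using AE_not_null_set by eventually_elim (rule eq)
  ultimately show ?thesis
    unfolding integral_gauss_measure[OF f] using g by (intro integral_cong_AE) auto
qed

text \<open>\<^const>\<open>cyl_proj\<close> along \<^term>\<open>limit_field\<close>, as a function of the independent standard normal variables.\<close>

definition zcoord :: "nat \<Rightarrow> (nat \<Rightarrow> real) \<Rightarrow> nat \<Rightarrow> real" where
  "zcoord n z = (\<lambda>i. if i < n then amp (2 * i) * z (2 * i)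
     else if i < 2 * n then amp (Suc (2 * (i - n))) * z (Suc (2 * (i - n))) else 0)"

lemma coord_limit_field: "z \<notin> null_set \<Longrightarrow> j div 2 \<in> I \<Longrightarrow> coord j (limit_field z) = amp j * z j"
  unfolding coord_def by (rule inner_riesz_bas_limit_field)

lemma cyl_proj_limit_field:
  assumes "{..<n} \<subseteq> I" "z \<notin> null_set"
  shows "cyl_proj e \<iota> n (limit_field z) = zcoord n z"
proof
  fix i
  have "i - n < n" if "i < 2 * n" "\<not> i < n"
    using that by linarith
  then show "cyl_proj e \<iota> n (limit_field z) i = zcoord n z i"
    unfolding cyl_proj_eq[OF assms(1)] zcoord_def
    using assms(1) by (auto intro!: coord_limit_field[OF assms(2)])
qed

lemma continuous_zcoord: "continuous_on UNIV (zcoord n)"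
proof (rule continuous_on_coordinatewise_then_product)
  fix i
  show "continuous_on UNIV (\<lambda>z. zcoord n z i)"
    by (cases "i < n"; cases "i < 2 * n")
       (simp_all add: zcoord_def continuous_intros continuous_on_product_coordinates)
qed

lemma continuous_zcoord_compose: "continuous_on UNIV \<phi> \<Longrightarrow> continuous_on UNIV (\<lambda>z. \<phi> (zcoord n z))"
  by (rule continuous_on_compose2[OF _ continuous_zcoord]) auto

lemma zcoord_upd_even: "zcoord n (z(2 * k := t)) = (if k < n then (zcoord n z)(k := amp (2 * k) * t) else zcoord n z)"
  by (rule ext) (auto simp: zcoord_def Suc_double_not_eq_double double_not_eq_Suc_double)

lemma zcoord_upd_odd:
  "zcoord n (z(Suc (2 * k) := t)) = (if k < n then (zcoord n z)(n + k := amp (Suc (2 * k)) * t) else zcoord n z)"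
  by (rule ext) (auto simp: zcoord_def Suc_double_not_eq_double double_not_eq_Suc_double)

lemma zcoord_derivative_even:
  assumes "test_function (2 * n) \<phi>"
  shows "((\<lambda>t. \<phi> (zcoord n (z(2 * k := t)))) has_real_derivative
    (if k < n then amp (2 * k) * partial_deriv k \<phi> (zcoord n (z(2 * k := t))) else 0)) (at t)"
proof (cases "k < n")
  case True
  then have "((\<lambda>t. \<phi> ((zcoord n z)(k := t))) has_real_derivative partial_deriv k \<phi> ((zcoord n z)(k := amp (2 * k) * t))) (at (amp (2 * k) * t))"
    by (intro test_function_has_derivative[OF assms]) simp
  from DERIV_chain2[where f="\<lambda>t. \<phi> ((zcoord n z)(k := t))" and g="\<lambda>t. amp (2 * k) * t", OF this DERIV_cmult_Id] True show ?thesis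
    by (simp add: zcoord_upd_even mult.commute[of _ "amp (2 * k)"])
qed (simp add: zcoord_upd_even)

lemma zcoord_derivative_odd:
  assumes "test_function (2 * n) \<phi>"
  shows "((\<lambda>t. \<phi> (zcoord n (z(Suc (2 * k) := t)))) has_real_derivative
    (if k < n then amp (Suc (2 * k)) * partial_deriv (n + k) \<phi> (zcoord n (z(Suc (2 * k) := t))) else 0)) (at t)"
proof (cases "k < n")
  case True
  then have "((\<lambda>t. \<phi> ((zcoord n z)(n + k := t))) has_real_derivative partial_deriv (n + k) \<phi> ((zcoord n z)(n + k := amp (Suc (2 * k)) * t))) (at (amp (Suc (2 * k)) * t))"
    by (intro test_function_has_derivative[OF assms]) simp
  from DERIV_chain2[where f="\<lambda>t. \<phi> ((zcoord n z)(n + k := t))" and g="\<lambda>t. amp (Suc (2 * k)) * t", OF this DERIV_cmult_Id] True show ?thesis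
    by (simp add: zcoord_upd_odd mult.commute[of _ "amp (Suc (2 * k))"])
qed (simp add: zcoord_upd_odd)

lemma amp_odd: "amp (Suc (2 * k)) = amp (2 * k)"
  by (simp add: amp_def kap_def)

text \<open>The contribution of one mode. Integrating the two terms on the right by parts in the two
  variables of the mode yields the mixed second derivative of \<open>\<phi>\<close> twice with
  opposite signs, and only the bracket remains. If \<open>j \<ge> m\<close>, then
  \<open>\<psi>\<close> does not see the mode and both sides vanish.\<close>

lemma gauss_kms_identity:
  assumes \<phi>: "test_function (2 * n) \<phi>" and \<psi>: "test_function (2 * m) \<psi>" and j: "j < n"
  shows "(LINT z|gaussian_product. (if j < m then partial_deriv j \<phi> (zcoord n z) * partial_deriv (m + j) \<psi> (zcoord m z)
      - partial_deriv (n + j) \<phi> (zcoord n z) * partial_deriv j \<psi> (zcoord m z) else 0)) =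
    \<beta> * lam j * amp (2 * j) * (LINT z|gaussian_product.
      (partial_deriv j \<phi> (zcoord n z) * z (Suc (2 * j)) - partial_deriv (n + j) \<phi> (zcoord n z) * z (2 * j)) * \<psi> (zcoord m z))"
proof -
  define a where "a = amp (2 * j)"
  have a_pos: "a > 0"
    by (simp add: a_def amp_pos)
  have "\<beta> * lam j * a\<^sup>2 = 1"
    using \<beta>_pos kap_pos[of "2 * j"] unfolding a_def amp_square by (simp add: kap_def)
  \<comment> \<open>The variance is \<open>a^2 = 1 / (\<beta> * lam j)\<close>, so the prefactor
    cancels the \<open>a\<close> that the chain rule produces.\<close>
  then have coef: "\<beta> * lam j * a = 1 / a"
    using a_pos by (simp add: power2_eq_square field_simps)
  let ?F = "\<lambda>z. partial_deriv j \<phi> (zcoord n z)" and ?F' = "\<lambda>z. partial_deriv (n + j) \<phi> (zcoord n z)"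
  let ?F2 = "\<lambda>z. partial_deriv (n + j) (partial_deriv j \<phi>) (zcoord n z)"
  let ?P = "\<lambda>z. \<psi> (zcoord m z)"
  let ?Px = "\<lambda>z. if j < m then partial_deriv j \<psi> (zcoord m z) else 0"
  let ?Py = "\<lambda>z. if j < m then partial_deriv (m + j) \<psi> (zcoord m z) else 0"
  have tf: "test_function (2 * n) (partial_deriv j \<phi>)" "test_function (2 * n) (partial_deriv (n + j) \<phi>)"
    "test_function (2 * n) (partial_deriv (n + j) (partial_deriv j \<phi>))"
    using j by (auto intro!: test_function_partial_deriv \<phi>)
  have tg: "j < m \<Longrightarrow> test_function (2 * m) (partial_deriv j \<psi>)" "j < m \<Longrightarrow> test_function (2 * m) (partial_deriv (m + j) \<psi>)"
    by (auto intro!: test_function_partial_deriv \<psi>)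
  have cb: "continuous_on UNIV (\<lambda>z. \<eta> (zcoord l z)) \<and> (\<exists>B. \<forall>z. \<bar>\<eta> (zcoord l z)\<bar> \<le> B)" if "test_function k \<eta>" for k l \<eta>
    using continuous_zcoord_compose[OF test_function_continuous[OF that]] test_function_bounded[OF that] by metis
  have cb_if: "continuous_on UNIV (\<lambda>z. if j < m then \<eta> (zcoord m z) else 0) \<and>
      (\<exists>B. \<forall>z. abs (if j < m then \<eta> (zcoord m z) else 0) \<le> B)"
    if "j < m \<Longrightarrow> test_function (2 * m) \<eta>" for \<eta>
    using cb[OF that] by (cases "j < m") auto
  obtain B where B: "\<And>z. \<bar>?F z\<bar> \<le> B" "\<And>z. \<bar>?F' z\<bar> \<le> B" "\<And>z. \<bar>?F2 z\<bar> \<le> B"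
      "\<And>z. \<bar>?P z\<bar> \<le> B" "\<And>z. \<bar>?Px z\<bar> \<le> B" "\<And>z. \<bar>?Py z\<bar> \<le> B"
  proof -
    obtain B1 B2 B3 B4 B5 B6 where "\<forall>z. \<bar>?F z\<bar> \<le> B1" "\<forall>z. \<bar>?F' z\<bar> \<le> B2" "\<forall>z. \<bar>?F2 z\<bar> \<le> B3"
      "\<forall>z. \<bar>?P z\<bar> \<le> B4" "\<forall>z. \<bar>?Px z\<bar> \<le> B5" "\<forall>z. \<bar>?Py z\<bar> \<le> B6"
      using cb[OF tf(1)] cb[OF tf(2)] cb[OF tf(3)] cb[OF \<psi>] cb_if[OF tg(1)] cb_if[OF tg(2)] by metis
    then show ?thesis
      by (intro that[of "max B1 (max B2 (max B3 (max B4 (max B5 B6))))"]) (auto simp: le_max_iff_disj)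
  qed
  have c: "continuous_on UNIV ?F" "continuous_on UNIV ?F'" "continuous_on UNIV ?F2" "continuous_on UNIV ?P"
    "continuous_on UNIV ?Px" "continuous_on UNIV ?Py"
    using cb[OF tf(1)] cb[OF tf(2)] cb[OF tf(3)] cb[OF \<psi>] cb_if[OF tg(1)] cb_if[OF tg(2)] by auto
  have "B \<ge> 0"
    using B(1)[of "\<lambda>_. 0"] by simp
  have prod_le: "\<bar>x * y\<bar> \<le> B * B" if "\<bar>x\<bar> \<le> B" "\<bar>y\<bar> \<le> B" for x y
    using that \<open>B \<ge> 0\<close> by (auto simp: abs_mult intro!: mult_mono)
  \<comment> \<open>One constant for the products and for their derivatives, as integration by parts
    asks for a common bound.\<close>
  define C where "C = B * B + a * (B * B + B * B)"
  have bound1: "\<bar>x * y\<bar> \<le> C" if "\<bar>x\<bar> \<le> B" "\<bar>y\<bar> \<le> B" for x y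
    using prod_le[OF that] a_pos \<open>B \<ge> 0\<close> by (simp add: C_def add_increasing2)
  have bound2: "\<bar>a * (x * y + v * w)\<bar> \<le> C" if "\<bar>x\<bar> \<le> B" "\<bar>y\<bar> \<le> B" "\<bar>v\<bar> \<le> B" "\<bar>w\<bar> \<le> B" for x y v w
  proof -
    have "\<bar>a * (x * y + v * w)\<bar> = a * \<bar>x * y + v * w\<bar>"
      using a_pos by (simp add: abs_mult)
    also have "\<dots> \<le> a * (B * B + B * B)"
      using a_pos prod_le[OF that(1,2)] prod_le[OF that(3,4)]
      by (intro mult_left_mono order_trans[OF abs_triangle_ineq]) auto
    finally show ?thesis
      using \<open>B \<ge> 0\<close> by (simp add: C_def add_increasing)
  qed
  have ibp_y: "(LINT z|gaussian_product. z (Suc (2 * j)) * (?F z * ?P z)) = (LINT z|gaussian_product. a * (?F2 z * ?P z + ?F z * ?Py z))"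
  proof (rule gaussian_integration_by_parts[where B=C])
    fix z t
    show "((\<lambda>t. ?F (z(Suc (2 * j) := t)) * ?P (z(Suc (2 * j) := t))) has_real_derivative
      a * (?F2 (z(Suc (2 * j) := t)) * ?P (z(Suc (2 * j) := t)) + ?F (z(Suc (2 * j) := t)) * ?Py (z(Suc (2 * j) := t)))) (at t)"
      using DERIV_mult[OF zcoord_derivative_odd[OF tf(1), of z j t] zcoord_derivative_odd[OF \<psi>, of z j t]]
      unfolding amp_odd a_def[symmetric] using j by (simp add: distrib_left mult_ac split: if_splits)
  qed (intro bound1 bound2 B continuous_intros c)+
  \<comment> \<open>With this, both integrations by parts contain the same term
    \<open>?F2 z * ?P z\<close>, which cancels in the difference.\<close>
  have mixed: "partial_deriv j (partial_deriv (n + j) \<phi>) x = partial_deriv (n + j) (partial_deriv j \<phi>) x" for x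
    using test_function_mixed_partials[OF \<phi>, of "n + j" j x] j by simp
  have ibp_x: "(LINT z|gaussian_product. z (2 * j) * (?F' z * ?P z)) = (LINT z|gaussian_product. a * (?F2 z * ?P z + ?F' z * ?Px z))"
  proof (rule gaussian_integration_by_parts[where B=C])
    fix z t
    show "((\<lambda>t. ?F' (z(2 * j := t)) * ?P (z(2 * j := t))) has_real_derivative
      a * (?F2 (z(2 * j := t)) * ?P (z(2 * j := t)) + ?F' (z(2 * j := t)) * ?Px (z(2 * j := t)))) (at t)"
      using DERIV_mult[OF zcoord_derivative_even[OF tf(2), of z j t] zcoord_derivative_even[OF \<psi>, of z j t]]
      unfolding a_def[symmetric] using j by (simp add: distrib_left mult_ac mixed split: if_splits)
  qed (intro bound1 bound2 B continuous_intros c)+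
  have int: "integrable gaussian_product (\<lambda>z. x z * y z)" and intz: "integrable gaussian_product (\<lambda>z. z k * (x z * y z))"
    if "continuous_on UNIV x" "continuous_on UNIV y" "\<And>z. \<bar>x z\<bar> \<le> B" "\<And>z. \<bar>y z\<bar> \<le> B"
    for k and x y :: "(nat \<Rightarrow> real) \<Rightarrow> real"
    using integrable_bounded_continuous[OF continuous_on_mult[OF that(1,2)], of "B * B"] prod_le that(3,4) by auto
  note ints = intz[OF c(1) c(4) B(1) B(4)] intz[OF c(2) c(4) B(2) B(4)] int[OF c(3) c(4) B(3) B(4)]
    int[OF c(1) c(6) B(1) B(6)] int[OF c(2) c(5) B(2) B(5)]
  have "(LINT z|gaussian_product. (?F z * z (Suc (2 * j)) - ?F' z * z (2 * j)) * ?P z) =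
      (LINT z|gaussian_product. z (Suc (2 * j)) * (?F z * ?P z) - z (2 * j) * (?F' z * ?P z))"
    by (simp add: algebra_simps)
  also have "\<dots> = (LINT z|gaussian_product. a * (?F2 z * ?P z + ?F z * ?Py z)) - (LINT z|gaussian_product. a * (?F2 z * ?P z + ?F' z * ?Px z))"
    unfolding ibp_x[symmetric] ibp_y[symmetric] by (rule Bochner_Integration.integral_diff[OF ints(1,2)])
  also have "\<dots> = a * ((LINT z|gaussian_product. ?F z * ?Py z) - (LINT z|gaussian_product. ?F' z * ?Px z))"
    using ints(3-5) by (simp only: integral_mult_right_zero Bochner_Integration.integral_add[OF ints(3,4)] Bochner_Integration.integral_add[OF ints(3,5)])
      (simp add: algebra_simps)
  also have "(LINT z|gaussian_product. ?F z * ?Py z) - (LINT z|gaussian_product. ?F' z * ?Px z) =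
      (LINT z|gaussian_product. ?F z * ?Py z - ?F' z * ?Px z)"
    by (rule Bochner_Integration.integral_diff[OF ints(4,5), symmetric])
  also have "(\<lambda>z. ?F z * ?Py z - ?F' z * ?Px z) = (\<lambda>z. if j < m then ?F z * partial_deriv (m + j) \<psi> (zcoord m z)
      - ?F' z * partial_deriv j \<psi> (zcoord m z) else 0)"
    by auto
  finally show ?thesis
    unfolding a_def[symmetric] coef using a_pos by simp
qed

lemma integrable_zcoord_mult:
  assumes "test_function k \<eta>" "test_function l \<theta>"
  shows "integrable gaussian_product (\<lambda>z. \<eta> (zcoord n z) * \<theta> (zcoord m z))"
    and "integrable gaussian_product (\<lambda>z. z i * (\<eta> (zcoord n z) * \<theta> (zcoord m z)))"
proof -
  obtain B B' where B: "\<And>x. \<bar>\<eta> x\<bar> \<le> B" "\<And>x. \<bar>\<theta> x\<bar> \<le> B'"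
    using test_function_bounded[OF assms(1)] test_function_bounded[OF assms(2)] by metis
  have "B \<ge> 0" "B' \<ge> 0"
    using B(1)[of undefined] B(2)[of undefined] by auto
  then have bd: "\<bar>\<eta> x * \<theta> y\<bar> \<le> B * B'" for x y
    using B by (auto simp: abs_mult intro!: mult_mono)
  note cont = continuous_on_mult[OF continuous_zcoord_compose[OF test_function_continuous[OF assms(1)]]
      continuous_zcoord_compose[OF test_function_continuous[OF assms(2)]]]
  show "integrable gaussian_product (\<lambda>z. \<eta> (zcoord n z) * \<theta> (zcoord m z))"
    "integrable gaussian_product (\<lambda>z. z i * (\<eta> (zcoord n z) * \<theta> (zcoord m z)))"
    using integrable_bounded_continuous[OF cont bd] by auto
qed

text \<open>Both sides are sums over modes, so the identity for one mode suffices once expectations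
  are written as integrals over the independent normal variables.\<close>

lemma kms_gauss_measure:
  "kms_measure I e \<iota> (field_iH_tests D H I e s) (field_iH H \<iota>) \<beta> gauss_measure"
  unfolding kms_measure_def
proof (intro conjI ballI allI impI prob_space_gauss_measure)
  show "sets gauss_measure = sets borel"
    by (simp add: gauss_measure_def)
  fix f assume "f \<in> field_iH_tests D H I e s"
  then have "\<i> *\<^sub>C H f \<in> sobolev H I e s"
    by (auto simp: field_iH_tests_def intro: sobolev_i)
  then obtain v where v: "riesz (\<i> *\<^sub>C H f) v"
    using riesz_exists by blast
  have "(\<lambda>u. inner v u) \<in> borel_measurable borel"
    by (intro borel_measurable_continuous_onI continuous_intros)
  then have "integrable gauss_measure (\<lambda>u. inner v u)"
    unfolding gauss_measure_def using integrable_inner_limit_field[of v]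
    by (subst integrable_distr_eq[OF limit_field_measurable])
  then show "integrable gauss_measure (field_iH H \<iota> f)"
    unfolding field_iH_def riesz_dual_pairing[OF v] .
next
  fix n m \<phi> \<psi>
  assume n: "{..<n} \<subseteq> I" and m: "{..<m} \<subseteq> I" and \<phi>: "test_function (2 * n) \<phi>" and \<psi>: "test_function (2 * m) \<psi>"
  have tf: "test_function (2 * n) (partial_deriv j \<phi>)" "test_function (2 * n) (partial_deriv (n + j) \<phi>)" if "j < n" for j
    using that by (auto intro!: test_function_partial_deriv \<phi>)
  have tg: "test_function (2 * m) (partial_deriv j \<psi>)" "test_function (2 * m) (partial_deriv (m + j) \<psi>)" if "j < m" for j
    using that by (auto intro!: test_function_partial_deriv \<psi>)
  have cont: "continuous_on UNIV (\<lambda>u. \<eta> (cyl_proj e \<iota> k u))" if "{..<k} \<subseteq> I" "test_function l \<eta>" for k l \<eta>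
    by (intro continuous_cylindrical that test_function_continuous[OF that(2)])
  let ?L = "\<lambda>j z. if j < m then partial_deriv j \<phi> (zcoord n z) * partial_deriv (m + j) \<psi> (zcoord m z)
      - partial_deriv (n + j) \<phi> (zcoord n z) * partial_deriv j \<psi> (zcoord m z) else 0"
  let ?R = "\<lambda>j z. (partial_deriv j \<phi> (zcoord n z) * z (Suc (2 * j)) - partial_deriv (n + j) \<phi> (zcoord n z) * z (2 * j)) * \<psi> (zcoord m z)"
  have L_int: "integrable gaussian_product (?L j)" if "j < n" for j
    using that tf tg by (cases "j < m") (auto intro!: Bochner_Integration.integrable_diff integrable_zcoord_mult)
  have R_int: "integrable gaussian_product (?R j)" if "j < n" for j
  proof -
    have "integrable gaussian_product (\<lambda>z. z (Suc (2 * j)) * (partial_deriv j \<phi> (zcoord n z) * \<psi> (zcoord m z))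
        - z (2 * j) * (partial_deriv (n + j) \<phi> (zcoord n z) * \<psi> (zcoord m z)))"
      by (intro Bochner_Integration.integrable_diff integrable_zcoord_mult(2)[OF tf(1)[OF that] \<psi>]
          integrable_zcoord_mult(2)[OF tf(2)[OF that] \<psi>])
    then show ?thesis
      by (simp add: algebra_simps)
  qed
  have "(LINT u|gauss_measure. sigma (cyl_gradient e \<iota> n \<phi> u) (cyl_gradient e \<iota> m \<psi> u)) =
      (LINT z|gaussian_product. (\<Sum>j<n. ?L j z))"
  proof (rule integral_gauss_measure_eq)
    have "continuous_on UNIV (\<lambda>u. if j < m then partial_deriv j \<phi> (cyl_proj e \<iota> n u) * partial_deriv (m + j) \<psi> (cyl_proj e \<iota> m u)
      - partial_deriv (n + j) \<phi> (cyl_proj e \<iota> n u) * partial_deriv j \<psi> (cyl_proj e \<iota> m u) else 0)" if "j < n" for j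
      using cont[OF n tf(1)[OF that]] cont[OF n tf(2)[OF that]] cont[OF m tg(1)] cont[OF m tg(2)]
      by (cases "j < m") (auto intro!: continuous_intros)
    then show "continuous_on UNIV (\<lambda>u. sigma (cyl_gradient e \<iota> n \<phi> u) (cyl_gradient e \<iota> m \<psi> u))"
      unfolding sigma_cyl_gradient[OF n m] by (intro continuous_on_sum) auto
    show "integrable gaussian_product (\<lambda>z. \<Sum>j<n. ?L j z)"
      by (intro Bochner_Integration.integrable_sum L_int) auto
    show "sigma (cyl_gradient e \<iota> n \<phi> (limit_field z)) (cyl_gradient e \<iota> m \<psi> (limit_field z)) = (\<Sum>j<n. ?L j z)"
      if "z \<notin> null_set" for z
      unfolding sigma_cyl_gradient[OF n m] cyl_proj_limit_field[OF n that] cyl_proj_limit_field[OF m that] ..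
  qed
  also have "\<dots> = (\<Sum>j<n. LINT z|gaussian_product. ?L j z)"
    by (intro Bochner_Integration.integral_sum L_int) auto
  also have "\<dots> = (\<Sum>j<n. \<beta> * lam j * amp (2 * j) * (LINT z|gaussian_product. ?R j z))"
    by (intro sum.cong refl gauss_kms_identity \<phi> \<psi>) auto
  also have "\<dots> = \<beta> * (\<Sum>j<n. LINT z|gaussian_product. lam j * amp (2 * j) * ?R j z)"
    by (simp add: sum_distrib_left mult.assoc)
  also have "(\<Sum>j<n. LINT z|gaussian_product. lam j * amp (2 * j) * ?R j z) =
      (LINT z|gaussian_product. (\<Sum>j<n. lam j * amp (2 * j) * ?R j z))"
    by (intro Bochner_Integration.integral_sum[symmetric] integrable_mult_right R_int) auto
  also have "\<dots> = (LINT u|gauss_measure. field_iH H \<iota> (cyl_gradient e \<iota> n \<phi> u) u * \<psi> (cyl_proj e \<iota> m u))"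
  proof (rule integral_gauss_measure_eq[symmetric])
    show "continuous_on UNIV (\<lambda>u. field_iH H \<iota> (cyl_gradient e \<iota> n \<phi> u) u * \<psi> (cyl_proj e \<iota> m u))"
      unfolding field_iH_cyl_gradient[OF n]
      by (intro continuous_intros continuous_coord cont[OF n tf(1)] cont[OF n tf(2)] cont[OF m \<psi>]) auto
    show "integrable gaussian_product (\<lambda>z. \<Sum>j<n. lam j * amp (2 * j) * ?R j z)"
      by (intro Bochner_Integration.integrable_sum integrable_mult_right R_int) auto
    fix z assume z: "z \<notin> null_set"
    have "coord (2 * j) (limit_field z) = amp (2 * j) * z (2 * j)"
      "coord (Suc (2 * j)) (limit_field z) = amp (2 * j) * z (Suc (2 * j))" if "j < n" for j
      using that n coord_limit_field[OF z, of "2 * j"] coord_limit_field[OF z, of "Suc (2 * j)"] by (auto simp: amp_odd)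
    then show "field_iH H \<iota> (cyl_gradient e \<iota> n \<phi> (limit_field z)) (limit_field z) * \<psi> (cyl_proj e \<iota> m (limit_field z)) =
        (\<Sum>j<n. lam j * amp (2 * j) * ?R j z)"
      unfolding field_iH_cyl_gradient[OF n] cyl_proj_limit_field[OF n z] cyl_proj_limit_field[OF m z] sum_distrib_right
      by (intro sum.cong) (auto simp: algebra_simps)
  qed
  finally show "(LINT u|gauss_measure. sigma (cyl_gradient e \<iota> n \<phi> u) (cyl_gradient e \<iota> m \<psi> u)) =
      \<beta> * (LINT u|gauss_measure. field_iH H \<iota> (cyl_gradient e \<iota> n \<phi> u) u * \<psi> (cyl_proj e \<iota> m u))" .
qed

end

section \<open>Smooth cylindrical cutoffs\<close>

text \<open>Defined by existence of a derivative one order lower, so that closure under products and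
  affine substitution is a plain induction without higher-order formulas.\<close>

primrec Ck :: "nat \<Rightarrow> (real \<Rightarrow> complex) \<Rightarrow> bool" where
  "Ck 0 g \<longleftrightarrow> continuous_on UNIV g"
| "Ck (Suc k) g \<longleftrightarrow> (\<exists>g'. (\<forall>t. (g has_vector_derivative g' t) (at t)) \<and> Ck k g')"

definition smooth_curve :: "(real \<Rightarrow> complex) \<Rightarrow> bool" where
  "smooth_curve g \<longleftrightarrow> (\<forall>k. Ck k g)"

lemma differentiable_imp_continuous_curve:
  "(\<And>t. (g has_vector_derivative g' t) (at t)) \<Longrightarrow> continuous_on UNIV (g :: real \<Rightarrow> complex)"
  by (auto simp: continuous_on_eq_continuous_at intro: has_vector_derivative_continuous)

lemma Ck_SucI: "(\<And>t. (g has_vector_derivative g' t) (at t)) \<Longrightarrow> Ck k g' \<Longrightarrow> Ck (Suc k) g"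
  by auto

lemma Ck_Suc_D: "Ck (Suc k) g \<Longrightarrow> Ck k g"
proof (induction k arbitrary: g)
  case 0
  then show ?case
    by (auto intro: differentiable_imp_continuous_curve)
next
  case (Suc k)
  then show ?case
    unfolding Ck.simps(2)[of "Suc k" g] Ck.simps(2)[of k g] by blast
qed

lemma Ck_const: "Ck k (\<lambda>t. c)"
proof (induction k arbitrary: c)
  case (Suc k)
  show ?case
    by (rule Ck_SucI[where g'="\<lambda>_. 0"]) (simp_all add: Suc)
qed simp

lemma Ck_add: "Ck k f \<Longrightarrow> Ck k g \<Longrightarrow> Ck k (\<lambda>t. f t + g t)"
proof (induction k arbitrary: f g)
  case (Suc k)
  then obtain f' g' where "\<And>t. (f has_vector_derivative f' t) (at t)" "Ck k f'"
    "\<And>t. (g has_vector_derivative g' t) (at t)" "Ck k g'"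
    unfolding Ck.simps by blast
  then show ?case
    using Suc.IH[of f' g'] by (auto intro!: exI[of _ "\<lambda>t. f' t + g' t"] has_vector_derivative_add)
qed (simp add: continuous_on_add)

lemma Ck_mult: "Ck k f \<Longrightarrow> Ck k g \<Longrightarrow> Ck k (\<lambda>t. f t * g t)"
proof (induction k arbitrary: f g)
  case (Suc k)
  then obtain f' g' where d: "\<And>t. (f has_vector_derivative f' t) (at t)" "Ck k f'"
    "\<And>t. (g has_vector_derivative g' t) (at t)" "Ck k g'"
    unfolding Ck.simps by blast
  have "((\<lambda>t. f t * g t) has_vector_derivative f t * g' t + f' t * g t) (at t)" for t
    by (rule has_vector_derivative_mult[OF d(1,3)])
  moreover have "Ck k (\<lambda>t. f t * g' t + f' t * g t)"
    \<comment> \<open>The Leibniz terms contain \<open>f\<close> and \<open>g\<close> themselves,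
      which enter with one order less.\<close>
    by (intro Ck_add Suc.IH d Suc.prems[THEN Ck_Suc_D])
  ultimately show ?case
    by (rule Ck_SucI)
qed (simp add: continuous_on_mult)

lemma Ck_affine: "Ck k g \<Longrightarrow> Ck k (\<lambda>t. g (a * t + b))"
proof (induction k arbitrary: g)
  case 0
  then show ?case
    by (auto intro!: continuous_intros continuous_on_compose2[of UNIV g])
next
  case (Suc k)
  then obtain g' where d: "\<And>t. (g has_vector_derivative g' t) (at t)" "Ck k g'"
    unfolding Ck.simps by blast
  have "((\<lambda>t. a * t + b) has_vector_derivative a) (at t)" for t
    unfolding has_real_derivative_iff_has_vector_derivative[symmetric] by (auto intro!: derivative_eq_intros)
  from vector_diff_chain_at[OF this d(1)]
  have "((\<lambda>t. g (a * t + b)) has_vector_derivative complex_of_real a * g' (a * t + b)) (at t)" for t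
    by (simp add: o_def scaleR_conv_of_real)
  moreover have "Ck k (\<lambda>t. complex_of_real a * g' (a * t + b))"
    by (intro Ck_mult Ck_const Suc.IH d(2))
  ultimately show ?case
    by (rule Ck_SucI)
qed

lemma Ck_ident: "Ck k complex_of_real"
proof (cases k)
  case (Suc l)
  have "(complex_of_real has_vector_derivative 1) (at t)" for t
    using has_vector_derivative_of_real[of "\<lambda>t. t" 1] by auto
  then show ?thesis
    unfolding Suc by (rule Ck_SucI) (rule Ck_const)
qed (simp add: continuous_intros)

lemma Ck_iexp: "Ck k (\<lambda>t. c * iexp (h * t))"
proof (induction k arbitrary: c)
  case 0
  then show ?case
    by (simp add: continuous_intros)
next
  case (Suc k)
  have "((\<lambda>t. h * t) has_vector_derivative h) (at t)" for t
    unfolding has_real_derivative_iff_has_vector_derivative[symmetric] by (auto intro!: derivative_eq_intros)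
  from vector_diff_chain_at[OF this has_vector_derivative_iexp]
  have "((\<lambda>t. iexp (h * t)) has_vector_derivative complex_of_real h * (\<i> * iexp (h * t))) (at t)" for t
    by (simp add: o_def scaleR_conv_of_real)
  then have "((\<lambda>t. c * iexp (h * t)) has_vector_derivative (c * h * \<i>) * iexp (h * t)) (at t)" for t
    unfolding mult.assoc by (rule has_vector_derivative_mult_right)
  then show ?case
    by (rule Ck_SucI) (rule Suc.IH)
qed

lemma smooth_curve_intros:
  "smooth_curve (\<lambda>t. c)" "smooth_curve complex_of_real" "smooth_curve (\<lambda>t. c * iexp (h * t))"
  "smooth_curve f \<Longrightarrow> smooth_curve g \<Longrightarrow> smooth_curve (\<lambda>t. f t * g t)"
  "smooth_curve g \<Longrightarrow> smooth_curve (\<lambda>t. g (a * t + b))"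
  unfolding smooth_curve_def by (blast intro: Ck_const Ck_ident Ck_iexp Ck_mult Ck_affine)+

lemma smooth_curve_derivative:
  assumes "smooth_curve g"
  shows "(g has_vector_derivative vector_derivative g (at t)) (at t)" "smooth_curve (\<lambda>t. vector_derivative g (at t))"
proof -
  have *: "(\<forall>t. (g has_vector_derivative vector_derivative g (at t)) (at t)) \<and> Ck k (\<lambda>t. vector_derivative g (at t))" for k
  proof -
    have "Ck (Suc k) g"
      using assms by (simp add: smooth_curve_def del: Ck.simps)
    then obtain g' where g': "\<And>t. (g has_vector_derivative g' t) (at t)" "Ck k g'"
      unfolding Ck.simps by blast
    then have "g' = (\<lambda>t. vector_derivative g (at t))"
      by (intro ext) (simp add: vector_derivative_at[OF g'(1)])
    then show ?thesis
      using g' by auto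
  qed
  show "(g has_vector_derivative vector_derivative g (at t)) (at t)" "smooth_curve (\<lambda>t. vector_derivative g (at t))"
    using * by (auto simp: smooth_curve_def)
qed

lemma smooth_curve_continuous: "smooth_curve g \<Longrightarrow> continuous_on UNIV g"
  unfolding smooth_curve_def using Ck.simps(1) by blast

text \<open>The derivative of a member is a linear combination of later members, so smoothness of
  the whole family, and of the flat function \<open>flat_exp 0\<close>, is an induction.\<close>

definition flat_exp :: "nat \<Rightarrow> real \<Rightarrow> complex" where
  "flat_exp n x = (if x > 0 then complex_of_real (exp (- 1 / x) / x ^ n) else 0)"

text \<open>Only the point 0 is delicate: with \<open>y = 1 / x\<close> the right difference
  quotient is \<open>y^(n+1) / exp y\<close>, which tends to 0.\<close>

lemma flat_exp_derivative:
  "(flat_exp n has_vector_derivative - of_nat n * flat_exp (Suc n) x + flat_exp (Suc (Suc n)) x) (at x)"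
proof (cases x "0 :: real" rule: linorder_cases)
  case less
  have "((\<lambda>x. 0) has_vector_derivative 0) (at x)"
    by simp
  then have "(flat_exp n has_vector_derivative 0) (at x)"
    by (rule has_vector_derivative_transform_within_open[where S="{..<0}"]) (use less in \<open>auto simp: flat_exp_def\<close>)
  then show ?thesis
    using less by (simp add: flat_exp_def)
next
  case greater
  have "((\<lambda>x. exp (- 1 / x) / x ^ n) has_real_derivative
      - real n * (exp (- 1 / x) / x ^ Suc n) + exp (- 1 / x) / x ^ Suc (Suc n)) (at x)"
  proof (induction n)
    case 0
    then show ?case
      using greater by (auto intro!: derivative_eq_intros simp: power2_eq_square)
  next
    case (Suc n)
    have "((\<lambda>x. exp (- 1 / x) / x ^ n * inverse x) has_real_derivative
        (- real n * (exp (- 1 / x) / x ^ Suc n) + exp (- 1 / x) / x ^ Suc (Suc n)) * inverse x +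
        - (inverse x ^ Suc (Suc 0)) * (exp (- 1 / x) / x ^ n)) (at x)"
      using greater by (intro DERIV_mult Suc DERIV_inverse) auto
    moreover define y where "y = exp (- 1 / x) / x ^ n"
    then have "exp (- 1 / x) / x ^ Suc n = y / x" "exp (- 1 / x) / x ^ Suc (Suc n) = y / x / x"
      "exp (- 1 / x) / x ^ Suc (Suc (Suc n)) = y / x / x / x"
      by (simp_all only: power_Suc2 divide_divide_eq_left)
    moreover have "(\<lambda>x::real. exp (- 1 / x) / x ^ n * inverse x) = (\<lambda>x. exp (- 1 / x) / x ^ Suc n)"
      by (simp add: fun_eq_iff field_simps)
    moreover have "(- real n * (y / x) + y / x / x) * inverse x + - (inverse x ^ Suc (Suc 0)) * y =
        - real (Suc n) * (y / x / x) + y / x / x / x"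
      using greater by (simp add: field_simps)
    ultimately show ?case
      by (simp only: y_def[symmetric])
  qed
  then have "((\<lambda>x. complex_of_real (exp (- 1 / x) / x ^ n)) has_vector_derivative
      complex_of_real (- real n * (exp (- 1 / x) / x ^ Suc n) + exp (- 1 / x) / x ^ Suc (Suc n))) (at x)"
    by (rule has_vector_derivative_of_real[OF _, simplified has_real_derivative_iff_has_vector_derivative[symmetric]])
  then have "(flat_exp n has_vector_derivative
      complex_of_real (- real n * (exp (- 1 / x) / x ^ Suc n) + exp (- 1 / x) / x ^ Suc (Suc n))) (at x)"
    by (rule has_vector_derivative_transform_within_open[where S="{0<..}"]) (use greater in \<open>auto simp: flat_exp_def\<close>)
  then show ?thesis
    using greater by (simp add: flat_exp_def)
next
  case equal
  have "((\<lambda>t. (flat_exp n t - flat_exp n 0) / complex_of_real t) \<longlongrightarrow> 0) (at 0)"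
    unfolding filterlim_at_split
  proof
    show "((\<lambda>t. (flat_exp n t - flat_exp n 0) / complex_of_real t) \<longlongrightarrow> 0) (at_left 0)"
      by (rule tendsto_eventually) (auto simp: flat_exp_def eventually_at_filter)
    have "((\<lambda>t. (inverse t) ^ Suc n / exp (inverse t)) \<longlongrightarrow> 0) (at_right (0::real))"
      by (rule filterlim_compose[OF tendsto_power_div_exp_0 filterlim_inverse_at_top_right])
    then have "((\<lambda>t. complex_of_real ((inverse t) ^ Suc n / exp (inverse t))) \<longlongrightarrow> complex_of_real 0) (at_right 0)"
      by (rule tendsto_of_real)
    moreover have "\<forall>\<^sub>F t in at_right 0. complex_of_real ((inverse t) ^ Suc n / exp (inverse t)) = (flat_exp n t - flat_exp n 0) / complex_of_real t"
      by (auto simp: eventually_at_filter flat_exp_def exp_minus field_simps power_inverse inverse_eq_divide)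
    ultimately show "((\<lambda>t. (flat_exp n t - flat_exp n 0) / complex_of_real t) \<longlongrightarrow> 0) (at_right 0)"
      by (simp add: tendsto_cong)
  qed
  then show ?thesis
    using equal by (simp add: has_vector_derivative_at_0_iff flat_exp_def)
qed

lemma smooth_curve_flat_exp: "smooth_curve (flat_exp n)"
proof -
  have "Ck k (flat_exp n)" for k
  proof (induction k arbitrary: n)
    case 0
    show ?case
      unfolding Ck.simps by (rule differentiable_imp_continuous_curve[OF flat_exp_derivative])
  next
    case (Suc k)
    have "Ck k (\<lambda>x. - of_nat n * flat_exp (Suc n) x + flat_exp (Suc (Suc n)) x)"
      by (intro Ck_add Ck_mult Ck_const Suc)
    with flat_exp_derivative[of n] show ?case
      by (rule Ck_SucI)
  qed
  then show ?thesis
    by (simp add: smooth_curve_def)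
qed

lemma continuous_compact_support_bounded:
  assumes "continuous_on UNIV (g :: real \<Rightarrow> complex)" "\<And>t. \<bar>t\<bar> > 1 \<Longrightarrow> g t = 0"
  shows "\<exists>M. \<forall>t. cmod (g t) \<le> M"
proof -
  have "bounded (g ` {-1..1})"
    by (intro compact_imp_bounded compact_continuous_image continuous_on_subset[OF assms(1)]) auto
  then obtain M where M: "\<And>t. t \<in> {-1..1} \<Longrightarrow> cmod (g t) \<le> M"
    unfolding bounded_iff by blast
  have "cmod (g t) \<le> \<bar>M\<bar>" for t
  proof (cases "\<bar>t\<bar> > 1")
    case False
    then have "t \<in> {-1..1}"
      by auto
    from M[OF this] show ?thesis
      by simp
  qed (simp add: assms(2))
  then show ?thesis
    by blast
qed

text \<open>The bounds on \<open>t * \<theta> t\<close> and \<open>t * \<theta>' t\<close> are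
  included because the cutoff also multiplies a linear function; a single \<open>M\<close> serves
  all bounds.\<close>

lemma bump_exists:
  obtains \<theta> \<theta>' :: "real \<Rightarrow> complex" and M :: real where "smooth_curve \<theta>"
    "\<And>t. (\<theta> has_vector_derivative \<theta>' t) (at t)" "\<And>t. \<bar>t\<bar> > 1 \<Longrightarrow> \<theta> t = 0" "\<theta> 0 = 1" "isCont \<theta> 0" "isCont \<theta>' 0"
    "\<And>t. cmod (\<theta> t) \<le> M" "\<And>t. cmod (\<theta>' t) \<le> M" "\<And>t. cmod (t * \<theta> t) \<le> M" "\<And>t. cmod (t * \<theta>' t) \<le> M" "M \<ge> 1"
proof -
  \<comment> \<open>At \<open>t = 0\<close> both factors are \<open>exp (- 1)\<close>, so
    \<open>exp 2\<close> normalises the value to 1; both arguments are positive exactly for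
    \<open>|t| < 1\<close>.\<close>
  define \<theta> where "\<theta> t = exp 2 * (flat_exp 0 (1 * t + 1) * flat_exp 0 (- 1 * t + 1))" for t
  define \<theta>' where "\<theta>' t = vector_derivative \<theta> (at t)" for t
  have smooth: "smooth_curve \<theta>"
    unfolding \<theta>_def by (intro smooth_curve_intros smooth_curve_flat_exp)
  have d: "(\<theta> has_vector_derivative \<theta>' t) (at t)" for t
    unfolding \<theta>'_def by (rule smooth_curve_derivative(1)[OF smooth])
  have smooth': "smooth_curve \<theta>'"
    unfolding \<theta>'_def by (rule smooth_curve_derivative(2)[OF smooth])
  have zero: "\<theta> t = 0" if "\<bar>t\<bar> > 1" for t
    using that by (auto simp: \<theta>_def flat_exp_def)
  have zero': "\<theta>' t = 0" if "\<bar>t\<bar> > 1" for t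
  proof -
    have "((\<lambda>t. 0) has_vector_derivative 0) (at t)"
      by simp
    then have "(\<theta> has_vector_derivative 0) (at t)"
      by (rule has_vector_derivative_transform_within_open[where S="{t. \<bar>t\<bar> > 1}"])
         (use that zero in \<open>auto intro!: open_Collect_less continuous_intros\<close>)
    then show ?thesis
      by (simp add: \<theta>'_def vector_derivative_at)
  qed
  have c: "continuous_on UNIV \<theta>" "continuous_on UNIV \<theta>'"
    using smooth smooth' by (auto intro: smooth_curve_continuous)
  have "\<exists>M. \<forall>t. cmod (\<theta> t) \<le> M" "\<exists>M. \<forall>t. cmod (\<theta>' t) \<le> M" "\<exists>M. \<forall>t. cmod (t * \<theta> t) \<le> M" "\<exists>M. \<forall>t. cmod (t * \<theta>' t) \<le> M"
    using zero zero' c by (auto intro!: continuous_compact_support_bounded continuous_intros)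
  then obtain M1 M2 M3 M4 where "\<And>t. cmod (\<theta> t) \<le> M1" "\<And>t. cmod (\<theta>' t) \<le> M2" "\<And>t. cmod (t * \<theta> t) \<le> M3" "\<And>t. cmod (t * \<theta>' t) \<le> M4"
    by blast
  then have b: "cmod (\<theta> t) \<le> max 1 (max M1 (max M2 (max M3 M4)))" "cmod (\<theta>' t) \<le> max 1 (max M1 (max M2 (max M3 M4)))"
    "cmod (t * \<theta> t) \<le> max 1 (max M1 (max M2 (max M3 M4)))" "cmod (t * \<theta>' t) \<le> max 1 (max M1 (max M2 (max M3 M4)))" for t
    by (simp_all add: le_max_iff_disj)
  have \<theta>0: "\<theta> 0 = 1"
    by (simp add: \<theta>_def flat_exp_def mult_exp_exp exp_of_real[symmetric])
  have cont0: "isCont \<theta> 0" "isCont \<theta>' 0"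
    using c by (auto simp: continuous_on_eq_continuous_at)
  have "1 \<le> max 1 (max M1 (max M2 (max M3 M4)))"
    by simp
  then show ?thesis
    by (rule that[OF smooth d zero \<theta>0 cont0 b, rotated])
qed

text \<open>These test functions form a class closed under partial derivatives.\<close>

definition prod_curve :: "nat \<Rightarrow> (nat \<Rightarrow> real \<Rightarrow> complex) \<Rightarrow> (nat \<Rightarrow> real) \<Rightarrow> real" where
  "prod_curve m g x = Re (\<Prod>i<m. g i (x i))"

lemma prod_curve_has_derivative:
  assumes "j < m" "\<And>t. (g j has_vector_derivative g' t) (at t)"
  shows "((\<lambda>t. prod_curve m g (x(j := t))) has_real_derivative prod_curve m (g(j := g')) (x(j := t))) (at t)"
proof -
  define c where "c = (\<Prod>i\<in>{..<m} - {j}. g i (x i))"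
  have c1: "(\<Prod>i<m. g i ((x(j := t)) i)) = g j t * c" for t
    using assms(1) unfolding c_def by (subst prod.remove[of _ j]) (auto intro!: prod.cong)
  have c2: "(\<Prod>i<m. (g(j := g')) i ((x(j := t)) i)) = g' t * c" for t
    using assms(1) unfolding c_def by (subst prod.remove[of _ j]) (auto intro!: prod.cong)
  have "((\<lambda>t. g j t * c) has_vector_derivative g' t * c) (at t)"
    by (intro has_vector_derivative_mult_left assms)
  then have "((\<lambda>t. Re (g j t * c)) has_vector_derivative Re (g' t * c)) (at t)"
    by (rule bounded_linear.has_vector_derivative[OF bounded_linear_Re])
  then show ?thesis
    unfolding prod_curve_def c1 c2 by (simp add: has_real_derivative_iff_has_vector_derivative)
qed

lemma partial_deriv_prod_curve:
  assumes "j < m" "\<And>t. (g j has_vector_derivative g' t) (at t)"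
  shows "partial_deriv j (prod_curve m g) = prod_curve m (g(j := g'))"
proof
  fix x
  show "partial_deriv j (prod_curve m g) x = prod_curve m (g(j := g')) x"
    using DERIV_imp_deriv[OF prod_curve_has_derivative[where x=x and t="x j" and j=j and m=m and g=g and g'=g', OF assms]]
    by (simp add: partial_deriv_def)
qed

lemma continuous_prod_curve:
  assumes "\<And>i. i < m \<Longrightarrow> continuous_on UNIV (g i)"
  shows "continuous_on UNIV (prod_curve m g)"
  unfolding prod_curve_def
  by (intro continuous_intros continuous_on_compose2[OF assms] continuous_on_product_coordinates) auto

lemma foldr_partial_deriv_prod_curve:
  assumes "\<And>i. i < m \<Longrightarrow> smooth_curve (g i)" "set js \<subseteq> {..<m}"
  shows "\<exists>g'. (\<forall>i<m. smooth_curve (g' i)) \<and> foldr partial_deriv js (prod_curve m g) = prod_curve m g'"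
  using assms(2)
proof (induction js)
  case Nil
  then show ?case
    using assms(1) by auto
next
  case (Cons j js)
  then obtain g' where g': "\<forall>i<m. smooth_curve (g' i)" "foldr partial_deriv js (prod_curve m g) = prod_curve m g'"
    by auto
  have "j < m"
    using Cons.prems by simp
  then have "partial_deriv j (prod_curve m g') = prod_curve m (g'(j := \<lambda>t. vector_derivative (g' j) (at t)))"
    using g'(1) by (intro partial_deriv_prod_curve smooth_curve_derivative(1)) auto
  moreover have "\<forall>i<m. smooth_curve ((g'(j := \<lambda>t. vector_derivative (g' j) (at t))) i)"
    using g'(1) \<open>j < m\<close> by (auto intro: smooth_curve_derivative(2))
  ultimately show ?case
    using g'(2) by (intro exI[of _ "g'(j := \<lambda>t. vector_derivative (g' j) (at t))"] conjI) (simp_all add: fun_upd_def)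
qed

text \<open>A product of intervals below \<open>m\<close> and singletons beyond, hence compact by
  Tychonoff. Such boxes contain the supports of the product test functions.\<close>

lemma compact_box_slice: "compact {x :: nat \<Rightarrow> real. (\<forall>i\<ge>m. x i = 0) \<and> (\<forall>i<m. \<bar>x i\<bar> \<le> R)}"
proof -
  have "compactin (product_topology (\<lambda>i. euclidean) UNIV) (PiE UNIV (\<lambda>i::nat. if i < m then {-R..R} else {0::real}))"
    unfolding compactin_PiE by auto
  then have "compact (PiE UNIV (\<lambda>i::nat. if i < m then {-R..R} else {0::real}))"
    by (simp add: euclidean_product_topology)
  also have "PiE UNIV (\<lambda>i::nat. if i < m then {-R..R} else {0::real}) = {x. (\<forall>i\<ge>m. x i = 0) \<and> (\<forall>i<m. \<bar>x i\<bar> \<le> R)}"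
  proof (intro equalityI subsetI)
    fix x assume x: "x \<in> PiE UNIV (\<lambda>i::nat. if i < m then {-R..R} else {0::real})"
    have "x i \<in> (if i < m then {-R..R} else {0})" for i
      using x by (simp add: PiE_iff)
    then show "x \<in> {x. (\<forall>i\<ge>m. x i = 0) \<and> (\<forall>i<m. \<bar>x i\<bar> \<le> R)}"
      by (auto simp: abs_le_iff split: if_splits) (metis atLeastAtMost_iff minus_le_iff not_less singletonD)+
  qed (auto simp: PiE_iff abs_le_iff)
  finally show ?thesis .
qed

lemma test_function_prod_curve:
  assumes smooth: "\<And>i. i < m \<Longrightarrow> smooth_curve (g i)" and supp: "\<And>i t. i < m \<Longrightarrow> \<bar>t\<bar> > R \<Longrightarrow> g i t = 0"
  shows "test_function m (prod_curve m g)"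
  unfolding test_function_def
proof (intro conjI allI impI)
  fix x y :: "nat \<Rightarrow> real" assume "\<forall>i<m. x i = y i"
  then show "prod_curve m g x = prod_curve m g y"
    by (simp add: prod_curve_def)
next
  fix js assume "set js \<subseteq> {..<m}"
  then obtain g' where g': "\<forall>i<m. smooth_curve (g' i)" "foldr partial_deriv js (prod_curve m g) = prod_curve m g'"
    using foldr_partial_deriv_prod_curve[of m g js] smooth by blast
  show "continuous_on UNIV (foldr partial_deriv js (prod_curve m g))"
    unfolding g'(2) using g'(1) by (intro continuous_prod_curve smooth_curve_continuous) auto
  fix j x assume "j < m"
  then show "(\<lambda>t. foldr partial_deriv js (prod_curve m g) (x(j := t))) field_differentiable at (x j)"
    unfolding g'(2) field_differentiable_def
    using prod_curve_has_derivative[of j m g', OF _ smooth_curve_derivative(1)] g'(1) by blast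
next
  have "{x. (\<forall>i\<ge>m. x i = 0) \<and> prod_curve m g x \<noteq> 0} \<subseteq> {x. (\<forall>i\<ge>m. x i = 0) \<and> (\<forall>i<m. \<bar>x i\<bar> \<le> R)}"
  proof safe
    fix x i assume "prod_curve m g x \<noteq> 0" "i < m"
    then have "g i (x i) \<noteq> 0"
      unfolding prod_curve_def by (metis finite_lessThan lessThan_iff prod_zero zero_complex.simps(1))
    then show "\<bar>x i\<bar> \<le> R"
      using supp[OF \<open>i < m\<close>, of "x i"] by linarith
  qed
  then have "closure {x. (\<forall>i\<ge>m. x i = 0) \<and> prod_curve m g x \<noteq> 0} \<subseteq> {x. (\<forall>i\<ge>m. x i = 0) \<and> (\<forall>i<m. \<bar>x i\<bar> \<le> R)}"
    by (intro closure_minimal compact_imp_closed compact_box_slice)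
  then have "closure {x. (\<forall>i\<ge>m. x i = 0) \<and> prod_curve m g x \<noteq> 0} =
      closure {x. (\<forall>i\<ge>m. x i = 0) \<and> prod_curve m g x \<noteq> 0} \<inter> {x. (\<forall>i\<ge>m. x i = 0) \<and> (\<forall>i<m. \<bar>x i\<bar> \<le> R)}"
    by blast
  moreover have "compact (closure {x. (\<forall>i\<ge>m. x i = 0) \<and> prod_curve m g x \<noteq> 0} \<inter>
      {x. (\<forall>i\<ge>m. x i = 0) \<and> (\<forall>i<m. \<bar>x i\<bar> \<le> R)})"
    by (rule closed_Int_compact[OF closed_closure compact_box_slice])
  ultimately show "compact (closure {x. (\<forall>i\<ge>m. x i = 0) \<and> prod_curve m g x \<noteq> 0})"
    by (simp only:)
qed

lemma smooth_curve_scale: "smooth_curve g \<Longrightarrow> smooth_curve (\<lambda>t. g (a * t))"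
  using smooth_curve_intros(5)[of g a 0] by simp

lemma has_vector_derivative_scale:
  assumes "\<And>t. (g has_vector_derivative g' t) (at t)"
  shows "((\<lambda>t. g (a * t)) has_vector_derivative complex_of_real a * g' (a * t)) (at t)"
proof -
  have "((\<lambda>t. a * t) has_vector_derivative a) (at t)"
    unfolding has_real_derivative_iff_has_vector_derivative[symmetric] by (auto intro!: derivative_eq_intros)
  from vector_diff_chain_at[OF this assms] show ?thesis
    by (simp add: o_def scaleR_conv_of_real)
qed

lemma prod_curve_scale:
  assumes "i < m"
  shows "prod_curve m (g(i := \<lambda>t. complex_of_real a * f t)) x = a * prod_curve m (g(i := f)) x"
proof -
  have "(\<Prod>l<m. (g(i := f)) l (x l)) = f (x i) * (\<Prod>l\<in>{..<m} - {i}. g l (x l))" for f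
    using assms by (subst prod.remove[of _ i]) (auto intro!: prod.cong)
  then show ?thesis
    by (simp add: prod_curve_def mult.assoc)
qed

lemma prod_curve_bounded:
  assumes "\<And>i. i < m \<Longrightarrow> cmod (g i (x i)) \<le> B"
  shows "\<bar>prod_curve m g x\<bar> \<le> B ^ m"
proof -
  have "\<bar>prod_curve m g x\<bar> \<le> cmod (\<Prod>i<m. g i (x i))"
    unfolding prod_curve_def by (rule abs_Re_le_cmod)
  also have "\<dots> = (\<Prod>i<m. cmod (g i (x i)))"
    by (simp add: prod_norm)
  also have "\<dots> \<le> (\<Prod>i<m. B)"
    using assms by (intro prod_mono) auto
  finally show ?thesis
    by simp
qed

lemma prod_curve_tendsto:
  assumes "\<And>i. i < m \<Longrightarrow> (\<lambda>r. g r i (x i)) \<longlonglongrightarrow> l i"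
  shows "(\<lambda>r. prod_curve m (g r) x) \<longlonglongrightarrow> Re (\<Prod>i<m. l i)"
  unfolding prod_curve_def using assms by (intro tendsto_intros) auto

lemma null_scale_tendsto:
  assumes "isCont g (0::real)"
  shows "(\<lambda>r. g (inverse (real (Suc r)) * t)) \<longlonglongrightarrow> (g 0 :: complex)"
proof -
  have "(\<lambda>r. inverse (real (Suc r)) * t) \<longlonglongrightarrow> 0"
    using tendsto_mult_left_zero[OF LIMSEQ_inverse_real_of_nat] .
  then show ?thesis
    by (rule isCont_tendsto_compose[OF assms])
qed

text \<open>The cut-off coordinate is \<open>x k\<close> times the product of all
  \<open>\<theta> (a r * x i)\<close>, with scale \<open>a r = 1 / (r + 1)\<close>. Written as
  \<open>1 / a r\<close> times a product of functions of \<open>a r * x i\<close>, its gradient is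
  bounded uniformly because the chain rule factor \<open>a r\<close> cancels \<open>1 / a r\<close>.
  In the limit each factor takes its value at 0: the undifferentiated factor \<open>u k\<close>
  gives 0, all others that matter give 1.\<close>

lemma linear_cutoff:
  assumes k: "k < m"
  obtains F B where "\<And>r. test_function m (F r)"
    "\<And>i x. i < m \<Longrightarrow> (\<lambda>r::nat. partial_deriv i (F r) x) \<longlonglongrightarrow> (if i = k then 1 else 0)"
    "\<And>i r x. i < m \<Longrightarrow> \<bar>partial_deriv i (F r) x\<bar> \<le> B"
proof -
  obtain \<theta> \<theta>' :: "real \<Rightarrow> complex" and M where \<theta>: "smooth_curve \<theta>" and d: "\<And>t. (\<theta> has_vector_derivative \<theta>' t) (at t)"
    and supp: "\<And>t. \<bar>t\<bar> > 1 \<Longrightarrow> \<theta> t = 0" and \<theta>0: "\<theta> 0 = 1" and cont: "isCont \<theta> 0" "isCont \<theta>' 0"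
    and M: "\<And>t. cmod (\<theta> t) \<le> M" "\<And>t. cmod (\<theta>' t) \<le> M" "\<And>t. cmod (t * \<theta> t) \<le> M" "\<And>t. cmod (t * \<theta>' t) \<le> M" "M \<ge> 1"
    using bump_exists by metis
  define a where "a r = inverse (real (Suc r))" for r
  have a: "a r > 0" for r
    by (simp add: a_def)
  define u where "u i t = (if i = k then complex_of_real t * \<theta> t else \<theta> t)" for i t
  define v where "v i t = (if i = k then \<theta> t + complex_of_real t * \<theta>' t else \<theta>' t)" for i t
  define U where "U r i t = u i (a r * t)" for r i t
  define F where "F r = prod_curve m ((U r)(k := \<lambda>t. complex_of_real (1 / a r) * U r k t))" for r
  have su: "smooth_curve (u i)" for i
    unfolding u_def by (cases "i = k") (auto intro: smooth_curve_intros \<theta>)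
  have du: "(u i has_vector_derivative v i t) (at t)" for i t
  proof (cases "i = k")
    case True
    have "(complex_of_real has_vector_derivative 1) (at t)"
      using has_vector_derivative_of_real[of "\<lambda>t. t" 1] by auto
    from has_vector_derivative_mult[OF this d] True show ?thesis
      by (simp add: u_def[abs_def] v_def add.commute)
  qed (simp add: u_def[abs_def] v_def d)
  have F_eq: "F r x = (1 / a r) * prod_curve m (U r) x" for r x
    unfolding F_def prod_curve_scale[OF k] by simp
  have pd: "partial_deriv i (F r) x = prod_curve m ((U r)(i := \<lambda>t. v i (a r * t))) x" if "i < m" for i r x
  proof -
    have "((\<lambda>t. (1 / a r) * prod_curve m (U r) (x(i := t))) has_real_derivative
        (1 / a r) * prod_curve m ((U r)(i := \<lambda>t. complex_of_real (a r) * v i (a r * t))) (x(i := x i))) (at (x i))"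
      by (intro DERIV_cmult prod_curve_has_derivative[OF that])
         (unfold U_def, rule has_vector_derivative_scale[OF du])
    then show ?thesis
      unfolding partial_deriv_def F_eq prod_curve_scale[OF that] using a[of r] by (auto dest: DERIV_imp_deriv)
  qed
  have tf: "test_function m (F r)" for r
    unfolding F_def
  proof (rule test_function_prod_curve[where R="1 / a r"])
    have sU: "smooth_curve (U r i)" for i
      unfolding U_def[abs_def] by (rule smooth_curve_scale[OF su])
    have "smooth_curve (\<lambda>t. complex_of_real (1 / a r) * U r k t)"
      by (intro smooth_curve_intros(1,4) sU)
    then show "smooth_curve (((U r)(k := \<lambda>t. complex_of_real (1 / a r) * U r k t)) i)" for i
      by (cases "i = k") (simp_all only: fun_upd_same fun_upd_other sU not_False_eq_True)
    fix i t assume "\<bar>t\<bar> > 1 / a r"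
    then have "\<bar>a r * t\<bar> > 1"
      using a[of r] by (simp add: abs_mult field_simps)
    then show "((U r)(k := \<lambda>t. complex_of_real (1 / a r) * U r k t)) i t = 0"
      by (auto simp: U_def u_def supp)
  qed
  have u_lim: "(\<lambda>r. u i (a r * t)) \<longlonglongrightarrow> u i 0" and v_lim: "(\<lambda>r. v i (a r * t)) \<longlonglongrightarrow> v i 0" for i t
  proof -
    have c: "isCont (u i) 0" "isCont (v i) 0"
      unfolding u_def[abs_def] v_def[abs_def] using cont by (cases "i = k"; simp add: continuous_intros)+
    show "(\<lambda>r. u i (a r * t)) \<longlonglongrightarrow> u i 0" "(\<lambda>r. v i (a r * t)) \<longlonglongrightarrow> v i 0"
      unfolding a_def by (rule null_scale_tendsto[OF c(1)], rule null_scale_tendsto[OF c(2)])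
  qed
  have lim: "(\<lambda>r. partial_deriv i (F r) x) \<longlonglongrightarrow> (if i = k then 1 else 0)" if "i < m" for i x
  proof -
    define l where "l j = (if j = i then v i 0 else u j 0)" for j
    have "(\<lambda>r. prod_curve m ((U r)(i := \<lambda>t. v i (a r * t))) x) \<longlonglongrightarrow> Re (\<Prod>j<m. l j)"
      by (intro prod_curve_tendsto) (auto simp: l_def U_def u_lim v_lim)
    moreover have "(\<Prod>j<m. l j) = (if i = k then 1 else 0)"
    proof (cases "i = k")
      case True
      then have "l j = 1" for j
        by (simp add: l_def u_def v_def \<theta>0)
      then show ?thesis
        using True by simp
    next
      case False
      then have "l k = 0"
        by (simp add: l_def u_def)
      then show ?thesis
        using False k by (auto intro: prod_zero)
    qed
    ultimately show ?thesis
      by (auto simp: pd[OF that])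
  qed
  have bound: "\<bar>partial_deriv i (F r) x\<bar> \<le> (2 * M) ^ m" if "i < m" for i r x
    unfolding pd[OF that]
  proof (rule prod_curve_bounded)
    fix j
    have "cmod (u j t) \<le> 2 * M" for t
      using M(1,3)[of t] M(5) by (auto simp: u_def)
    moreover have "cmod (v j t) \<le> 2 * M" for t
      using norm_triangle_ineq[of "\<theta> t" "t * \<theta>' t"] M(1,2,4)[of t] M(5) by (auto simp: v_def)
    ultimately show "cmod (((U r)(i := \<lambda>t. v i (a r * t))) j (x j)) \<le> 2 * M"
      by (auto simp: U_def)
  qed
  show ?thesis
    by (rule that[OF tf lim bound])
qed

text \<open>The exponential factors over the coordinates, and each factor gets its own cutoff. The
  derivative of the cutoff carries the scale \<open>a r\<close>, which tends to 0, so values and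
  gradients converge under a common bound.\<close>

lemma exp_cutoff:
  assumes m: "0 < m"
  obtains G B where "\<And>r. test_function m (G r)"
    "\<And>x. (\<lambda>r::nat. G r x) \<longlonglongrightarrow> Re (c * iexp (\<Sum>i<m. h i * x i))"
    "\<And>i x. i < m \<Longrightarrow> (\<lambda>r. partial_deriv i (G r) x) \<longlonglongrightarrow> Re (\<i> * h i * c * iexp (\<Sum>i<m. h i * x i))"
    "\<And>r x. \<bar>G r x\<bar> \<le> B" "\<And>i r x. i < m \<Longrightarrow> \<bar>partial_deriv i (G r) x\<bar> \<le> B"
proof -
  obtain \<theta> \<theta>' :: "real \<Rightarrow> complex" and M where \<theta>: "smooth_curve \<theta>" and d: "\<And>t. (\<theta> has_vector_derivative \<theta>' t) (at t)"
    and supp: "\<And>t. \<bar>t\<bar> > 1 \<Longrightarrow> \<theta> t = 0" and \<theta>0: "\<theta> 0 = 1" and cont: "isCont \<theta> 0" "isCont \<theta>' 0"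
    and M: "\<And>t. cmod (\<theta> t) \<le> M" "\<And>t. cmod (\<theta>' t) \<le> M" "M \<ge> 1"
    using bump_exists by metis
  define a where "a r = inverse (real (Suc r))" for r
  have a: "a r > 0" "a r \<le> 1" for r
    by (simp_all add: a_def inverse_le_1_iff)
  \<comment> \<open>The constant \<open>c\<close> is put into factor 0, which exists because
    \<open>0 < m\<close>.\<close>
  define w where "w i t = (if i = 0 then c else 1) * iexp (h i * t)" for i t
  define g where "g r i t = \<theta> (a r * t) * w i t" for r i t
  define g' where "g' r i t = \<theta> (a r * t) * (\<i> * h i * w i t) + (complex_of_real (a r) * \<theta>' (a r * t)) * w i t" for r i t
  define G where "G r = prod_curve m (g r)" for r
  have dw: "(w i has_vector_derivative \<i> * h i * w i t) (at t)" for i t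
    using has_vector_derivative_mult_right[OF has_vector_derivative_scale[OF has_vector_derivative_iexp, of "h i" t], of "if i = 0 then c else 1"]
    by (simp add: w_def[abs_def] mult_ac)
  have dg: "(g r i has_vector_derivative g' r i t) (at t)" for r i t
    unfolding g_def[abs_def] g'_def by (intro has_vector_derivative_mult has_vector_derivative_scale d dw)
  have pd: "partial_deriv i (G r) = prod_curve m ((g r)(i := g' r i))" if "i < m" for i r
    unfolding G_def by (rule partial_deriv_prod_curve[OF that dg])
  have tf: "test_function m (G r)" for r
    unfolding G_def
  proof (rule test_function_prod_curve[where R="1 / a r"])
    show "smooth_curve (g r i)" for i
      unfolding g_def[abs_def] w_def by (intro smooth_curve_intros smooth_curve_scale \<theta>)
    fix i t assume "\<bar>t\<bar> > 1 / a r"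
    then have "\<bar>a r * t\<bar> > 1"
      using a(1)[of r] by (simp add: abs_mult field_simps)
    then show "g r i t = 0"
      by (simp add: g_def supp)
  qed
  have prod_w: "(\<Prod>i<m. w i (x i)) = c * iexp (\<Sum>i<m. h i * x i)" for x
  proof -
    have "(\<Prod>i<m. w i (x i)) = (\<Prod>i<m. if i = 0 then c else 1) * (\<Prod>i<m. iexp (h i * x i))"
      by (simp add: w_def prod.distrib)
    also have "(\<Prod>i<m. if i = 0 then c else 1) = c"
      using m by (simp add: prod.delta)
    also have "(\<Prod>i<m. iexp (h i * x i)) = iexp (\<Sum>i<m. h i * x i)"
      by (simp add: exp_sum sum_distrib_left)
    finally show ?thesis .
  qed
  have a0: "a \<longlonglongrightarrow> 0"
    unfolding a_def[abs_def] by (rule LIMSEQ_inverse_real_of_nat)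
  have g_lim: "(\<lambda>r. g r i t) \<longlonglongrightarrow> w i t" for i t
    using tendsto_mult_right[OF null_scale_tendsto[OF cont(1), of t], of "w i t"] by (simp add: g_def a_def \<theta>0)
  have g'_lim: "(\<lambda>r. g' r i t) \<longlonglongrightarrow> \<i> * h i * w i t" for i t
  proof -
    have "(\<lambda>r. g' r i t) \<longlonglongrightarrow> \<theta> 0 * (\<i> * h i * w i t) + (complex_of_real 0 * \<theta>' 0) * w i t"
      unfolding g'_def using null_scale_tendsto[OF cont(1), of t] null_scale_tendsto[OF cont(2), of t]
      by (intro tendsto_intros a0) (simp_all add: a_def)
    then show ?thesis
      by (simp add: \<theta>0)
  qed
  have G_lim: "(\<lambda>r. G r x) \<longlonglongrightarrow> Re (c * iexp (\<Sum>i<m. h i * x i))" for x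
    unfolding G_def prod_w[symmetric] by (intro prod_curve_tendsto g_lim)
  have pd_lim: "(\<lambda>r. partial_deriv i (G r) x) \<longlonglongrightarrow> Re (\<i> * h i * c * iexp (\<Sum>i<m. h i * x i))" if "i < m" for i x
  proof -
    define l where "l j = (if j = i then \<i> * h i * w i (x i) else w j (x j))" for j
    have "(\<lambda>r. prod_curve m ((g r)(i := g' r i)) x) \<longlonglongrightarrow> Re (\<Prod>j<m. l j)"
      by (intro prod_curve_tendsto) (auto simp: l_def g_lim g'_lim)
    moreover have "(\<Prod>j<m. l j) = \<i> * h i * (\<Prod>j<m. w j (x j))"
      using that by (subst (1 2) prod.remove[of _ i]) (auto simp: l_def mult.assoc intro!: prod.cong)
    ultimately show ?thesis
      by (simp add: pd[OF that] prod_w mult.assoc)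
  qed
  \<comment> \<open>The last factor pays for the derivative of the exponential; \<open>K\<close>
    bounds every factor, differentiated or not, and \<open>K ^ m\<close> the products.\<close>
  define K where "K = (1 + cmod c) * M * (1 + (\<Sum>i<m. \<bar>h i\<bar>))"
  have w_le: "cmod (w i t) \<le> 1 + cmod c" for i t
    by (auto simp: w_def norm_mult)
  have K1: "cmod (g r i t) \<le> K" for r i t
  proof -
    have "cmod (g r i t) \<le> M * (1 + cmod c)"
      unfolding g_def norm_mult using M by (intro mult_mono w_le) auto
    also have "\<dots> \<le> M * (1 + cmod c) * (1 + (\<Sum>i<m. \<bar>h i\<bar>))"
      using M(3) mult_left_mono[of 1 "1 + (\<Sum>i<m. \<bar>h i\<bar>)" "M * (1 + cmod c)"] by (simp add: sum_nonneg)
    finally show ?thesis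
      by (simp add: K_def mult_ac)
  qed
  have K2: "cmod (g' r i t) \<le> K" if "i < m" for r i t
  proof -
    have hi: "\<bar>h i\<bar> \<le> (\<Sum>i<m. \<bar>h i\<bar>)"
      using that by (intro member_le_sum) auto
    have "cmod (g' r i t) \<le> cmod (\<theta> (a r * t) * (\<i> * h i * w i t)) + cmod ((complex_of_real (a r) * \<theta>' (a r * t)) * w i t)"
      unfolding g'_def by (rule norm_triangle_ineq)
    also have "\<dots> \<le> M * (\<bar>h i\<bar> * (1 + cmod c)) + (1 * M) * (1 + cmod c)"
      unfolding norm_mult using M a[of r] by (intro add_mono mult_mono w_le mult_nonneg_nonneg) auto
    also have "\<dots> = (1 + cmod c) * M * (1 + \<bar>h i\<bar>)"
      by (simp add: algebra_simps)
    also have "\<dots> \<le> K"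
      unfolding K_def using M(3) hi by (intro mult_left_mono) auto
    finally show ?thesis .
  qed
  have G_le: "\<bar>G r x\<bar> \<le> K ^ m" for r x
    unfolding G_def by (rule prod_curve_bounded[OF K1])
  have pd_le: "\<bar>partial_deriv i (G r) x\<bar> \<le> K ^ m" if "i < m" for i r x
    unfolding pd[OF that] by (rule prod_curve_bounded) (auto simp: K1 K2)
  show ?thesis
    by (rule that[OF tf G_lim pd_lim G_le pd_le])
qed

section \<open>The characteristic function of a KMS measure\<close>

context gaussian_sobolev
begin

text \<open>The integrability in \<open>kms_measure\<close> concerns the functions
  \<open>\<langle>\<phi>, X(\<cdot>)\<rangle>\<close>; for \<open>\<phi>\<close> the conjugate basis
  vector of the same mode, this function is a nonzero multiple of coordinate
  \<open>j\<close>.\<close>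

lemma coord_integrable:
  assumes kms: "kms_measure I e \<iota> (field_iH_tests D H I e s) (field_iH H \<iota>) \<beta> \<mu>"
    and j: "j div 2 \<in> I"
  shows "integrable \<mu> (coord j)"
proof -
  have test: "bas i \<in> field_iH_tests D H I e s" for i
    using proj_in_sobolev[of "Suc i" "kap i *\<^sub>R bas i" s]
    by (simp add: field_iH_tests_def bas_in_sobolev bas_in_D H_bas linear_cmul[OF linear_proj] proj_bas)
  have scaled: "integrable \<mu> (coord j)" if "\<i> *\<^sub>C bas i = a *\<^sub>R bas j" "a \<noteq> 0" for i a
  proof -
    have "riesz (\<i> *\<^sub>C H (bas i)) ((kap i * a) *\<^sub>R riesz_bas j)"
      using riesz_scaleR[OF riesz_bas, of "kap i * a" j] that(1) by (simp add: H_bas scaleC_scaleR)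
    then have "field_iH H \<iota> (bas i) = (\<lambda>u. (kap i * a) * coord j u)"
      unfolding field_iH_def by (simp add: riesz_dual_pairing coord_def fun_eq_iff)
    then have "integrable \<mu> (\<lambda>u. (kap i * a) * coord j u)"
      using kms test[of i] unfolding kms_measure_def by metis
    then show ?thesis
      using that(2) kap_pos[of i] by (simp add: integrable_mult_left_iff)
  qed
  show ?thesis
  proof (cases "even j")
    case True
    then obtain k where "j = 2 * k"
      by (elim evenE)
    then show ?thesis
      using scaled[of "Suc (2 * k)" "- 1"] by (simp add: i_bas)
  next
    case False
    then obtain k where "j = Suc (2 * k)"
      by (metis oddE Suc_eq_plus1)
    then show ?thesis
      using scaled[of "2 * k" 1] by (simp add: i_bas)
  qed
qed

lemma cyl_proj_coord:
  assumes "{..<n} \<subseteq> I" "j < n"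
  shows "cyl_proj e \<iota> n u j = coord (2 * j) u" "cyl_proj e \<iota> n u (n + j) = coord (Suc (2 * j)) u"
  using assms(2) by (simp_all add: cyl_proj_eq[OF assms(1)])

text \<open>The eigenvalue belonging to coordinate \<open>i\<close> in the block order of
  \<open>cyl_proj\<close>.\<close>

definition eig :: "nat \<Rightarrow> nat \<Rightarrow> real" where
  "eig n i = lam (if i < n then i else i - n)"

context
  fixes \<mu> :: "'b measure" and n :: nat
  assumes kms: "kms_measure I e \<iota> (field_iH_tests D H I e s) (field_iH H \<iota>) \<beta> \<mu>"
    and n: "{..<n} \<subseteq> I" "0 < n"
begin

interpretation \<mu>: prob_space \<mu>
  using kms by (simp add: kms_measure_def)

abbreviation cyl :: "nat \<Rightarrow> 'b \<Rightarrow> real" where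
  "cyl i u \<equiv> cyl_proj e \<iota> n u i"

lemma borel_measurable_kms: "continuous_on UNIV f \<Longrightarrow> f \<in> borel_measurable \<mu>" for f :: "'b \<Rightarrow> 'c::topological_space"
  using borel_measurable_continuous_onI[of f] kms unfolding kms_measure_def by (simp cong: measurable_cong_sets)

lemma cyl_continuous: "continuous_on UNIV (cyl i)"
  by (rule continuous_on_product_then_coordinatewise[OF continuous_cyl_proj[OF n(1)]])

lemma cyl_integrable: "i < 2 * n \<Longrightarrow> integrable \<mu> (cyl i)"
proof (cases "i < n")
  case True
  then have "cyl i = coord (2 * i)"
    by (auto simp: cyl_proj_coord[OF n(1)])
  then show ?thesis
    using True n coord_integrable[OF kms, of "2 * i"] by auto
next
  case False
  assume "i < 2 * n"
  with False have "i - n < n" "n + (i - n) = i"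
    by auto
  then have "cyl i = coord (Suc (2 * (i - n)))"
    using cyl_proj_coord(2)[OF n(1), of "i - n"] by auto
  then show ?thesis
    using \<open>i - n < n\<close> n coord_integrable[OF kms, of "Suc (2 * (i - n))"] by auto
qed

text \<open>The KMS condition is tested with the \<open>k\<close>-th coordinate, where \<open>k\<close> is conjugate to \<open>i\<close>, and an
  exponential, both cut off; the cutoff is removed by dominated convergence.\<close>

lemma kms_real_identity:
  assumes i: "i < 2 * n"
  shows "\<beta> * eig n i * (LINT u|\<mu>. cyl i u * Re (c * iexp (\<Sum>l<2 * n. h l * cyl l u))) =
    (LINT u|\<mu>. Re (\<i> * h i * c * iexp (\<Sum>l<2 * n. h l * cyl l u)))"
proof -
  \<comment> \<open>\<open>k\<close> is the coordinate conjugate to \<open>i\<close>, and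
    \<open>\<epsilon>\<close> the sign with which the pair enters; it appears on both sides and
    cancels at the end.\<close>
  define k where "k = (if i < n then n + i else i - n)"
  define \<epsilon> :: real where "\<epsilon> = (if i < n then - 1 else 1)"
  have k: "k < 2 * n"
    using i by (auto simp: k_def)
  define Y where "Y u = (\<Sum>l<2 * n. h l * cyl l u)" for u
  obtain F A where F: "\<And>r. test_function (2 * n) (F r)"
    "\<And>i x. i < 2 * n \<Longrightarrow> (\<lambda>r::nat. partial_deriv i (F r) x) \<longlonglongrightarrow> (if i = k then 1 else 0)"
    "\<And>i r x. i < 2 * n \<Longrightarrow> \<bar>partial_deriv i (F r) x\<bar> \<le> A"
  proof -
    show thesis
      by (rule linear_cutoff[OF k]) (rule that; assumption)
  qed
  have n2: "0 < 2 * n"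
    using n(2) by simp
  obtain G B where G: "\<And>r. test_function (2 * n) (G r)"
    "\<And>x. (\<lambda>r::nat. G r x) \<longlonglongrightarrow> Re (c * iexp (\<Sum>l<2 * n. h l * x l))"
    "\<And>i x. i < 2 * n \<Longrightarrow> (\<lambda>r. partial_deriv i (G r) x) \<longlonglongrightarrow> Re (\<i> * h i * c * iexp (\<Sum>l<2 * n. h l * x l))"
    "\<And>r x. \<bar>G r x\<bar> \<le> B" "\<And>i r x. i < 2 * n \<Longrightarrow> \<bar>partial_deriv i (G r) x\<bar> \<le> B"
  proof -
    show thesis
      by (rule exp_cutoff[OF n2, of c h]) (rule that; assumption)
  qed
  have AB: "A \<ge> 0" "B \<ge> 0"
    using F(3)[OF k, of 0 "\<lambda>_. 0"] G(4)[of 0 "\<lambda>_. 0"] by auto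
  let ?P = "cyl_proj e \<iota> n"
  let ?L = "\<lambda>i u. Re (\<i> * h i * c * iexp (Y u))"
  define S where "S r u = (\<Sum>j<n. partial_deriv j (F r) (?P u) * partial_deriv (n + j) (G r) (?P u)
      - partial_deriv (n + j) (F r) (?P u) * partial_deriv j (G r) (?P u))" for r u
  define X where "X r u = (\<Sum>j<n. lam j * (partial_deriv j (F r) (?P u) * cyl (n + j) u
      - partial_deriv (n + j) (F r) (?P u) * cyl j u))" for r u
  have tf: "test_function (2 * n) (partial_deriv j (F r))" "test_function (2 * n) (partial_deriv j (G r))" if "j < 2 * n" for j r
    using that by (auto intro!: test_function_partial_deriv F(1) G(1))
  have cont: "continuous_on UNIV (\<lambda>u. \<phi> (?P u))" if "test_function (2 * n) \<phi>" for \<phi>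
    by (intro continuous_cylindrical n(1) test_function_continuous[OF that])
  have KMS: "(LINT u|\<mu>. S r u) = \<beta> * (LINT u|\<mu>. X r u * G r (?P u))" for r
  proof -
    have "(LINT u|\<mu>. sigma (cyl_gradient e \<iota> n (F r) u) (cyl_gradient e \<iota> n (G r) u)) =
        \<beta> * (LINT u|\<mu>. field_iH H \<iota> (cyl_gradient e \<iota> n (F r) u) u * G r (?P u))"
      using kms n F(1) G(1) unfolding kms_measure_def by blast
    moreover have "sigma (cyl_gradient e \<iota> n (F r) u) (cyl_gradient e \<iota> n (G r) u) = S r u" for u
      unfolding sigma_cyl_gradient[OF n(1) n(1)] S_def by (intro sum.cong) auto
    moreover have "field_iH H \<iota> (cyl_gradient e \<iota> n (F r) u) u = X r u" for u
      unfolding field_iH_cyl_gradient[OF n(1)] X_def by (intro sum.cong) (auto simp: cyl_proj_coord[OF n(1)])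
    ultimately show ?thesis
      by simp
  qed
  have cY: "continuous_on UNIV Y"
    unfolding Y_def by (intro continuous_intros cyl_continuous)
  have "(\<lambda>r. LINT u|\<mu>. S r u) \<longlonglongrightarrow> (LINT u|\<mu>. \<epsilon> * ?L i u)"
  \<comment> \<open>Both gradients are bounded uniformly in the cutoff, by \<open>A\<close> and
    \<open>B\<close>, so a constant dominates.\<close>
  proof (rule integral_dominated_convergence[where w="\<lambda>u. real n * (A * B + A * B)"])
    show "(\<lambda>u. \<epsilon> * ?L i u) \<in> borel_measurable \<mu>"
      by (intro borel_measurable_kms continuous_intros cY)
    show "S r \<in> borel_measurable \<mu>" for r
      unfolding S_def by (intro borel_measurable_kms continuous_intros cont tf) auto
    show "AE u in \<mu>. (\<lambda>r. S r u) \<longlonglongrightarrow> \<epsilon> * ?L i u"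
    proof (intro AE_I2)
      fix u
      have "(\<lambda>r. S r u) \<longlonglongrightarrow> (\<Sum>j<n. (if j = k then 1 else 0) * ?L (n + j) u - (if n + j = k then 1 else 0) * ?L j u)"
        unfolding S_def Y_def by (intro tendsto_intros F(2) G(3)) auto
      also have "(\<Sum>j<n. (if j = k then 1 else 0) * ?L (n + j) u - (if n + j = k then 1 else 0) * ?L j u) =
          (\<Sum>j<n. if j = (if i < n then i else i - n) then \<epsilon> * ?L i u else 0)"
        using i by (intro sum.cong) (auto simp: k_def \<epsilon>_def)
      also have "\<dots> = \<epsilon> * ?L i u"
        using i by auto
      finally show "(\<lambda>r. S r u) \<longlonglongrightarrow> \<epsilon> * ?L i u" .
    qed
    have "norm (S r u) \<le> real n * (A * B + A * B)" for r u
    proof -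
      have "norm (S r u) \<le> (\<Sum>j<n. A * B + A * B)"
        unfolding S_def
      proof (rule sum_norm_le)
        fix j assume "j \<in> {..<n}"
        then have j: "j < 2 * n" "n + j < 2 * n"
          by auto
        show "norm (partial_deriv j (F r) (?P u) * partial_deriv (n + j) (G r) (?P u)
            - partial_deriv (n + j) (F r) (?P u) * partial_deriv j (G r) (?P u)) \<le> A * B + A * B"
          by (rule order_trans[OF norm_triangle_ineq4]; unfold real_norm_def abs_mult)
             (intro add_mono mult_mono F(3) G(5) j AB abs_ge_zero)
      qed
      then show ?thesis
        by simp
    qed
    then show "AE u in \<mu>. norm (S r u) \<le> real n * (A * B + A * B)" for r
      by simp
  qed simp
  moreover have "(\<lambda>r. LINT u|\<mu>. X r u * G r (?P u)) \<longlonglongrightarrow> (LINT u|\<mu>. \<epsilon> * eig n i * cyl i u * Re (c * iexp (Y u)))"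
  \<comment> \<open>The vector field is linear in the coordinates, whose absolute values are
    integrable; this is where the first moments enter.\<close>
  proof (rule integral_dominated_convergence[where w="\<lambda>u. (\<Sum>j<n. lam j * (A * \<bar>cyl (n + j) u\<bar> + A * \<bar>cyl j u\<bar>)) * B"])
    show "(\<lambda>u. \<epsilon> * eig n i * cyl i u * Re (c * iexp (Y u))) \<in> borel_measurable \<mu>"
      by (intro borel_measurable_kms continuous_intros cY cyl_continuous)
    show "(\<lambda>u. X r u * G r (?P u)) \<in> borel_measurable \<mu>" for r
      unfolding X_def by (intro borel_measurable_kms continuous_intros cont tf G(1) cyl_continuous) auto
    show "integrable \<mu> (\<lambda>u. (\<Sum>j<n. lam j * (A * \<bar>cyl (n + j) u\<bar> + A * \<bar>cyl j u\<bar>)) * B)"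
      by (intro integrable_mult_left Bochner_Integration.integrable_sum integrable_mult_right
          Bochner_Integration.integrable_add integrable_abs cyl_integrable) auto
    show "AE u in \<mu>. (\<lambda>r. X r u * G r (?P u)) \<longlonglongrightarrow> \<epsilon> * eig n i * cyl i u * Re (c * iexp (Y u))"
    proof (intro AE_I2)
      fix u
      have "(\<lambda>r. X r u * G r (?P u)) \<longlonglongrightarrow> (\<Sum>j<n. lam j * ((if j = k then 1 else 0) * cyl (n + j) u - (if n + j = k then 1 else 0) * cyl j u)) * Re (c * iexp (Y u))"
        unfolding X_def Y_def by (intro tendsto_intros F(2) G(2)) auto
      also have "(\<Sum>j<n. lam j * ((if j = k then 1 else 0) * cyl (n + j) u - (if n + j = k then 1 else 0) * cyl j u)) =
          (\<Sum>j<n. if j = (if i < n then i else i - n) then \<epsilon> * eig n i * cyl i u else 0)"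
        using i by (intro sum.cong) (auto simp: k_def \<epsilon>_def eig_def)
      also have "\<dots> = \<epsilon> * eig n i * cyl i u"
        using i by auto
      finally show "(\<lambda>r. X r u * G r (?P u)) \<longlonglongrightarrow> \<epsilon> * eig n i * cyl i u * Re (c * iexp (Y u))" .
    qed
    have "norm (X r u * G r (?P u)) \<le> (\<Sum>j<n. lam j * (A * \<bar>cyl (n + j) u\<bar> + A * \<bar>cyl j u\<bar>)) * B" for r u
      unfolding norm_mult
    proof (intro mult_mono)
      show "norm (X r u) \<le> (\<Sum>j<n. lam j * (A * \<bar>cyl (n + j) u\<bar> + A * \<bar>cyl j u\<bar>))"
        unfolding X_def
      proof (rule sum_norm_le)
        fix j assume "j \<in> {..<n}"
        then have j: "j < 2 * n" "n + j < 2 * n"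
          by auto
        have "norm (partial_deriv j (F r) (?P u) * cyl (n + j) u - partial_deriv (n + j) (F r) (?P u) * cyl j u) \<le>
            A * \<bar>cyl (n + j) u\<bar> + A * \<bar>cyl j u\<bar>"
          by (rule order_trans[OF norm_triangle_ineq4]; unfold real_norm_def abs_mult)
             (intro add_mono mult_right_mono F(3) j abs_ge_zero)
        then show "norm (lam j * (partial_deriv j (F r) (?P u) * cyl (n + j) u - partial_deriv (n + j) (F r) (?P u) * cyl j u)) \<le>
            lam j * (A * \<bar>cyl (n + j) u\<bar> + A * \<bar>cyl j u\<bar>)"
          unfolding norm_mult[of "lam j"] using lam_pos[of j] by (simp add: mult_left_mono)
      qed
    qed (use G(4) AB less_imp_le[OF lam_pos] in \<open>auto intro!: sum_nonneg mult_nonneg_nonneg add_nonneg_nonneg\<close>)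
    then show "AE u in \<mu>. norm (X r u * G r (?P u)) \<le> (\<Sum>j<n. lam j * (A * \<bar>cyl (n + j) u\<bar> + A * \<bar>cyl j u\<bar>)) * B" for r
      by simp
  qed
  ultimately have "(LINT u|\<mu>. \<epsilon> * ?L i u) = \<beta> * (LINT u|\<mu>. \<epsilon> * eig n i * cyl i u * Re (c * iexp (Y u)))"
    unfolding KMS by (intro LIMSEQ_unique[OF _ tendsto_mult_left])
  then have "\<epsilon> * (LINT u|\<mu>. ?L i u) = \<epsilon> * (\<beta> * eig n i * (LINT u|\<mu>. cyl i u * Re (c * iexp (Y u))))"
    by (simp add: mult.assoc mult.left_commute[of \<beta> \<epsilon>])
  moreover have "\<epsilon> \<noteq> 0"
    by (simp add: \<epsilon>_def)
  ultimately show ?thesis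
    by (simp add: Y_def)
qed

text \<open>The real identity with \<open>c = 1\<close> and with \<open>c = - \<i>\<close> gives the
  real and the imaginary part of the complex one.\<close>

lemma kms_identity:
  assumes i: "i < 2 * n"
  shows "(LINT u|\<mu>. cyl i u * iexp (\<Sum>l<2 * n. h l * cyl l u)) =
    \<i> * (h i / (\<beta> * eig n i)) * (LINT u|\<mu>. iexp (\<Sum>l<2 * n. h l * cyl l u))"
proof -
  define E where "E u = iexp (\<Sum>l<2 * n. h l * cyl l u)" for u
  have cE: "continuous_on UNIV E"
    unfolding E_def by (intro continuous_intros cyl_continuous)
  have intE: "integrable \<mu> E"
  proof (rule \<mu>.integrable_const_bound[where B=1])
    show "E \<in> borel_measurable \<mu>"
      by (rule borel_measurable_kms[OF cE])
  qed (simp add: E_def)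
  have intxE: "integrable \<mu> (\<lambda>u. complex_of_real (cyl i u) * E u)"
  proof (rule Bochner_Integration.integrable_bound[OF cyl_integrable[OF i]])
    show "(\<lambda>u. complex_of_real (cyl i u) * E u) \<in> borel_measurable \<mu>"
      by (intro borel_measurable_kms continuous_intros cyl_continuous cE)
  qed (simp add: E_def norm_mult)
  define q where "q = h i / (\<beta> * eig n i)"
  have "\<beta> * eig n i \<noteq> 0"
    using \<beta>_pos lam_pos by (simp add: eig_def less_imp_neq[symmetric])
  then have div: "v = q * w" if "\<beta> * eig n i * v = h i * w" for v w
    using that by (simp add: q_def field_simps)
  have re: "(LINT u|\<mu>. cyl i u * Re (E u)) = q * - (LINT u|\<mu>. Im (E u))"
    by (rule div) (use kms_real_identity[OF i, of 1 h, folded E_def] in simp)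
  have im: "(LINT u|\<mu>. cyl i u * Im (E u)) = q * (LINT u|\<mu>. Re (E u))"
    by (rule div) (use kms_real_identity[OF i, of "- \<i>" h, folded E_def] in simp)
  have "(LINT u|\<mu>. complex_of_real (cyl i u) * E u) = \<i> * complex_of_real q * (LINT u|\<mu>. E u)"
  proof (rule complex_eqI)
    have "Re (LINT u|\<mu>. complex_of_real (cyl i u) * E u) = (LINT u|\<mu>. cyl i u * Re (E u))"
      using integral_Re[OF intxE] by simp
    then show "Re (LINT u|\<mu>. complex_of_real (cyl i u) * E u) = Re (\<i> * complex_of_real q * (LINT u|\<mu>. E u))"
      using re integral_Im[OF intE] by simp
    have "Im (LINT u|\<mu>. complex_of_real (cyl i u) * E u) = (LINT u|\<mu>. cyl i u * Im (E u))"
      using integral_Im[OF intxE] by simp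
    then show "Im (LINT u|\<mu>. complex_of_real (cyl i u) * E u) = Im (\<i> * complex_of_real q * (LINT u|\<mu>. E u))"
      using im integral_Re[OF intE] by simp
  qed
  then show ?thesis
    by (simp only: E_def q_def)
qed

text \<open>The preceding identity with \<open>t * h l\<close> in place of \<open>h l\<close>
  expresses every term of the derivative of \<open>S\<close> through \<open>S t\<close>; their sum
  is the equation solved by \<open>gaussian_ode\<close>.\<close>

lemma kms_char:
  "(LINT u|\<mu>. iexp (\<Sum>l<2 * n. h l * cyl l u)) = exp (- (\<Sum>l<2 * n. (h l)\<^sup>2 / (\<beta> * eig n l)) / 2)"
proof -
  define Y where "Y u = (\<Sum>l<2 * n. h l * cyl l u)" for u
  define S where "S t = (LINT u|\<mu>. iexp (t * Y u))" for t
  define c where "c = (\<Sum>l<2 * n. (h l)\<^sup>2 / (\<beta> * eig n l))"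
  have cY: "continuous_on UNIV Y"
    unfolding Y_def by (intro continuous_intros cyl_continuous)
  have intY: "integrable \<mu> Y"
    unfolding Y_def by (intro Bochner_Integration.integrable_sum integrable_mult_right cyl_integrable) auto
  have "(S has_vector_derivative - (t * c) *\<^sub>R S t) (at t)" for t
  proof -
    have intxE: "integrable \<mu> (\<lambda>u. complex_of_real (cyl l u) * iexp (t * Y u))" if "l < 2 * n" for l
    proof (rule Bochner_Integration.integrable_bound[OF cyl_integrable[OF that]])
      show "(\<lambda>u. complex_of_real (cyl l u) * iexp (t * Y u)) \<in> borel_measurable \<mu>"
        by (intro borel_measurable_kms continuous_intros cyl_continuous cY)
    qed (simp add: norm_mult)
    have tY: "t * Y u = (\<Sum>l<2 * n. (t * h l) * cyl l u)" for u
      by (simp add: Y_def sum_distrib_left mult.assoc)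
    have "(LINT u|\<mu>. \<i> * Y u * iexp (t * Y u)) =
        (LINT u|\<mu>. (\<Sum>l<2 * n. (\<i> * h l) * (complex_of_real (cyl l u) * iexp (t * Y u))))"
      by (intro Bochner_Integration.integral_cong refl) (simp add: Y_def sum_distrib_left sum_distrib_right mult_ac)
    also have "\<dots> = (\<Sum>l<2 * n. (\<i> * h l) * (LINT u|\<mu>. complex_of_real (cyl l u) * iexp (t * Y u)))"
      using intxE by (subst Bochner_Integration.integral_sum) (auto intro!: integrable_mult_right)
    also have "\<dots> = (\<Sum>l<2 * n. (\<i> * h l) * (\<i> * (t * h l / (\<beta> * eig n l)) * S t))"
      using kms_identity[of _ "\<lambda>l. t * h l"] unfolding S_def tY[symmetric] by (intro sum.cong) auto
    also have "\<dots> = - (t * c) *\<^sub>R S t"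
      by (simp add: c_def scaleR_conv_of_real sum_distrib_left sum_distrib_right sum_negf[symmetric] power2_eq_square mult_ac)
    finally have D: "(LINT u|\<mu>. \<i> * Y u * iexp (t * Y u)) = - (t * c) *\<^sub>R S t" .
    have "((\<lambda>r. LINT u|\<mu>. iexp (t * Y u + r * Y u)) has_vector_derivative - (t * c) *\<^sub>R S t) (at (t - t))"
      unfolding D[symmetric] diff_self
      by (intro \<mu>.iexp_integral_has_vector_derivative intY borel_measurable_kms continuous_intros cY)
    from vector_diff_chain_at[where f="\<lambda>r. r - t" and x=t, OF _ this, of 1] show ?thesis
      by (simp add: o_def has_vector_derivative_diff_const S_def[abs_def] distrib_right[symmetric])
  qed
  moreover have "S 0 = 1"
    using \<mu>.prob_space by (simp add: S_def)
  ultimately have "S 1 = exp (- c * 1\<^sup>2 / 2)"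
    by (rule gaussian_ode)
  then show ?thesis
    by (simp add: S_def Y_def c_def)
qed

end

lemma sum_even_odd: "(\<Sum>j<2 * n. f j) = (\<Sum>j<n. f (2 * j) + f (Suc (2 * j)))" for f :: "nat \<Rightarrow> real"
  by (induction n) (simp_all add: algebra_simps)

lemma sum_halves: "(\<Sum>j<2 * n. f j) = (\<Sum>j<n. f j + f (n + j))" for f :: "nat \<Rightarrow> real"
proof -
  have "(\<Sum>j<2 * n. f j) = (\<Sum>j<n + n. f j)"
    by (simp add: mult_2)
  also have "\<dots> = (\<Sum>j<n. f j) + (\<Sum>j=n..<n + n. f j)"
    by (simp add: lessThan_atLeast0 sum.atLeastLessThan_concat)
  also have "(\<Sum>j=n..<n + n. f j) = (\<Sum>j<n. f (n + j))"
    using sum.shift_bounds_nat_ivl[of f 0 n n] by (simp add: lessThan_atLeast0 add.commute)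
  finally show ?thesis
    by (simp add: sum.distrib)
qed

text \<open>A reordering: the block order of \<open>cyl_proj\<close> is matched with the interleaved
  order of \<open>bas\<close>. The empty projection is separate, since the KMS condition is stated
  for \<open>0 < n\<close>.\<close>

lemma kms_measure_char_proj:
  assumes kms: "kms_measure I e \<iota> (field_iH_tests D H I e s) (field_iH H \<iota>) \<beta> \<mu>"
    and n: "{..<n} \<subseteq> I"
  shows "(LINT u|\<mu>. iexp (dual_pairing \<iota> (proj (2 * n) f) u)) = exp (- cov (2 * n) f f / 2)"
proof (cases "n = 0")
  case True
  interpret \<mu>: prob_space \<mu>
    using kms by (simp add: kms_measure_def)
  have "dual_pairing \<iota> (proj 0 f) u = 0" for u
    using dual_pairing_sum_bas[of "\<lambda>_. 0" 0 u] by (simp add: proj_def)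
  then show ?thesis
    using True \<mu>.prob_space by (simp add: cov_def)
next
  case False
  define h where "h i = (if i < n then inner (bas (2 * i)) f else inner (bas (Suc (2 * (i - n)))) f)" for i
  have "(\<Sum>l<2 * n. h l * cyl_proj e \<iota> n u l) = dual_pairing \<iota> (proj (2 * n) f) u" for u
  proof -
    have "dual_pairing \<iota> (proj (2 * n) f) u = (\<Sum>j<2 * n. inner (bas j) f * coord j u)"
      unfolding proj_def dual_pairing_sum_bas by (simp add: dual_pairing_bas coord_def)
    also have "\<dots> = (\<Sum>j<n. inner (bas (2 * j)) f * coord (2 * j) u + inner (bas (Suc (2 * j))) f * coord (Suc (2 * j)) u)"
      by (rule sum_even_odd)
    also have "\<dots> = (\<Sum>j<n. h j * cyl_proj e \<iota> n u j + h (n + j) * cyl_proj e \<iota> n u (n + j))"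
      by (intro sum.cong) (auto simp: h_def cyl_proj_coord[OF n])
    also have "\<dots> = (\<Sum>l<2 * n. h l * cyl_proj e \<iota> n u l)"
      by (rule sum_halves[symmetric])
    finally show ?thesis ..
  qed
  moreover have "(\<Sum>l<2 * n. (h l)\<^sup>2 / (\<beta> * eig n l)) = cov (2 * n) f f"
  proof -
    have "(\<Sum>l<2 * n. (h l)\<^sup>2 / (\<beta> * eig n l)) =
        (\<Sum>j<n. (h j)\<^sup>2 / (\<beta> * eig n j) + (h (n + j))\<^sup>2 / (\<beta> * eig n (n + j)))"
      by (rule sum_halves)
    also have "\<dots> = (\<Sum>j<n. (amp (2 * j) * inner (bas (2 * j)) f)\<^sup>2 + (amp (Suc (2 * j)) * inner (bas (Suc (2 * j))) f)\<^sup>2)"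
      by (intro sum.cong) (auto simp: h_def eig_def power_mult_distrib amp_square kap_def)
    also have "\<dots> = (\<Sum>j<2 * n. (amp j * inner (bas j) f)\<^sup>2)"
      by (rule sum_even_odd[symmetric])
    finally show ?thesis
      by (simp add: cov_def power2_eq_square)
  qed
  ultimately show ?thesis
    using kms_char[OF kms n, of h] False by simp
qed

text \<open>Even projections add one full mode at a time, and their pairings converge pointwise to
  that of \<open>f\<close>; dominated convergence passes to the limit.\<close>

lemma kms_measure_fourier:
  assumes kms: "kms_measure I e \<iota> (field_iH_tests D H I e s) (field_iH H \<iota>) \<beta> \<mu>"
    and f: "f \<in> sobolev H I e s"
  shows "fourier \<iota> \<mu> f = gauss_char f"
proof -
  interpret \<mu>: prob_space \<mu>
    using kms by (simp add: kms_measure_def)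
  have meas: "(\<lambda>u. iexp (dual_pairing \<iota> g u)) \<in> borel_measurable \<mu>" if "g \<in> sobolev H I e s" for g
  proof -
    have "(\<lambda>u. iexp (dual_pairing \<iota> g u)) \<in> borel_measurable borel"
      by (intro borel_measurable_continuous_onI continuous_intros continuous_dual_pairing that)
    then show ?thesis
      using kms by (simp add: kms_measure_def cong: measurable_cong_sets)
  qed
  have char: "(LINT u|\<mu>. iexp (dual_pairing \<iota> (proj (2 * n) f) u)) = exp (- cov (2 * n) f f / 2)" for n
  proof (cases "{..<n} \<subseteq> I")
    case True
    then show ?thesis
      by (rule kms_measure_char_proj[OF kms])
  next
    case False
    \<comment> \<open>In finite dimension all basis vectors beyond the modes below \<open>N\<close>
      are padding, so projections and covariances are constant from there on.\<close>
    then obtain N where N: "I = {..<N}" "N \<le> n"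
      using eigen by (auto simp: eigenbasis_def)
    have zero: "bas j = 0" if "\<not> j < 2 * N" for j
    proof -
      have "j div 2 \<notin> I"
        using that N(1) by auto
      then show ?thesis
        by (simp add: bas_def)
    qed
    have "proj (2 * n) f = proj (2 * N) f"
      unfolding proj_def by (intro sum.mono_neutral_right) (use N(2) zero in auto)
    moreover have "cov (2 * n) f f = cov (2 * N) f f"
      unfolding cov_def by (intro sum.mono_neutral_right) (use N(2) zero in auto)
    ultimately have "proj (2 * n) f = proj (2 * N) f" "cov (2 * n) f f = cov (2 * N) f f"
      by auto
    then show ?thesis
      using kms_measure_char_proj[OF kms, of N f] N(1) by simp
  qed
  have "(\<lambda>n. LINT u|\<mu>. iexp (dual_pairing \<iota> (proj (2 * n) f) u)) \<longlonglongrightarrow> fourier \<iota> \<mu> f"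
    unfolding fourier_def
  proof (rule integral_dominated_convergence[where w="\<lambda>_. 1"])
    show "AE u in \<mu>. (\<lambda>n. iexp (dual_pairing \<iota> (proj (2 * n) f) u)) \<longlonglongrightarrow> iexp (dual_pairing \<iota> f u)"
      by (intro AE_I2 tendsto_intros LIMSEQ_subseq_LIMSEQ[OF dual_pairing_proj_LIMSEQ[OF f], unfolded o_def])
         (auto simp: strict_mono_def)
  qed (auto intro!: meas f proj_in_sobolev)
  moreover have "(\<lambda>n. complex_of_real (exp (- cov (2 * n) f f / 2))) \<longlonglongrightarrow> complex_of_real (gauss_char f)"
  proof -
    have "(\<lambda>n. exp (- cov (2 * n) f f / 2)) \<longlonglongrightarrow> exp (- (Hinv_form f f / \<beta>) / 2)"
      by (intro tendsto_intros LIMSEQ_subseq_LIMSEQ[OF cov_LIMSEQ, unfolded o_def]) (auto simp: strict_mono_def)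
    then show ?thesis
      unfolding gauss_char_def by (intro tendsto_of_real) (simp add: mult.commute)
  qed
  ultimately show ?thesis
    unfolding char by (rule LIMSEQ_unique)
qed

end

section \<open>The equivalence\<close>

context gaussian_sobolev
begin

lemma gauss_char_proj_LIMSEQ: "(\<lambda>n. complex_of_real (gauss_char (proj n f))) \<longlonglongrightarrow> complex_of_real (gauss_char f)"
  using continuous_gauss_char by (intro tendsto_of_real continuous_on_tendsto_compose[OF _ proj_LIMSEQ]) auto

text \<open>The projections of \<open>f\<close> lie in \<open>D\<close>, where the state is known to
  be Gaussian, and converge to \<open>f\<close>; so continuity at the single vector \<open>f\<close>
  is enough.\<close>

lemma fourier_gauss_measure_eq_state:
  fixes \<omega> :: "('a \<Rightarrow> complex) \<Rightarrow> complex"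
  assumes char: "\<And>h. h \<in> D \<Longrightarrow> \<omega> (W0 h) = gauss_char h"
    and f: "f \<in> sobolev H I e s" "f \<in> D \<or> isCont (\<lambda>g. \<omega> (W0 g)) f"
  shows "fourier \<iota> gauss_measure f = \<omega> (W0 f)"
  using f(2)
proof
  assume "f \<in> D"
  then show ?thesis
    by (simp add: fourier_gauss_measure[OF f(1)] char)
next
  assume "isCont (\<lambda>g. \<omega> (W0 g)) f"
  then have "(\<lambda>n. \<omega> (W0 (proj n f))) \<longlonglongrightarrow> \<omega> (W0 f)"
    by (rule isCont_tendsto_compose[OF _ proj_LIMSEQ])
  moreover have "\<omega> (W0 (proj n f)) = gauss_char (proj n f)" for n
    unfolding proj_def by (intro char H_sum_bas)
  ultimately have "\<omega> (W0 f) = gauss_char f"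
    using gauss_char_proj_LIMSEQ[of f] by (simp add: LIMSEQ_unique)
  then show ?thesis
    by (simp add: fourier_gauss_measure[OF f(1)])
qed

lemma extends_fourier_gauss_state:
  assumes "\<And>f. f \<in> sobolev H I e s \<Longrightarrow> fourier \<iota> \<mu> f = gauss_char f"
  shows "extends_fourier H I e s \<iota> \<mu> gauss_state"
  unfolding extends_fourier_def
proof (intro conjI)
  show "\<forall>f\<in>sobolev H I e s. gauss_state (W0 f) = fourier \<iota> \<mu> f"
    by (simp add: assms gauss_state_W0)
  show "continuous_on UNIV (\<lambda>f. gauss_state (W0 f))"
    unfolding gauss_state_W0 by (intro continuous_intros continuous_gauss_char)
  show "clinear_functional_on Weyl_algebra gauss_state"
    using state_gauss_state by (simp add: state_def)
  show "\<exists>C. \<forall>A\<in>Weyl_algebra. \<forall>K. (\<forall>u. cmod (A u) \<le> K) \<longrightarrow> cmod (gauss_state A) \<le> C * K"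
    using gauss_state_bounded by (intro exI[of _ 1]) simp
qed

text \<open>The projections lie in every Sobolev space, so continuity of the extension fixes its
  values at all Weyl functions, and boundedness fixes it on the closure.\<close>

lemma extends_fourier_unique:
  assumes four: "\<And>f. f \<in> sobolev H I e s \<Longrightarrow> fourier \<iota> \<mu> f = gauss_char f"
    and \<omega>: "extends_fourier H I e s \<iota> \<mu> \<omega>" and A: "A \<in> Weyl_algebra"
  shows "\<omega> A = gauss_state A"
proof -
  obtain C where C: "\<And>A K. A \<in> Weyl_algebra \<Longrightarrow> (\<forall>u. cmod (A u) \<le> K) \<Longrightarrow> cmod (\<omega> A) \<le> C * K"
    using \<omega> unfolding extends_fourier_def by blast
  have "\<omega> (W0 f) = gauss_state (W0 f)" for f
  proof -
    have "isCont (\<lambda>g. \<omega> (W0 g)) f"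
      using \<omega> by (simp add: extends_fourier_def continuous_on_eq_continuous_at)
    then have "(\<lambda>n. \<omega> (W0 (proj n f))) \<longlonglongrightarrow> \<omega> (W0 f)"
      by (rule isCont_tendsto_compose[OF _ proj_LIMSEQ])
    moreover have "\<omega> (W0 (proj n f)) = gauss_char (proj n f)" for n
      using \<omega> proj_in_sobolev[of n f s] by (simp add: extends_fourier_def four)
    ultimately show ?thesis
      unfolding gauss_state_W0 using gauss_char_proj_LIMSEQ[of f] by (simp add: LIMSEQ_unique)
  qed
  moreover have "clinear_functional_on Weyl_algebra \<omega>" "clinear_functional_on Weyl_algebra gauss_state"
    using \<omega> state_gauss_state by (simp_all add: extends_fourier_def state_def)
  ultimately show ?thesis
    using Weyl_algebra_functional_unique[of \<omega> C gauss_state 1 A] C gauss_state_bounded A by simp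
qed

end

text \<open>Both witnesses are fixed objects, \<open>gauss_measure\<close> and
  \<open>gauss_state\<close>; the given state or measure enters only through its Fourier transform,
  already known to be Gaussian.\<close>

theorem theorem4p11:
  fixes D :: "'a::complex_hilbert set"
    and H :: "'a \<Rightarrow> 'a"
    and I :: "nat set"
    and e :: "nat \<Rightarrow> 'a"
    and \<iota> :: "'a \<Rightarrow> 'b::{real_inner,complete_space}"
    and PB :: "('a \<Rightarrow> complex) \<Rightarrow> ('a \<Rightarrow> complex) \<Rightarrow> ('a \<Rightarrow> complex)"
    and A0 :: "('a \<Rightarrow> complex) set"
    and \<delta>0 :: "('a \<Rightarrow> complex) \<Rightarrow> ('a \<Rightarrow> complex)"
    and \<beta> s :: real
  assumes "separable_space (euclidean :: 'a topology)"
    and "\<beta> > 0"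
    and "selfadjoint_operator D H"
    and "positive_operator D H"
    and "compact_resolvent D H"
    and "eigenbasis D H I e"
    and "s > 0"
    and "trace_finite H I e (- s)"
    and "neg_sobolev_completion H I e s \<iota>"
    and "poisson_bracket PB"
    and "A0 = fun_span (W0 ` D)"
    and "weak_derivation A0 \<delta>0"
    and "continuous_derivation A0 \<delta>0"
    and "linear_derivation A0 \<delta>0"
    and "pointwise_closed_derivation A0 \<delta>0"
    and "\<forall>f\<in>D. \<delta>0 (W0 f) = (\<lambda>u. \<i> * Phi0 (\<i> *\<^sub>C H f) u * W0 f u)"
  shows
    "(\<forall>\<omega>0. weak_kms_state PB A0 \<delta>0 \<beta> \<omega>0 \<longrightarrow>
        (\<exists>\<mu>0 :: 'b measure.
           kms_measure I e \<iota> (field_iH_tests D H I e s) (field_iH H \<iota>) \<beta> \<mu>0 \<and>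
           (\<forall>f\<in>sobolev H I e s. f \<in> D \<or> isCont (\<lambda>g. \<omega>0 (W0 g)) f \<longrightarrow>
              fourier \<iota> \<mu>0 f = \<omega>0 (W0 f))))
     \<and>
     (\<forall>\<mu>0 :: 'b measure.
        kms_measure I e \<iota> (field_iH_tests D H I e s) (field_iH H \<iota>) \<beta> \<mu>0 \<longrightarrow>
        (\<exists>\<omega>0. extends_fourier H I e s \<iota> \<mu>0 \<omega>0 \<and>
           weak_kms_state PB A0 \<delta>0 \<beta> \<omega>0 \<and>
           (\<forall>\<omega>. extends_fourier H I e s \<iota> \<mu>0 \<omega> \<longrightarrow> (\<forall>A\<in>Weyl_algebra. \<omega> A = \<omega>0 A))))"
proof -
  interpret gaussian_sobolev D H I e s \<beta> \<iota>
    using assms by unfold_locales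
  have \<delta>_lin: "clinear_functional_on A0 (\<lambda>A. \<delta>0 A u)" for u
    using \<open>weak_derivation A0 \<delta>0\<close> by (simp add: weak_derivation_def)
  have \<delta>_W0: "\<delta>0 (W0 f) = (\<lambda>u. \<i> * Phi0 (\<i> *\<^sub>C H f) u * W0 f u)" if "f \<in> D" for f
    using assms that by blast
  show ?thesis
  proof (intro conjI allI impI)
    fix \<omega>0 assume "weak_kms_state PB A0 \<delta>0 \<beta> \<omega>0"
    then have char: "\<omega>0 (W0 h) = gauss_char h" if "h \<in> D" for h
      using weak_kms_state_char[OF \<open>poisson_bracket PB\<close> \<open>A0 = fun_span (W0 ` D)\<close> \<delta>_W0] that by blast
    have "fourier \<iota> gauss_measure f = \<omega>0 (W0 f)"
      if "f \<in> sobolev H I e s" "f \<in> D \<or> isCont (\<lambda>g. \<omega>0 (W0 g)) f" for f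
      by (rule fourier_gauss_measure_eq_state[OF char that])
    then show "\<exists>\<mu>0 :: 'b measure.
           kms_measure I e \<iota> (field_iH_tests D H I e s) (field_iH H \<iota>) \<beta> \<mu>0 \<and>
           (\<forall>f\<in>sobolev H I e s. f \<in> D \<or> isCont (\<lambda>g. \<omega>0 (W0 g)) f \<longrightarrow> fourier \<iota> \<mu>0 f = \<omega>0 (W0 f))"
      by (intro exI[of _ gauss_measure] conjI kms_gauss_measure) blast
  next
    fix \<mu>0 :: "'b measure"
    assume "kms_measure I e \<iota> (field_iH_tests D H I e s) (field_iH H \<iota>) \<beta> \<mu>0"
    then have four: "fourier \<iota> \<mu>0 f = gauss_char f" if "f \<in> sobolev H I e s" for f
      using that by (rule kms_measure_fourier)
    show "\<exists>\<omega>0. extends_fourier H I e s \<iota> \<mu>0 \<omega>0 \<and> weak_kms_state PB A0 \<delta>0 \<beta> \<omega>0 \<and>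
           (\<forall>\<omega>. extends_fourier H I e s \<iota> \<mu>0 \<omega> \<longrightarrow> (\<forall>A\<in>Weyl_algebra. \<omega> A = \<omega>0 A))"
      using extends_fourier_gauss_state[OF four] extends_fourier_unique[OF four]
        weak_kms_gauss_state[OF \<open>poisson_bracket PB\<close> \<open>A0 = fun_span (W0 ` D)\<close> \<delta>_lin \<delta>_W0]
      by (intro exI[of _ gauss_state] conjI allI ballI impI)
  qed
qed

end
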